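(* There is a constant $K$ such that for every $n\ge1$ there exists a true $\mathrm{\Pi}_1$-formula of length at most $Kn$ that implies in $\mathsf{PA}$ every true $\mathrm{\Pi}_1$-formula of length at most $n$.
   Context: $\mathsf{PA}$ is Peano arithmetic; "true" means true in the standard model; the length (size) of a formula is its length as a string of symbols of the language of $\mathsf{PA}$; $\mathrm{\Pi}_1$-formulas here are closed. *)

theory Defs
  imports Main
begin

text \<open>
  First-order arithmetic over the signature \<open>0, S, +, *, \<le>\<close> with equality, with named
  variables and the logical primitives negation, implication and universal quantification.
\<close>

datatype trm =
    Var nat
  | Zero
  | Succ trm
  | Add trm trm
  | Mul trm trm

datatype form =
    Eq trm trm
  | Le trm trm
  | Neg form
  | Imp form form
  | Forall nat form

abbreviation Conj :: "form \<Rightarrow> form \<Rightarrow> form" where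
  "Conj \<phi> \<psi> \<equiv> Neg (Imp \<phi> (Neg \<psi>))"

abbreviation Iff :: "form \<Rightarrow> form \<Rightarrow> form" where
  "Iff \<phi> \<psi> \<equiv> Conj (Imp \<phi> \<psi>) (Imp \<psi> \<phi>)"

abbreviation Exists :: "nat \<Rightarrow> form \<Rightarrow> form" where
  "Exists x \<phi> \<equiv> Neg (Forall x (Neg \<phi>))"


subsection \<open>Formulas as strings\<close>

text \<open>
  The alphabet is finite: the variable with index \<open>i\<close> is the letter \<open>x\<close> followed by \<open>i\<close> primes,
  and thus contributes \<open>i + 1\<close> symbols to the length of a formula.
\<close>

datatype symbol =
    SymX | SymPrime | SymZero | SymSucc | SymAdd | SymMul | SymEq | SymLe
  | SymNeg | SymImp | SymAll | SymOpen | SymClose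

definition var_string :: "nat \<Rightarrow> symbol list" where
  "var_string i = SymX # replicate i SymPrime"

fun trm_string :: "trm \<Rightarrow> symbol list" where
  "trm_string (Var i) = var_string i"
| "trm_string Zero = [SymZero]"
| "trm_string (Succ t) = SymSucc # trm_string t"
| "trm_string (Add s t) = [SymOpen] @ trm_string s @ [SymAdd] @ trm_string t @ [SymClose]"
| "trm_string (Mul s t) = [SymOpen] @ trm_string s @ [SymMul] @ trm_string t @ [SymClose]"

fun form_string :: "form \<Rightarrow> symbol list" where
  "form_string (Eq s t) = trm_string s @ [SymEq] @ trm_string t"
| "form_string (Le s t) = trm_string s @ [SymLe] @ trm_string t"
| "form_string (Neg \<phi>) = SymNeg # form_string \<phi>"
| "form_string (Imp \<phi> \<psi>) = [SymOpen] @ form_string \<phi> @ [SymImp] @ form_string \<psi> @ [SymClose]"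
| "form_string (Forall x \<phi>) = SymAll # var_string x @ form_string \<phi>"

definition form_length :: "form \<Rightarrow> nat" where
  "form_length \<phi> = length (form_string \<phi>)"


subsection \<open>Free variables and substitution\<close>

fun trm_vars :: "trm \<Rightarrow> nat set" where
  "trm_vars (Var i) = {i}"
| "trm_vars Zero = {}"
| "trm_vars (Succ t) = trm_vars t"
| "trm_vars (Add s t) = trm_vars s \<union> trm_vars t"
| "trm_vars (Mul s t) = trm_vars s \<union> trm_vars t"

fun free_vars :: "form \<Rightarrow> nat set" where
  "free_vars (Eq s t) = trm_vars s \<union> trm_vars t"
| "free_vars (Le s t) = trm_vars s \<union> trm_vars t"
| "free_vars (Neg \<phi>) = free_vars \<phi>"
| "free_vars (Imp \<phi> \<psi>) = free_vars \<phi> \<union> free_vars \<psi>"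
| "free_vars (Forall x \<phi>) = free_vars \<phi> - {x}"

definition sentence :: "form \<Rightarrow> bool" where
  "sentence \<phi> \<longleftrightarrow> free_vars \<phi> = {}"

fun trm_subst :: "nat \<Rightarrow> trm \<Rightarrow> trm \<Rightarrow> trm" where
  "trm_subst x t (Var i) = (if i = x then t else Var i)"
| "trm_subst x t Zero = Zero"
| "trm_subst x t (Succ s) = Succ (trm_subst x t s)"
| "trm_subst x t (Add s1 s2) = Add (trm_subst x t s1) (trm_subst x t s2)"
| "trm_subst x t (Mul s1 s2) = Mul (trm_subst x t s1) (trm_subst x t s2)"

text \<open>
  \<open>subst x t \<phi>\<close> replaces the free occurrences of \<open>x\<close> in \<open>\<phi>\<close> by \<open>t\<close>, without renaming bound
  variables; \<open>free_for t x \<phi>\<close> says that no variable of \<open>t\<close> is captured thereby.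
\<close>

fun subst :: "nat \<Rightarrow> trm \<Rightarrow> form \<Rightarrow> form" where
  "subst x t (Eq s1 s2) = Eq (trm_subst x t s1) (trm_subst x t s2)"
| "subst x t (Le s1 s2) = Le (trm_subst x t s1) (trm_subst x t s2)"
| "subst x t (Neg \<phi>) = Neg (subst x t \<phi>)"
| "subst x t (Imp \<phi> \<psi>) = Imp (subst x t \<phi>) (subst x t \<psi>)"
| "subst x t (Forall y \<phi>) = (if y = x then Forall y \<phi> else Forall y (subst x t \<phi>))"

fun free_for :: "trm \<Rightarrow> nat \<Rightarrow> form \<Rightarrow> bool" where
  "free_for t x (Eq s1 s2) \<longleftrightarrow> True"
| "free_for t x (Le s1 s2) \<longleftrightarrow> True"
| "free_for t x (Neg \<phi>) \<longleftrightarrow> free_for t x \<phi>"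
| "free_for t x (Imp \<phi> \<psi>) \<longleftrightarrow> free_for t x \<phi> \<and> free_for t x \<psi>"
| "free_for t x (Forall y \<phi>) \<longleftrightarrow>
     x \<notin> free_vars (Forall y \<phi>) \<or> (y \<notin> trm_vars t \<and> free_for t x \<phi>)"


subsection \<open>Truth in the standard model\<close>

fun trm_val :: "(nat \<Rightarrow> nat) \<Rightarrow> trm \<Rightarrow> nat" where
  "trm_val e (Var i) = e i"
| "trm_val e Zero = 0"
| "trm_val e (Succ t) = Suc (trm_val e t)"
| "trm_val e (Add s t) = trm_val e s + trm_val e t"
| "trm_val e (Mul s t) = trm_val e s * trm_val e t"

fun sat :: "(nat \<Rightarrow> nat) \<Rightarrow> form \<Rightarrow> bool" where
  "sat e (Eq s t) \<longleftrightarrow> trm_val e s = trm_val e t"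
| "sat e (Le s t) \<longleftrightarrow> trm_val e s \<le> trm_val e t"
| "sat e (Neg \<phi>) \<longleftrightarrow> \<not> sat e \<phi>"
| "sat e (Imp \<phi> \<psi>) \<longleftrightarrow> (sat e \<phi> \<longrightarrow> sat e \<psi>)"
| "sat e (Forall x \<phi>) \<longleftrightarrow> (\<forall>m. sat (e(x := m)) \<phi>)"

definition true_form :: "form \<Rightarrow> bool" where
  "true_form \<phi> \<longleftrightarrow> (\<forall>e. sat e \<phi>)"


subsection \<open>Provability in Peano arithmetic\<close>

text \<open>
  Hilbert calculus for first-order logic with equality. The generalization rule is unrestricted,
  so the axioms of a theory \<open>T\<close> count as universally closed.
\<close>

inductive proves :: "form set \<Rightarrow> form \<Rightarrow> bool" (infix "\<turnstile>" 50) for T :: "form set" where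
  axiom: "\<phi> \<in> T \<Longrightarrow> T \<turnstile> \<phi>"
| K: "T \<turnstile> Imp \<phi> (Imp \<psi> \<phi>)"
| S: "T \<turnstile> Imp (Imp \<phi> (Imp \<psi> \<chi>)) (Imp (Imp \<phi> \<psi>) (Imp \<phi> \<chi>))"
| contrapos: "T \<turnstile> Imp (Imp (Neg \<phi>) (Neg \<psi>)) (Imp \<psi> \<phi>)"
| inst: "free_for t x \<phi> \<Longrightarrow> T \<turnstile> Imp (Forall x \<phi>) (subst x t \<phi>)"
| distr: "x \<notin> free_vars \<phi> \<Longrightarrow> T \<turnstile> Imp (Forall x (Imp \<phi> \<psi>)) (Imp \<phi> (Forall x \<psi>))"
| eq_refl: "T \<turnstile> Eq t t"
| eq_subst: "free_for s x \<phi> \<Longrightarrow> free_for t x \<phi> \<Longrightarrow>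
    T \<turnstile> Imp (Eq s t) (Imp (subst x s \<phi>) (subst x t \<phi>))"
| mp: "T \<turnstile> Imp \<phi> \<psi> \<Longrightarrow> T \<turnstile> \<phi> \<Longrightarrow> T \<turnstile> \<psi>"
| gen: "T \<turnstile> \<phi> \<Longrightarrow> T \<turnstile> Forall x \<phi>"

text \<open>
  In the induction scheme \<open>\<phi>\<close> may contain parameters, and substituting \<open>S x\<close> for \<open>x\<close> never
  captures a variable.
\<close>

inductive_set PA :: "form set" where
  succ_nonzero: "Neg (Eq (Succ (Var 0)) Zero) \<in> PA"
| succ_inj: "Imp (Eq (Succ (Var 0)) (Succ (Var 1))) (Eq (Var 0) (Var 1)) \<in> PA"
| add_zero: "Eq (Add (Var 0) Zero) (Var 0) \<in> PA"
| add_succ: "Eq (Add (Var 0) (Succ (Var 1))) (Succ (Add (Var 0) (Var 1))) \<in> PA"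
| mul_zero: "Eq (Mul (Var 0) Zero) Zero \<in> PA"
| mul_succ: "Eq (Mul (Var 0) (Succ (Var 1))) (Add (Mul (Var 0) (Var 1)) (Var 0)) \<in> PA"
| le_def: "Iff (Le (Var 0) (Var 1)) (Exists 2 (Eq (Add (Var 2) (Var 0)) (Var 1))) \<in> PA"
| induction: "Imp (subst x Zero \<phi>)
    (Imp (Forall x (Imp \<phi> (subst x (Succ (Var x)) \<phi>))) (Forall x \<phi>)) \<in> PA"


subsection \<open>Closed \<open>\<Pi>\<^sub>1\<close>-formulas\<close>

text \<open>
  Bounded existential quantifiers are obtained from bounded universal ones by negation.
\<close>

inductive delta0 :: "form \<Rightarrow> bool" where
  "delta0 (Eq s t)"
| "delta0 (Le s t)"
| "delta0 \<phi> \<Longrightarrow> delta0 (Neg \<phi>)"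
| "delta0 \<phi> \<Longrightarrow> delta0 \<psi> \<Longrightarrow> delta0 (Imp \<phi> \<psi>)"
| "x \<notin> trm_vars t \<Longrightarrow> delta0 \<phi> \<Longrightarrow> delta0 (Forall x (Imp (Le (Var x) t) \<phi>))"

inductive pi1 :: "form \<Rightarrow> bool" where
  "delta0 \<phi> \<Longrightarrow> pi1 \<phi>"
| "pi1 \<phi> \<Longrightarrow> pi1 (Forall x \<phi>)"

definition true_pi1_sentence :: "form \<Rightarrow> bool" where
  "true_pi1_sentence \<phi> \<longleftrightarrow> pi1 \<phi> \<and> sentence \<phi> \<and> true_form \<phi>"

end

theory Submission
  imports Defs "HOL-Library.Countable"
begin

text \<open>
  Among the codes up to \<open>B\<close> of refutable sentences let \<open>c\<close> be one whose least refutation is largest.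
  The sentence saying that a code up to \<open>B\<close> that is refuted at all is refuted below \<open>y\<close> whenever \<open>c\<close>
  is refuted below \<open>y\<close> is \<open>\<Pi>\<^sub>1\<close>, true, and has length linear in the number of digits of \<open>B\<close>. Let it hold in a
  model of PA, let \<open>y\<close> be a standard number below which \<open>c\<close> is refuted, and let \<open>d\<close> be the code of a
  sentence that fails in the model. Then \<open>d\<close> is refuted below the standard number \<open>y\<close>, which is a
  bounded fact and so holds in the standard model too: the sentence with code \<open>d\<close> was not true. By
  the completeness theorem, proved here by a Henkin construction, it suffices to argue in models.

  A refutation of \<open>\<forall>x \<delta>(x)\<close> is a table of the values of the subformulas of \<open>\<delta>\<close> under assignments. In
  a model of PA it is coded as a bounded set \<open>{x \<le> w. 1 + (x + 1) b dvd a}\<close>; every bounded definable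
  set has this form, so the true values form a table, while an induction on the standard formula \<open>\<delta>\<close>
  shows that a table whose entries are locally justified contains nothing but true values.
\<close>

subsection \<open>Propositional and predicate reasoning in the calculus\<close>

text \<open>The conjunction of all true sentences of length at most n is far too long, and so is a
  list telling which codes up to \<open>B\<close> are refuted. A single number would do instead: a
  bound y below which every refuted code up to \<open>B\<close> is refuted. It grows faster than any
  computable function of n, so no term of linear length denotes it; but the code whose refutation
  comes last names it with linearly many symbols, as in busy beaver arguments. The antecedent that
  \<open>c\<close> is refuted below y hides this number, and that it holds for some standard y is a
  bounded fact, hence true in every model. Linear length also requires codes with O(n) digits and
  numerals with boundedly many symbols per digit. In the given syntax a variable costs as much as
  its index, so looking it up or quantifying over it has to cost about the same in the coded
  language; this is why a tape machine replaces coded formulas. The evaluator has to be correct only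
  for standard expressions, so all inductions over syntax run outside the model.\<close>

inductive derives :: "form set \<Rightarrow> form set \<Rightarrow> form \<Rightarrow> bool" for T G where
  hyp: "\<phi> \<in> G \<Longrightarrow> derives T G \<phi>"
| provable: "T \<turnstile> \<phi> \<Longrightarrow> derives T G \<phi>"
| mp: "derives T G (Imp \<phi> \<psi>) \<Longrightarrow> derives T G \<phi> \<Longrightarrow> derives T G \<psi>"

lemma derives_mono: "derives T G \<phi> \<Longrightarrow> G \<subseteq> G' \<Longrightarrow> derives T G' \<phi>"
  by (induction rule: derives.induct) (auto intro: derives.intros)

lemma proves_imp_refl: "T \<turnstile> Imp \<phi> \<phi>"
  using proves.S[of T \<phi> "Imp \<phi> \<phi>" \<phi>] proves.K[of T \<phi> "Imp \<phi> \<phi>"] proves.K[of T \<phi> \<phi>]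
  by (blast intro: proves.mp)

lemma derives_K: "derives T G \<phi> \<Longrightarrow> derives T G (Imp \<psi> \<phi>)"
  by (meson derives.mp derives.provable proves.K)

text \<open>Generalization enters \<open>derives\<close> only through theorems of \<open>T\<close>,
  never below hypotheses from \<open>G\<close>; hence there is no side condition on free
  variables.\<close>

lemma derives_deduction: "derives T (insert \<psi> G) \<phi> \<Longrightarrow> derives T G (Imp \<psi> \<phi>)"
proof (induction rule: derives.induct)
  case (hyp \<phi>)
  then show ?case by (metis derives.hyp derives.provable derives_K insertE proves_imp_refl)
next
  case (provable \<phi>)
  then show ?case by (meson derives.provable derives_K)
next
  case (mp \<phi> \<chi>)
  then show ?case by (meson derives.mp derives.provable proves.S)
qed

lemma derives_empty: "derives T {} \<phi> \<Longrightarrow> T \<turnstile> \<phi>"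
  by (induction rule: derives.induct) (auto intro: proves.mp)

lemma derives_finite:
  "derives T G \<phi> \<Longrightarrow> \<exists>G'. finite G' \<and> G' \<subseteq> G \<and> derives T G' \<phi>"
proof (induction rule: derives.induct)
  case (hyp \<phi>)
  then show ?case by (intro exI[of _ "{\<phi>}"]) (auto intro: derives.hyp)
next
  case (provable \<phi>)
  then show ?case by (intro exI[of _ "{}"]) (auto intro: derives.provable)
next
  case (mp \<phi> \<psi>)
  then obtain G1 G2 where "finite G1" "G1 \<subseteq> G" "derives T G1 (Imp \<phi> \<psi>)"
    "finite G2" "G2 \<subseteq> G" "derives T G2 \<phi>" by blast
  then show ?case
    by (intro exI[of _ "G1 \<union> G2"]) (auto intro: derives.mp derives_mono)
qed

lemma derives_exfalso:
  assumes "derives T G \<phi>" "derives T G (Neg \<phi>)" shows "derives T G \<psi>"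
  by (meson assms derives.mp derives.provable derives_K proves.contrapos)

lemma derives_by_contradiction:
  assumes "derives T (insert (Neg \<phi>) G) \<psi>" "derives T (insert (Neg \<phi>) G) (Neg \<psi>)"
  shows "derives T G \<phi>"
proof -
  have "derives T (insert (Neg \<phi>) G) (Neg (Imp \<phi> \<phi>))"
    using assms by (rule derives_exfalso)
  then have "derives T G (Imp (Neg \<phi>) (Neg (Imp \<phi> \<phi>)))"
    by (rule derives_deduction)
  then show ?thesis
    by (meson derives.mp derives.provable proves.contrapos proves_imp_refl)
qed

lemma derives_notI:
  assumes "derives T (insert \<phi> G) \<psi>" "derives T (insert \<phi> G) (Neg \<psi>)"
  shows "derives T G (Neg \<phi>)"
proof (rule derives_by_contradiction)
  let ?G = "insert (Neg (Neg \<phi>)) G"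
  have nn: "derives T ?G \<phi>"
    by (rule derives_by_contradiction[of _ _ _ "Neg \<phi>"]) (auto intro: derives.hyp)
  have *: "derives T ?G \<chi>" if "derives T (insert \<phi> G) \<chi>" for \<chi>
  proof -
    have "derives T ?G (Imp \<phi> \<chi>)"
      using derives_deduction[OF that] derives_mono by blast
    then show ?thesis using nn by (rule derives.mp)
  qed
  show "derives T ?G \<psi>" "derives T ?G (Neg \<psi>)" using assms * by auto
qed

lemma trm_subst_self: "trm_subst x (Var x) t = t"
  by (induction t) auto

lemma subst_self: "subst x (Var x) \<phi> = \<phi>"
  by (induction \<phi>) (auto simp: trm_subst_self)

lemma free_for_self: "free_for (Var x) x \<phi>"
  by (induction \<phi>) auto

text \<open>Restores generalization below hypotheses. At a modus ponens the quantifier is pushed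
  through the implication, which \<open>inst\<close> and \<open>distr\<close> prove in the calculus
  itself.\<close>

lemma derives_gen:
  assumes "derives T G \<phi>" "\<And>\<gamma>. \<gamma> \<in> G \<Longrightarrow> x \<notin> free_vars \<gamma>"
  shows "derives T G (Forall x \<phi>)"
  using assms
proof (induction rule: derives.induct)
  case (hyp \<phi>)
  then have "T \<turnstile> Imp \<phi> (Forall x \<phi>)"
    using proves.distr[of x \<phi>] proves.gen[OF proves_imp_refl] proves.mp by blast
  then show ?case using hyp by (meson derives.hyp derives.mp derives.provable)
next
  case (provable \<phi>)
  then show ?case by (simp add: derives.provable proves.gen)
next
  case (mp \<phi> \<psi>)
  let ?A = "Forall x (Imp \<phi> \<psi>)" and ?B = "Forall x \<phi>"
  have inst: "T \<turnstile> Imp (Forall x \<chi>) \<chi>" for \<chi>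
    using proves.inst[OF free_for_self[of x \<chi>]] by (simp add: subst_self)
  have "derives T {?B, ?A} \<psi>"
    by (meson derives.hyp derives.mp derives.provable insertI1 insertI2 inst)
  then have "T \<turnstile> Imp ?A (Imp ?B \<psi>)"
    by (intro derives_empty derives_deduction)
  then have "T \<turnstile> Imp ?A (Forall x (Imp ?B \<psi>))"
    using proves.gen proves.mp proves.distr[of x ?A T "Imp ?B \<psi>"] by auto
  moreover have "T \<turnstile> Imp (Forall x (Imp ?B \<psi>)) (Imp ?B (Forall x \<psi>))"
    by (rule proves.distr) auto
  ultimately show ?case using mp by (meson derives.mp derives.provable)
qed

section \<open>Bound variables and substitution without capture\<close>

fun bound_vars :: "form \<Rightarrow> nat set" where
  "bound_vars (Eq s t) = {}"
| "bound_vars (Le s t) = {}"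
| "bound_vars (Neg \<phi>) = bound_vars \<phi>"
| "bound_vars (Imp \<phi> \<psi>) = bound_vars \<phi> \<union> bound_vars \<psi>"
| "bound_vars (Forall x \<phi>) = insert x (bound_vars \<phi>)"

lemma finite_trm_vars: "finite (trm_vars t)"
  by (induction t) auto

lemma finite_free_vars: "finite (free_vars \<phi>)"
  by (induction \<phi>) (auto simp: finite_trm_vars)

lemma finite_bound_vars: "finite (bound_vars \<phi>)"
  by (induction \<phi>) auto

lemma bound_vars_subst [simp]: "bound_vars (subst x t \<phi>) = bound_vars \<phi>"
  by (induction \<phi>) auto

lemma trm_vars_subst: "trm_vars (trm_subst x t s) \<subseteq> (trm_vars s - {x}) \<union> trm_vars t"
  by (induction s) auto

lemma free_vars_subst: "free_vars (subst x t \<phi>) \<subseteq> (free_vars \<phi> - {x}) \<union> trm_vars t"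
proof (induction \<phi>)
  case (Eq s1 s2)
  then show ?case using trm_vars_subst[of x t s1] trm_vars_subst[of x t s2] by auto
next
  case (Le s1 s2)
  then show ?case using trm_vars_subst[of x t s1] trm_vars_subst[of x t s2] by auto
qed auto

lemma free_for_disjoint: "trm_vars t \<inter> bound_vars \<phi> = {} \<Longrightarrow> free_for t x \<phi>"
  by (induction \<phi>) auto

lemma trm_subst_idle: "x \<notin> trm_vars s \<Longrightarrow> trm_subst x t s = s"
  by (induction s) auto

lemma subst_idle: "x \<notin> free_vars \<phi> \<Longrightarrow> subst x t \<phi> = \<phi>"
  by (induction \<phi>) (auto simp: trm_subst_idle)

lemma trm_subst_back: "y \<notin> trm_vars s \<Longrightarrow> trm_subst y (Var x) (trm_subst x (Var y) s) = s"
  by (induction s) auto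

lemma subst_back:
  "y \<notin> free_vars \<phi> \<Longrightarrow> y \<notin> bound_vars \<phi> \<Longrightarrow> subst y (Var x) (subst x (Var y) \<phi>) = \<phi>"
  by (induction \<phi>) (auto simp: trm_subst_back subst_idle)

lemma free_for_back:
  "y \<notin> free_vars \<phi> \<Longrightarrow> y \<notin> bound_vars \<phi> \<Longrightarrow> free_for (Var x) y (subst x (Var y) \<phi>)"
proof (induction \<phi>)
  case (Forall z \<phi>)
  then show ?case using free_vars_subst[of x "Var y" \<phi>] 
    by (cases "z = x") (auto intro: free_for_disjoint)
qed auto

text \<open>The Henkin step generalizes over a fresh \<open>y\<close>; this turns the result back
  into the quantifier over \<open>x\<close> whose negation is in the set.\<close>

lemma derives_all_rename:
  assumes "y \<notin> free_vars \<phi>" "y \<notin> bound_vars \<phi>"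
  shows "derives T {Forall y (subst x (Var y) \<phi>)} (Forall x \<phi>)"
proof (rule derives_gen)
  have "T \<turnstile> Imp (Forall y (subst x (Var y) \<phi>)) \<phi>"
    using proves.inst[OF free_for_back[OF assms, of x]] by (simp add: subst_back assms)
  then show "derives T {Forall y (subst x (Var y) \<phi>)} \<phi>"
    by (meson derives.hyp derives.mp derives.provable insertI1)
  show "\<And>\<gamma>. \<gamma> \<in> {Forall y (subst x (Var y) \<phi>)} \<Longrightarrow> x \<notin> free_vars \<gamma>"
    using free_vars_subst[of x "Var y" \<phi>] by auto
qed

subsection \<open>Henkin sets\<close>

definition consistent :: "form set \<Rightarrow> form set \<Rightarrow> bool" where
  "consistent T G \<longleftrightarrow> \<not> (\<exists>\<phi>. derives T G \<phi> \<and> derives T G (Neg \<phi>))"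

lemma consistent_mono: "consistent T G' \<Longrightarrow> G \<subseteq> G' \<Longrightarrow> consistent T G"
  unfolding consistent_def using derives_mono by blast

lemma inconsistent_insertD: "\<not> consistent T (insert \<phi> G) \<Longrightarrow> derives T G (Neg \<phi>)"
  unfolding consistent_def using derives_notI by blast

text \<open>If the counterexample led to a contradiction, the hypotheses would derive the instance
  at \<open>y\<close>. As \<open>y\<close> is free in none of them, it could be generalized, against
  the negated quantifier.\<close>

lemma consistent_witness:
  assumes con: "consistent T (insert (Neg (Forall x \<phi>)) G)"
    and y: "y \<notin> free_vars \<phi>" "y \<notin> bound_vars \<phi>" "\<And>\<gamma>. \<gamma> \<in> G \<Longrightarrow> y \<notin> free_vars \<gamma>"
  shows "consistent T (insert (Neg (subst x (Var y) \<phi>)) (insert (Neg (Forall x \<phi>)) G))"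
proof (rule ccontr)
  let ?G = "insert (Neg (Forall x \<phi>)) G"
  assume "\<not> ?thesis"
  then have "derives T ?G (subst x (Var y) \<phi>)"
    unfolding consistent_def using derives_by_contradiction by blast
  then have "derives T ?G (Forall y (subst x (Var y) \<phi>))"
    by (rule derives_gen) (use y in auto)
  moreover have "derives T ?G (Imp (Forall y (subst x (Var y) \<phi>)) (Forall x \<phi>))"
    by (rule derives_mono[of _ "{}"], rule derives_deduction)
      (use derives_all_rename[OF y(1,2)] in auto)
  ultimately have "derives T ?G (Forall x \<phi>)" using derives.mp by blast
  moreover have "derives T ?G (Neg (Forall x \<phi>))" by (simp add: derives.hyp)
  ultimately show False using con unfolding consistent_def by blast
qed

instance trm :: countable by countable_datatype
instance form :: countable by countable_datatype

text \<open>
  The variables in the range of \<open>h\<close> serve as Henkin constants: they may occur free in the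
  formulas of the Henkin set but are never bound there, so that substituting them is always safe.
\<close>

locale henkin =
  fixes T :: "form set" and \<chi> :: form and h :: "nat \<Rightarrow> nat"
  assumes inj_h: "inj h"
    and not_all: "range h \<noteq> UNIV"
    and sentence: "free_vars \<chi> = {}"
    and bound: "bound_vars \<chi> \<inter> range h = {}"
    and unprovable: "\<not> T \<turnstile> \<chi>"
begin

definition good :: "form \<Rightarrow> bool" where
  "good \<phi> \<longleftrightarrow> bound_vars \<phi> \<inter> range h = {} \<and> free_vars \<phi> \<subseteq> range h"

definition fresh :: "form set \<Rightarrow> nat" where
  "fresh G = (SOME y. y \<in> range h \<and> (\<forall>\<gamma>\<in>G. y \<notin> free_vars \<gamma>))"

definition witnesses :: "form set \<Rightarrow> form \<Rightarrow> form set" where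
  "witnesses G \<theta> = {Neg (subst x (Var (fresh (insert \<theta> G))) \<phi>) | x \<phi>. \<theta> = Neg (Forall x \<phi>)}"

text \<open>Completion and the addition of witnesses happen in one pass: a negated universal formula
  enters together with a counterexample. A fresh Henkin variable is always left, because each stage
  is finite.\<close>

primrec stage :: "nat \<Rightarrow> form set" where
  "stage 0 = {Neg \<chi>}"
| "stage (Suc n) = (let \<theta> = from_nat n in
     if good \<theta> \<and> consistent T (insert \<theta> (stage n))
     then witnesses (stage n) \<theta> \<union> insert \<theta> (stage n) else stage n)"

definition Delta :: "form set" where
  "Delta = (\<Union>n. stage n)"

lemma stage_mono: "m \<le> n \<Longrightarrow> stage m \<subseteq> stage n"
  by (rule lift_Suc_mono_le) (auto simp: Let_def)

lemma fresh:
  assumes "finite G" shows "fresh G \<in> range h" "\<gamma> \<in> G \<Longrightarrow> fresh G \<notin> free_vars \<gamma>"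
proof -
  have "finite (\<Union>\<gamma>\<in>G. free_vars \<gamma>)" using assms finite_free_vars by auto
  moreover have "infinite (range h)" using inj_h finite_imageD by blast
  ultimately have "\<not> range h \<subseteq> (\<Union>\<gamma>\<in>G. free_vars \<gamma>)"
    using finite_subset by auto
  then obtain y where "y \<in> range h" "y \<notin> (\<Union>\<gamma>\<in>G. free_vars \<gamma>)" by blast
  then have "fresh G \<in> range h \<and> (\<forall>\<gamma>\<in>G. fresh G \<notin> free_vars \<gamma>)"
    unfolding fresh_def using someI[of "\<lambda>y. y \<in> range h \<and> (\<forall>\<gamma>\<in>G. y \<notin> free_vars \<gamma>)" y]
    by simp
  then show "fresh G \<in> range h" "\<gamma> \<in> G \<Longrightarrow> fresh G \<notin> free_vars \<gamma>" by auto
qed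

lemma finite_stage: "finite (stage n)"
proof (induction n)
  case (Suc n)
  have "finite (witnesses G \<theta>)" for G \<theta>
  proof (cases "\<exists>x \<phi>. \<theta> = Neg (Forall x \<phi>)")
    case True
    then show ?thesis by (auto simp: witnesses_def)
  next
    case False
    then have "witnesses G \<theta> = {}" by (auto simp: witnesses_def)
    then show ?thesis by simp
  qed
  with Suc show ?case by (auto simp: Let_def)
qed auto

lemma good_stage: "\<phi> \<in> stage n \<Longrightarrow> good \<phi>"
proof (induction n arbitrary: \<phi>)
  case 0
  then show ?case using sentence bound by (auto simp: good_def)
next
  case (Suc n)
  have "good \<phi>" if "good \<theta>" "\<phi> \<in> witnesses (stage n) \<theta>" for \<theta>
  proof -
    from that(2) obtain x \<psi> where \<psi>: "\<theta> = Neg (Forall x \<psi>)"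
      "\<phi> = Neg (subst x (Var (fresh (insert \<theta> (stage n)))) \<psi>)"
      by (auto simp: witnesses_def)
    have "fresh (insert \<theta> (stage n)) \<in> range h" by (simp add: fresh finite_stage)
    with \<psi> that(1) free_vars_subst[of x "Var (fresh (insert \<theta> (stage n)))" \<psi>]
    show ?thesis by (auto simp: good_def)
  qed
  then show ?case using Suc by (auto simp: Let_def split: if_splits)
qed

lemma consistent_stage: "consistent T (stage n)"
proof (induction n)
  case 0
  show ?case
  proof (rule ccontr)
    assume "\<not> ?thesis"
    then have "derives T {} \<chi>"
      unfolding consistent_def using derives_by_contradiction[of T \<chi> "{}"] by auto
    then show False using unprovable derives_empty by blast
  qed
next
  case (Suc n)
  show ?case
  proof (cases "good (from_nat n) \<and> consistent T (insert (from_nat n) (stage n))")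
    case True
    let ?\<theta> = "from_nat n :: form"
    show ?thesis
    proof (cases "\<exists>x \<phi>. ?\<theta> = Neg (Forall x \<phi>)")
      case ex: True
      then obtain x \<phi> where \<theta>: "?\<theta> = Neg (Forall x \<phi>)" by blast
      let ?y = "fresh (insert ?\<theta> (stage n))"
      have y: "?y \<in> range h" "\<And>\<gamma>. \<gamma> \<in> insert ?\<theta> (stage n) \<Longrightarrow> ?y \<notin> free_vars \<gamma>"
        using fresh[of "insert ?\<theta> (stage n)"] finite_stage by auto
      have b: "?y \<notin> bound_vars (Forall x \<phi>)" using True y(1) \<theta> by (auto simp: good_def)
      then have "?y \<notin> free_vars \<phi>" using y(2)[of ?\<theta>] \<theta> by auto
      with b y have "consistent T (insert (Neg (subst x (Var ?y) \<phi>))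
          (insert (Neg (Forall x \<phi>)) (stage n)))"
        using True \<theta> by (intro consistent_witness) auto
      moreover have "witnesses (stage n) ?\<theta> = {Neg (subst x (Var ?y) \<phi>)}"
        using \<theta> by (auto simp: witnesses_def)
      ultimately show ?thesis using True \<theta> by (simp add: Let_def insert_commute)
    next
      case False
      then have "witnesses (stage n) ?\<theta> = {}" by (auto simp: witnesses_def)
      then show ?thesis using True by (simp add: Let_def)
    qed
  next
    case False
    then have "stage (Suc n) = stage n" by (auto simp: Let_def)
    then show ?thesis using Suc by simp
  qed
qed

lemma good_Delta: "\<phi> \<in> Delta \<Longrightarrow> good \<phi>"
  using good_stage by (auto simp: Delta_def)

lemma Delta_derives_stage:
  assumes "derives T Delta \<phi>" shows "\<exists>n. derives T (stage n) \<phi>"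
proof -
  obtain G where G: "finite G" "G \<subseteq> Delta" "derives T G \<phi>"
    using derives_finite[OF assms] by auto
  have "\<exists>n. G \<subseteq> stage n" using G(1,2)
  proof (induction G rule: finite_induct)
    case (insert \<gamma> G)
    then obtain m n where "\<gamma> \<in> stage m" "G \<subseteq> stage n" by (auto simp: Delta_def)
    then have "insert \<gamma> G \<subseteq> stage (max m n)"
      using stage_mono[of m "max m n"] stage_mono[of n "max m n"] by auto
    then show ?case by blast
  qed auto
  then show ?thesis using derives_mono[OF G(3)] by blast
qed

lemma consistent_Delta: "consistent T Delta"
  unfolding consistent_def
proof
  assume "\<exists>\<phi>. derives T Delta \<phi> \<and> derives T Delta (Neg \<phi>)"
  then obtain \<phi> m n where "derives T (stage m) \<phi>" "derives T (stage n) (Neg \<phi>)"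
    using Delta_derives_stage by blast
  then have "derives T (stage (max m n)) \<phi>" "derives T (stage (max m n)) (Neg \<phi>)"
    using derives_mono[OF _ stage_mono[of m "max m n"]] derives_mono[OF _ stage_mono[of n "max m n"]]
    by simp_all
  then show False using consistent_stage unfolding consistent_def by blast
qed

text \<open>The formula was examined at stage \<open>to_nat \<phi>\<close>, and being good it could
  have been turned down only for inconsistency.\<close>

lemma Delta_consistent_insert:
  assumes "good \<phi>" "consistent T (insert \<phi> Delta)" shows "\<phi> \<in> Delta"
proof -
  have "consistent T (insert \<phi> (stage (to_nat \<phi>)))"
    by (rule consistent_mono[OF assms(2)]) (auto simp: Delta_def)
  then have "\<phi> \<in> stage (Suc (to_nat \<phi>))" using assms by (simp add: Let_def)
  then show ?thesis unfolding Delta_def by blast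
qed

lemma Delta_closed: 
  assumes "good \<phi>" "derives T Delta \<phi>" shows "\<phi> \<in> Delta"
proof (rule Delta_consistent_insert[OF assms(1)], rule ccontr)
  assume "\<not> consistent T (insert \<phi> Delta)"
  then have "derives T Delta (Neg \<phi>)" by (rule inconsistent_insertD)
  then show False using assms consistent_Delta unfolding consistent_def by blast
qed

lemma Delta_theorem: "good \<phi> \<Longrightarrow> T \<turnstile> \<phi> \<Longrightarrow> \<phi> \<in> Delta"
  by (simp add: Delta_closed derives.provable)

lemma Delta_mp:
  assumes "Imp \<phi> \<psi> \<in> Delta" "\<phi> \<in> Delta" shows "\<psi> \<in> Delta"
proof (rule Delta_closed)
  show "good \<psi>" using good_Delta[OF assms(1)] by (auto simp: good_def)
  show "derives T Delta \<psi>" by (rule derives.mp[OF derives.hyp derives.hyp]) (fact assms)+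
qed

lemma Delta_Neg: assumes "good \<phi>" shows "Neg \<phi> \<in> Delta \<longleftrightarrow> \<phi> \<notin> Delta"
proof
  show "Neg \<phi> \<in> Delta \<Longrightarrow> \<phi> \<notin> Delta"
    using consistent_Delta derives.hyp unfolding consistent_def by blast
  have "good (Neg \<phi>)" using assms by (simp add: good_def)
  then show "\<phi> \<notin> Delta \<Longrightarrow> Neg \<phi> \<in> Delta"
    using Delta_closed Delta_consistent_insert[OF assms] inconsistent_insertD by blast
qed

lemma Delta_Imp:
  assumes "good \<phi>" "good \<psi>" shows "Imp \<phi> \<psi> \<in> Delta \<longleftrightarrow> (\<phi> \<in> Delta \<longrightarrow> \<psi> \<in> Delta)"
proof
  show "Imp \<phi> \<psi> \<in> Delta \<Longrightarrow> \<phi> \<in> Delta \<longrightarrow> \<psi> \<in> Delta" using Delta_mp by blast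
  have good: "good (Imp \<phi> \<psi>)" using assms by (auto simp: good_def)
  assume "\<phi> \<in> Delta \<longrightarrow> \<psi> \<in> Delta"
  then consider "\<psi> \<in> Delta" | "Neg \<phi> \<in> Delta" using assms Delta_Neg by blast
  then show "Imp \<phi> \<psi> \<in> Delta"
  proof cases
    case 1
    then show ?thesis by (simp add: Delta_closed derives.hyp derives_K good)
  next
    case 2
    have "derives T (insert \<phi> Delta) \<psi>"
      by (rule derives_exfalso[of _ _ \<phi>]) (use 2 in \<open>auto intro: derives.hyp\<close>)
    then show ?thesis by (simp add: Delta_closed derives_deduction good)
  qed
qed

lemma good_subst:
  assumes "good (Forall x \<phi>)" shows "good (subst x (Var (h y)) \<phi>)"
  using assms free_vars_subst[of x "Var (h y)" \<phi>] by (auto simp: good_def)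

lemma Delta_Forall:
  assumes "good (Forall x \<phi>)"
  shows "Forall x \<phi> \<in> Delta \<longleftrightarrow> (\<forall>y. subst x (Var (h y)) \<phi> \<in> Delta)"
proof
  assume *: "Forall x \<phi> \<in> Delta"
  show "\<forall>y. subst x (Var (h y)) \<phi> \<in> Delta"
  proof
    fix y
    have "free_for (Var (h y)) x \<phi>"
      using assms by (intro free_for_disjoint) (auto simp: good_def)
    then have "derives T Delta (subst x (Var (h y)) \<phi>)"
      using * by (meson derives.hyp derives.mp derives.provable proves.inst)
    then show "subst x (Var (h y)) \<phi> \<in> Delta" by (simp add: Delta_closed good_subst assms)
  qed
next
  assume *: "\<forall>y. subst x (Var (h y)) \<phi> \<in> Delta"
  show "Forall x \<phi> \<in> Delta"
  proof (rule ccontr)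
    assume "Forall x \<phi> \<notin> Delta"
    let ?\<theta> = "Neg (Forall x \<phi>)" 
    let ?n = "to_nat ?\<theta>"
    have \<theta>: "?\<theta> \<in> Delta" using Delta_Neg[OF assms] \<open>Forall x \<phi> \<notin> Delta\<close> by simp
    have "consistent T (insert ?\<theta> (stage ?n))"
      by (rule consistent_mono[OF consistent_Delta]) (use \<theta> in \<open>auto simp: Delta_def\<close>)
    moreover have "good ?\<theta>" using assms by (simp add: good_def)
    ultimately have "witnesses (stage ?n) ?\<theta> \<subseteq> stage (Suc ?n)" by (auto simp: Let_def)
    then have w: "Neg (subst x (Var (fresh (insert ?\<theta> (stage ?n)))) \<phi>) \<in> Delta"
      unfolding witnesses_def Delta_def by blast
    have "fresh (insert ?\<theta> (stage ?n)) \<in> range h" by (simp add: fresh finite_stage)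
    then show False using w * Delta_Neg[OF good_subst[OF assms]] by fastforce
  qed
qed

lemma Neg_goal_in_Delta: "Neg \<chi> \<in> Delta"
  unfolding Delta_def by (auto intro: exI[of _ 0])

end

subsection \<open>Semantics in arbitrary structures\<close>

text \<open>Structures are types of a class, so that models of PA can become instances of
  \<open>linordered_semidom\<close> and inherit its arithmetic. Successor is read as addition of
  1.\<close>

class arith = zero + one + plus + times + ord
begin

primrec tval :: "(nat \<Rightarrow> 'a) \<Rightarrow> trm \<Rightarrow> 'a" where
  "tval e (Var i) = e i"
| "tval e Zero = 0"
| "tval e (Succ t) = tval e t + 1"
| "tval e (Add s t) = tval e s + tval e t"
| "tval e (Mul s t) = tval e s * tval e t"

primrec gsat :: "(nat \<Rightarrow> 'a) \<Rightarrow> form \<Rightarrow> bool" where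
  "gsat e (Eq s t) \<longleftrightarrow> tval e s = tval e t"
| "gsat e (Le s t) \<longleftrightarrow> tval e s \<le> tval e t"
| "gsat e (Neg \<phi>) \<longleftrightarrow> \<not> gsat e \<phi>"
| "gsat e (Imp \<phi> \<psi>) \<longleftrightarrow> (gsat e \<phi> \<longrightarrow> gsat e \<psi>)"
| "gsat e (Forall x \<phi>) \<longleftrightarrow> (\<forall>m. gsat (e(x := m)) \<phi>)"

end

instance nat :: arith ..

lemma tval_nat: "tval e t = trm_val e t"
  by (induction t) auto

lemma gsat_nat: "gsat e \<phi> = sat e \<phi>"
  by (induction \<phi> arbitrary: e) (auto simp: tval_nat)

lemma tval_cong: "(\<And>i. i \<in> trm_vars t \<Longrightarrow> e i = e' i) \<Longrightarrow> tval e t = tval e' t"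
  by (induction t) auto

lemma gsat_cong: "(\<And>i. i \<in> free_vars \<phi> \<Longrightarrow> e i = e' i) \<Longrightarrow> gsat e \<phi> = gsat e' \<phi>"
proof (induction \<phi> arbitrary: e e')
  case (Eq s t)
  then show ?case using tval_cong[of s e e'] tval_cong[of t e e'] by auto
next
  case (Le s t)
  then show ?case using tval_cong[of s e e'] tval_cong[of t e e'] by auto
next
  case (Neg \<phi>)
  then show ?case by (metis free_vars.simps(3) gsat.simps(3))
next
  case (Imp \<phi> \<psi>)
  then show ?case by (metis UnCI free_vars.simps(4) gsat.simps(4))
next
  case (Forall x \<phi>)
  have "gsat (e(x := m)) \<phi> = gsat (e'(x := m)) \<phi>" for m
    by (rule Forall.IH) (use Forall.prems in auto)
  then show ?case by simp
qed

lemma tval_subst: "tval e (trm_subst x t s) = tval (e(x := tval e t)) s"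
  by (induction s) auto

lemma gsat_subst: "free_for t x \<phi> \<Longrightarrow> gsat e (subst x t \<phi>) = gsat (e(x := tval e t)) \<phi>"
proof (induction \<phi> arbitrary: e)
  case (Forall y \<phi>)
  show ?case
  proof (cases "x \<in> free_vars (Forall y \<phi>)")
    case False
    then have "gsat (e(x := tval e t)) (Forall y \<phi>) = gsat e (Forall y \<phi>)"
      by (intro gsat_cong) auto
    then show ?thesis using False subst_idle by metis
  next
    case True
    then have "y \<noteq> x" "y \<notin> trm_vars t" "free_for t x \<phi>" using Forall.prems by auto
    moreover have "tval (e(y := m)) t = tval e t" for m
      using \<open>y \<notin> trm_vars t\<close> by (intro tval_cong) auto
    ultimately show ?thesis using Forall.IH by (simp add: fun_upd_twist del: fun_upd_apply)
  qed
qed (auto simp: tval_subst)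

lemma free_for_Succ: "free_for (Succ (Var x)) x \<phi>"
  by (induction \<phi>) auto

lemma free_for_Zero: "free_for Zero x \<phi>"
  by (induction \<phi>) auto

lemma gsat_subst_Zero: "gsat e (subst x Zero \<phi>) = gsat (e(x := 0)) \<phi>"
  by (simp add: gsat_subst free_for_Zero)

lemma gsat_subst_Succ: "gsat e (subst x (Succ (Var x)) \<phi>) = gsat (e(x := e x + 1)) \<phi>"
  by (simp add: gsat_subst free_for_Succ)

text \<open>Serves to show that PA does not prove 1 = 0, so that there is always some sentence to
  build a Henkin model for.\<close>

lemma soundness:
  assumes "PA \<turnstile> \<phi>" shows "gsat (e :: nat \<Rightarrow> nat) \<phi>"
  using assms
proof (induction arbitrary: e)
  case (axiom \<phi>)
  then show ?case
  proof cases
    case (induction x \<phi>)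
    have "gsat (e(x := m)) \<phi>" if "gsat (e(x := 0)) \<phi>"
      "\<forall>m. gsat (e(x := m)) \<phi> \<longrightarrow> gsat (e(x := m + 1)) \<phi>" for m
      using nat_induct[of "\<lambda>m. gsat (e(x := m)) \<phi>" m] that unfolding Suc_eq_plus1 by blast
    then show ?thesis
      unfolding induction gsat.simps gsat_subst_Zero gsat_subst_Succ fun_upd_same fun_upd_upd by blast
    next
    case le_def
    then show ?thesis by (simp add: le_iff_add) (metis add.commute)
  qed auto
next
  case (inst t x \<phi>)
  then show ?case by (simp add: gsat_subst)
next
  case (distr x \<phi> \<psi>)
  have "gsat (e(x := m)) \<phi> = gsat e \<phi>" for m by (rule gsat_cong) (use distr in auto)
  then show ?case by simp
next
  case (eq_subst s x \<phi> t)
  then show ?case by (simp add: gsat_subst)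
qed auto

section \<open>Renaming and simultaneous substitution of variables\<close>

fun trm_map :: "(nat \<Rightarrow> nat) \<Rightarrow> trm \<Rightarrow> trm" where
  "trm_map f (Var i) = Var (f i)"
| "trm_map f Zero = Zero"
| "trm_map f (Succ t) = Succ (trm_map f t)"
| "trm_map f (Add s t) = Add (trm_map f s) (trm_map f t)"
| "trm_map f (Mul s t) = Mul (trm_map f s) (trm_map f t)"

fun rename :: "(nat \<Rightarrow> nat) \<Rightarrow> form \<Rightarrow> form" where
  "rename f (Eq s t) = Eq (trm_map f s) (trm_map f t)"
| "rename f (Le s t) = Le (trm_map f s) (trm_map f t)"
| "rename f (Neg \<phi>) = Neg (rename f \<phi>)"
| "rename f (Imp \<phi> \<psi>) = Imp (rename f \<phi>) (rename f \<psi>)"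
| "rename f (Forall x \<phi>) = Forall (f x) (rename f \<phi>)"

lemma tval_map: "tval e (trm_map f t) = tval (e \<circ> f) t"
  by (induction t) auto

lemma gsat_rename: "inj f \<Longrightarrow> gsat e (rename f \<phi>) = gsat (e \<circ> f) \<phi>"
proof (induction \<phi> arbitrary: e)
  case (Forall x \<phi>)
  have "e(f x := m) \<circ> f = (e \<circ> f)(x := m)" for m
    using Forall.prems by (auto simp: fun_eq_iff inj_eq)
  then show ?case unfolding rename.simps gsat.simps Forall.IH[OF Forall.prems] by simp
qed (auto simp: tval_map)

lemma trm_vars_map: "trm_vars (trm_map f t) = f ` trm_vars t"
  by (induction t) auto

lemma bound_vars_rename: "bound_vars (rename f \<phi>) = f ` bound_vars \<phi>"
  by (induction \<phi>) auto

lemma free_vars_rename: "free_vars (rename f \<phi>) \<subseteq> range f"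
  by (induction \<phi>) (auto simp: trm_vars_map)

text \<open>Only free occurrences are replaced. There is no check for capture, because in use the
  new variables are Henkin variables, which the formulas never bind.\<close>

fun vsub :: "(nat \<Rightarrow> nat) \<Rightarrow> form \<Rightarrow> form" where
  "vsub f (Eq s t) = Eq (trm_map f s) (trm_map f t)"
| "vsub f (Le s t) = Le (trm_map f s) (trm_map f t)"
| "vsub f (Neg \<phi>) = Neg (vsub f \<phi>)"
| "vsub f (Imp \<phi> \<psi>) = Imp (vsub f \<phi>) (vsub f \<psi>)"
| "vsub f (Forall x \<phi>) = Forall x (vsub (f(x := x)) \<phi>)"

lemma bound_vars_vsub: "bound_vars (vsub f \<phi>) = bound_vars \<phi>"
  by (induction \<phi> arbitrary: f) auto

lemma free_vars_vsub: "free_vars (vsub f \<phi>) \<subseteq> f ` free_vars \<phi>"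
proof (induction \<phi> arbitrary: f)
  case (Forall x \<phi>)
  then show ?case using Forall[of "f(x := x)"] by fastforce
next
  case (Imp \<phi> \<psi>)
  then show ?case by (simp add: image_Un sup.coboundedI1 sup.coboundedI2)
qed (auto simp: trm_vars_map)

lemma trm_map_idle: "(\<And>i. i \<in> trm_vars t \<Longrightarrow> f i = i) \<Longrightarrow> trm_map f t = t"
  by (induction t) auto

lemma vsub_idle: "(\<And>i. i \<in> free_vars \<phi> \<Longrightarrow> f i = i) \<Longrightarrow> vsub f \<phi> = \<phi>"
  by (induction \<phi> arbitrary: f) (auto simp: trm_map_idle)

lemma trm_subst_map:
  "(\<And>i. i \<noteq> x \<Longrightarrow> f i \<noteq> x) \<Longrightarrow> trm_subst x (Var k) (trm_map (f(x := x)) t) = trm_map (f(x := k)) t"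
  by (induction t) auto

lemma subst_vsub:
  "(\<And>i. i \<noteq> x \<Longrightarrow> f i \<noteq> x) \<Longrightarrow> subst x (Var k) (vsub (f(x := x)) \<phi>) = vsub (f(x := k)) \<phi>"
proof (induction \<phi> arbitrary: f)
  case (Forall z \<phi>)
  show ?case
  proof (cases "z = x")
    case False
    then have "subst x (Var k) (vsub ((f(z := z))(x := x)) \<phi>) = vsub ((f(z := z))(x := k)) \<phi>"
      using Forall.prems by (intro Forall.IH) auto
    then show ?thesis using False by (simp add: fun_upd_twist del: fun_upd_apply)
  qed (simp del: fun_upd_apply)
qed (auto simp: trm_subst_map)

subsection \<open>Truth in the Henkin model\<close>

context henkin
begin

definition name :: "trm \<Rightarrow> nat" where
  "name t = (SOME y. Eq (Var (h y)) t \<in> Delta)"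

abbreviation closed :: "trm \<Rightarrow> bool" where
  "closed t \<equiv> trm_vars t \<subseteq> range h"

lemma eq_refl: "closed t \<Longrightarrow> Eq t t \<in> Delta"
  by (intro Delta_theorem) (auto simp: good_def proves.eq_refl)

lemma eq_replace:
  assumes "Eq s t \<in> Delta" "subst x s \<phi> \<in> Delta" "bound_vars \<phi> = {}" "x \<notin> range h"
    "free_vars \<phi> \<subseteq> insert x (range h)"
  shows "subst x t \<phi> \<in> Delta"
proof -
  have *: "closed s" "closed t" using good_Delta[OF assms(1)] by (auto simp: good_def)
  have "good (subst x t \<phi>)"
    using assms * free_vars_subst[of x t \<phi>] by (auto simp: good_def)
  moreover have "T \<turnstile> Imp (Eq s t) (Imp (subst x s \<phi>) (subst x t \<phi>))"
    by (rule proves.eq_subst) (use assms in \<open>auto intro: free_for_disjoint\<close>)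
  ultimately show ?thesis
    using assms(1,2) by (meson Delta_closed derives.hyp derives.mp derives.provable)
qed

text \<open>A variable that is no Henkin variable marks the place of replacement in the template
  formula to which an equality axiom is applied.\<close>

lemma spare: obtains x where "x \<notin> range h" "\<forall>t. closed t \<longrightarrow> x \<notin> trm_vars t"
  using not_all by blast

lemma eq_sym: assumes "Eq s t \<in> Delta" shows "Eq t s \<in> Delta"
proof -
  obtain x where x: "x \<notin> range h" "\<forall>t. closed t \<longrightarrow> x \<notin> trm_vars t" by (rule spare)
  have c: "closed s" "closed t" using good_Delta[OF assms] by (auto simp: good_def)
  then show ?thesis
    using eq_replace[OF assms, of x "Eq (Var x) s"] eq_refl x by (auto simp: trm_subst_idle)
qed

lemma eq_trans: assumes "Eq r s \<in> Delta" "Eq s t \<in> Delta" shows "Eq r t \<in> Delta"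
proof -
  obtain x where x: "x \<notin> range h" "\<forall>t. closed t \<longrightarrow> x \<notin> trm_vars t" by (rule spare)
  have c: "closed r" using good_Delta[OF assms(1)] by (auto simp: good_def)
  then show ?thesis
    using eq_replace[OF assms(2), of x "Eq r (Var x)"] assms x by (auto simp: trm_subst_idle)
qed

lemma eq_cong:
  assumes "Eq s t \<in> Delta" "x \<notin> range h" "trm_vars r \<subseteq> insert x (range h)"
  shows "Eq (trm_subst x s r) (trm_subst x t r) \<in> Delta"
proof -
  have c: "closed s" using good_Delta[OF assms(1)] by (auto simp: good_def)
  then have c': "closed (trm_subst x s r)" using assms trm_vars_subst[of x s r] by auto
  then have i: "trm_subst x u (trm_subst x s r) = trm_subst x s r" for u
    using assms(2) by (intro trm_subst_idle) auto
  show ?thesis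
    using eq_replace[OF assms(1), of x "Eq (trm_subst x s r) r"] c' eq_refl[OF c'] assms i by auto
qed

text \<open>If every \<open>Var (h y)\<close> differed from \<open>t\<close>, the formula saying so
  for all x would be in \<open>Delta\<close>, and its instance at \<open>t\<close> contradicts
  reflexivity. Hence the model can be a quotient of the indices of Henkin variables, without the
  other terms.\<close>

lemma name: assumes "closed t" shows "Eq (Var (h (name t))) t \<in> Delta"
proof -
  obtain x where x: "x \<notin> range h" "x \<notin> trm_vars t" using spare assms by metis
  let ?\<phi> = "Forall x (Neg (Eq (Var x) t))"
  have good: "good ?\<phi>" using assms x by (auto simp: good_def)
  have "?\<phi> \<notin> Delta"
  proof
    assume "?\<phi> \<in> Delta"
    moreover have "T \<turnstile> Imp ?\<phi> (Neg (Eq t t))"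
      using proves.inst[of t x "Neg (Eq (Var x) t)" T] x(2) by (simp add: trm_subst_idle)
    ultimately have "derives T Delta (Neg (Eq t t))"
      by (meson derives.hyp derives.mp derives.provable)
    then show False using eq_refl[OF assms] consistent_Delta
      unfolding consistent_def by (meson derives.hyp)
  qed
  then obtain y where y: "Neg (Eq (Var (h y)) t) \<notin> Delta"
    using Delta_Forall[OF good] x(2) by (auto simp: trm_subst_idle)
  have "good (Eq (Var (h y)) t)" using assms by (auto simp: good_def)
  then have "Eq (Var (h y)) t \<in> Delta" using y Delta_Neg by blast
  then show ?thesis unfolding name_def by (rule someI)
qed

lemma eq_cong_Add:
  assumes "Eq s s' \<in> Delta" "Eq t t' \<in> Delta" shows "Eq (Add s t) (Add s' t') \<in> Delta"
proof -
  obtain x where x: "x \<notin> range h" "\<forall>t. closed t \<longrightarrow> x \<notin> trm_vars t" by (rule spare)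
  have c: "closed t" "closed s'" using good_Delta assms by (fastforce simp: good_def)+
  have "Eq (Add s t) (Add s' t) \<in> Delta"
    using eq_cong[OF assms(1) x(1), of "Add (Var x) t"] x c by (auto simp: trm_subst_idle subset_insertI2)
  moreover have "Eq (Add s' t) (Add s' t') \<in> Delta"
    using eq_cong[OF assms(2) x(1), of "Add s' (Var x)"] x c by (auto simp: trm_subst_idle subset_insertI2)
  ultimately show ?thesis by (rule eq_trans)
qed

lemma eq_cong_Mul:
  assumes "Eq s s' \<in> Delta" "Eq t t' \<in> Delta" shows "Eq (Mul s t) (Mul s' t') \<in> Delta"
proof -
  obtain x where x: "x \<notin> range h" "\<forall>t. closed t \<longrightarrow> x \<notin> trm_vars t" by (rule spare)
  have c: "closed t" "closed s'" using good_Delta assms by (fastforce simp: good_def)+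
  have "Eq (Mul s t) (Mul s' t) \<in> Delta"
    using eq_cong[OF assms(1) x(1), of "Mul (Var x) t"] x c by (auto simp: trm_subst_idle subset_insertI2)
  moreover have "Eq (Mul s' t) (Mul s' t') \<in> Delta"
    using eq_cong[OF assms(2) x(1), of "Mul s' (Var x)"] x c by (auto simp: trm_subst_idle subset_insertI2)
  ultimately show ?thesis by (rule eq_trans)
qed

lemma eq_cong_Succ: "Eq s t \<in> Delta \<Longrightarrow> Eq (Succ s) (Succ t) \<in> Delta"
  using not_all eq_cong[of s t x "Succ (Var x)" for x] by force

lemma eq_cong_Le:
  assumes "Eq s s' \<in> Delta" "Eq t t' \<in> Delta" "Le s t \<in> Delta" shows "Le s' t' \<in> Delta"
proof -
  obtain x where x: "x \<notin> range h" "\<forall>t. closed t \<longrightarrow> x \<notin> trm_vars t" by (rule spare)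
  have c: "closed t" "closed s'" using good_Delta assms by (fastforce simp: good_def)+
  have "Le s' t \<in> Delta"
    using eq_replace[OF assms(1), of x "Le (Var x) t"] x c assms(3) by (auto simp: trm_subst_idle)
  then show ?thesis
    using eq_replace[OF assms(2), of x "Le s' (Var x)"] x c by (auto simp: trm_subst_idle subset_insertI2)
qed

end

text \<open>The truth lemma is proved for any type that realizes the quotient, since the type itself
  can be introduced only once \<open>T\<close>, \<open>\<chi>\<close> and \<open>h\<close> are
  concrete.\<close>

locale henkin_model = henkin T \<chi> h for T \<chi> h +
  fixes cls :: "nat \<Rightarrow> 'm::arith"
  assumes cls_eq: "cls y = cls z \<longleftrightarrow> Eq (Var (h y)) (Var (h z)) \<in> Delta"
    and surj_cls: "surj cls"
    and cls_zero: "0 = cls (name Zero)"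
    and cls_succ: "cls y + 1 = cls (name (Succ (Var (h y))))"
    and cls_add: "cls y + cls z = cls (name (Add (Var (h y)) (Var (h z))))"
    and cls_mul: "cls y * cls z = cls (name (Mul (Var (h y)) (Var (h z))))"
    and cls_le: "cls y \<le> cls z \<longleftrightarrow> Le (Var (h y)) (Var (h z)) \<in> Delta"
begin

lemma cls_name_eq: "closed s \<Longrightarrow> closed t \<Longrightarrow> cls (name s) = cls (name t) \<longleftrightarrow> Eq s t \<in> Delta"
  unfolding cls_eq using name eq_sym eq_trans by meson

lemma closed_map: "closed (trm_map (h \<circ> \<sigma>) t)"
  by (auto simp: trm_vars_map)

lemma tval_cls: "tval (cls \<circ> \<sigma>) t = cls (name (trm_map (h \<circ> \<sigma>) t))"
proof (induction t)
  case (Var i)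
  then show ?case using name[of "Var (h (\<sigma> i))"] eq_sym by (simp add: cls_eq)
next
  case Zero
  then show ?case by (simp add: cls_zero)
next
  case (Succ t)
  then show ?case 
    using closed_map[of \<sigma> t] by (simp add: cls_succ cls_name_eq eq_cong_Succ name del: comp_apply)
next
  case (Add s t)
  then show ?case using closed_map[of \<sigma> s] closed_map[of \<sigma> t]
    by (simp add: cls_add cls_name_eq eq_cong_Add name del: comp_apply)
next
  case (Mul s t)
  then show ?case using closed_map[of \<sigma> s] closed_map[of \<sigma> t]
    by (simp add: cls_mul cls_name_eq eq_cong_Mul name del: comp_apply)
qed

lemma good_vsub: "bound_vars \<phi> \<inter> range h = {} \<Longrightarrow> good (vsub (h \<circ> \<sigma>) \<phi>)"
  using free_vars_vsub[of "h \<circ> \<sigma>" \<phi>] by (auto simp: good_def bound_vars_vsub)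

text \<open>Henkin's truth lemma. As \<open>cls\<close> is onto, every environment has the form
  \<open>cls \<circ> \<sigma>\<close>, and \<open>vsub\<close> writes such an environment into the
  formula.\<close>

lemma gsat_cls:
  "bound_vars \<phi> \<inter> range h = {} \<Longrightarrow> gsat (cls \<circ> \<sigma>) \<phi> \<longleftrightarrow> vsub (h \<circ> \<sigma>) \<phi> \<in> Delta"
proof (induction \<phi> arbitrary: \<sigma>)
  case (Eq s t)
  then show ?case by (simp add: tval_cls cls_name_eq closed_map del: comp_apply)
next
  case (Le s t)
  have "Le (Var (h (name s'))) (Var (h (name t'))) \<in> Delta \<longleftrightarrow> Le s' t' \<in> Delta"
    if "closed s'" "closed t'" for s' t'
    using name[OF that(1)] name[OF that(2)] eq_cong_Le eq_sym by meson
  then show ?case by (simp add: tval_cls cls_le closed_map del: comp_apply)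
next
  case (Neg \<phi>)
  then show ?case using Delta_Neg[OF good_vsub] by (simp del: comp_apply)
next
  case (Imp \<phi> \<psi>)
  then have "bound_vars \<phi> \<inter> range h = {}" "bound_vars \<psi> \<inter> range h = {}" by auto
  with Imp show ?case using Delta_Imp[OF good_vsub good_vsub] by (simp del: comp_apply)
next
  case (Forall x \<phi>)
  then have b: "bound_vars \<phi> \<inter> range h = {}" "x \<notin> range h" by auto
  have "gsat (cls \<circ> \<sigma>) (Forall x \<phi>) \<longleftrightarrow> (\<forall>y. gsat ((cls \<circ> \<sigma>)(x := cls y)) \<phi>)"
    using surj_cls by (auto simp: surj_def) metis
  also have "\<dots> \<longleftrightarrow> (\<forall>y. gsat (cls \<circ> \<sigma>(x := y)) \<phi>)"
    by (simp add: fun_upd_comp)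
  also have "\<dots> \<longleftrightarrow> (\<forall>y. vsub (h \<circ> \<sigma>(x := y)) \<phi> \<in> Delta)"
    using Forall.IH[OF b(1)] by (simp only:)
  also have "\<dots> \<longleftrightarrow> (\<forall>y. subst x (Var (h y)) (vsub ((h \<circ> \<sigma>)(x := x)) \<phi>) \<in> Delta)"
    using b(2) by (subst subst_vsub) (auto simp: fun_upd_comp)
  also have "\<dots> \<longleftrightarrow> vsub (h \<circ> \<sigma>) (Forall x \<phi>) \<in> Delta"
    using Delta_Forall[of x "vsub ((h \<circ> \<sigma>)(x := x)) \<phi>"] good_vsub[OF Forall.prems, of \<sigma>] by simp
  finally show ?case .
qed

lemma gsat_sentence:
  assumes "good \<phi>" "free_vars \<phi> = {}" shows "gsat (e :: nat \<Rightarrow> 'm) \<phi> \<longleftrightarrow> \<phi> \<in> Delta"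
proof -
  have "gsat e \<phi> = gsat (cls \<circ> id) \<phi>" by (rule gsat_cong) (use assms in auto)
  also have "\<dots> \<longleftrightarrow> vsub (h \<circ> id) \<phi> \<in> Delta"
    by (rule gsat_cls) (use assms in \<open>auto simp: good_def\<close>)
  also have "vsub (h \<circ> id) \<phi> = \<phi>" by (rule vsub_idle) (use assms in auto)
  finally show ?thesis .
qed

lemma gsat_goal: "\<not> gsat (e :: nat \<Rightarrow> 'm) \<chi>"
proof -
  have "good (Neg \<chi>)" using sentence bound by (simp add: good_def)
  then show ?thesis using gsat_sentence[of "Neg \<chi>" e] Neg_goal_in_Delta sentence by simp
qed

lemma gsat_theorem:
  assumes "T \<turnstile> \<phi>" "bound_vars \<phi> \<inter> range h = {}" "free_vars \<phi> \<inter> range h = {}"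
  shows "gsat (e :: nat \<Rightarrow> 'm) \<phi>"
proof -
  \<comment> \<open>Formulas in \<open>Delta\<close> have only Henkin variables free, so a theorem
    with other free variables enters it as a universal closure.\<close>
  define cl where "cl xs = foldr Forall xs \<phi>" for xs
  have p: "T \<turnstile> cl xs" for xs
    by (induction xs) (auto simp: cl_def assms intro: proves.gen)
  have f: "free_vars (cl xs) = free_vars \<phi> - set xs" for xs
    by (induction xs) (auto simp: cl_def)
  have b: "bound_vars (cl xs) = bound_vars \<phi> \<union> set xs" for xs
    by (induction xs) (auto simp: cl_def)
  have s: "gsat e (cl xs) \<Longrightarrow> gsat e \<phi>" for xs and e :: "nat \<Rightarrow> 'm"
  proof (induction xs arbitrary: e)
    case (Cons x xs)
    then have "gsat (e(x := e x)) (cl xs)" unfolding cl_def by (metis foldr_Cons comp_apply gsat.simps(5))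
    then show ?case using Cons by simp
  qed (auto simp: cl_def)
  obtain xs where xs: "set xs = free_vars \<phi>" using finite_list[OF finite_free_vars] by auto
  have good: "good (cl xs)" using f b assms xs by (auto simp: good_def)
  show ?thesis
    by (rule s[of e xs]) (use gsat_sentence[OF good] Delta_theorem[OF good p] f xs in auto)
qed

end

subsection \<open>Definable relations\<close>

text \<open>
  Variables with index divisible by 3 carry the arguments of a relation, those with index 1 modulo
  3 denote all elements of the (countable) structure and serve as parameters, and those with index
  2 modulo 3 are spare; making room for a quantifier is then an injective renaming.
\<close>

definition mix :: "(nat \<Rightarrow> 'a::{zero,countable}) \<Rightarrow> nat \<Rightarrow> 'a" where
  "mix e i = (if i mod 3 = 0 then e (i div 3) else if i mod 3 = 1 then from_nat (i div 3) else 0)"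

text \<open>A semantic notion with closure rules lets induction be applied to HOL predicates by
  \<open>intro\<close>, while the underlying formulas stay implicit.\<close>

definition definable :: "((nat \<Rightarrow> 'a::{arith,countable}) \<Rightarrow> bool) \<Rightarrow> bool" where
  "definable P \<longleftrightarrow> (\<exists>\<phi>. \<forall>e. P e = gsat (mix e) \<phi>)"

definition definable_fun :: "((nat \<Rightarrow> 'a::{arith,countable}) \<Rightarrow> 'a) \<Rightarrow> bool" where
  "definable_fun f \<longleftrightarrow> definable (\<lambda>e. e 0 = f (\<lambda>i. e (Suc i)))"

lemma definable_not: "definable P \<Longrightarrow> definable (\<lambda>e. \<not> P e)"
  unfolding definable_def by (metis gsat.simps(3))

lemma definable_imp: "definable P \<Longrightarrow> definable Q \<Longrightarrow> definable (\<lambda>e. P e \<longrightarrow> Q e)"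
  unfolding definable_def by (metis gsat.simps(4))

lemma definable_and: "definable P \<Longrightarrow> definable Q \<Longrightarrow> definable (\<lambda>e. P e \<and> Q e)"
  using definable_not[OF definable_imp[OF _ definable_not], of P Q] by simp

lemma definable_or: "definable P \<Longrightarrow> definable Q \<Longrightarrow> definable (\<lambda>e. P e \<or> Q e)"
  using definable_imp[OF definable_not, of P Q] by (simp add: disj_imp)

lemma definable_iff: "definable P \<Longrightarrow> definable Q \<Longrightarrow> definable (\<lambda>e. P e \<longleftrightarrow> Q e)"
  using definable_and[OF definable_imp definable_imp, of P Q Q P] by (simp add: iff_conv_conj_imp)

lemma definable_rename:
  assumes "definable P" "inj k" shows "definable (\<lambda>e. P (\<lambda>i. e (k i)))"
proof -
  obtain \<phi> where \<phi>: "\<And>e. P e = gsat (mix e) \<phi>" using assms(1) unfolding definable_def by auto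
  define f where "f i = (if i mod 3 = 0 then 3 * k (i div 3) else i)" for i
  have "inj f"
    unfolding f_def inj_on_def using \<open>inj k\<close>[THEN inj_eq] by (auto split: if_splits)
  moreover have "mix e \<circ> f = mix (\<lambda>i. e (k i))" for e :: "nat \<Rightarrow> 'a"
    by (auto simp: mix_def f_def fun_eq_iff)
  ultimately have "P (\<lambda>i. e (k i)) = gsat (mix e) (rename f \<phi>)" for e
    by (simp add: \<phi> gsat_rename)
  then show ?thesis unfolding definable_def by blast
qed

lemma definable_all:
  assumes "definable (\<lambda>e. P (e 0) (\<lambda>i. e (Suc i)))" shows "definable (\<lambda>e. \<forall>x. P x e)"
proof -
  obtain \<phi> where \<phi>: "\<And>e. P (e 0) (\<lambda>i. e (Suc i)) = gsat (mix e) \<phi>"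
    using assms unfolding definable_def by auto
  \<comment> \<open>The quantified argument goes to the spare variable 2, the other arguments move
    down one place, and the spare variables move up to keep \<open>f\<close> injective.\<close>
  define f :: "nat \<Rightarrow> nat" where "f i = (if i = 0 then 2 else if i mod 3 = 0 then i - 3
    else if i mod 3 = 1 then i else i + 3)" for i
  have "inj f"
    unfolding f_def inj_on_def by (auto split: if_splits) presburger+
  have m: "(mix e)(2 := x) \<circ> f = mix (case_nat x e)" for x and e :: "nat \<Rightarrow> 'a"
  proof
    fix i
    consider "i = 0" | j where "i = 3 * Suc j" | j where "i = 3 * j + 1" | j where "i = 3 * j + 2"
      by (metis (no_types) One_nat_def add.right_neutral mod_less_divisor mult_0_right
          mult_div_mod_eq not0_implies_Suc numeral_2_eq_2 numeral_3_eq_3 less_Suc_eq not_less0 zero_less_Suc)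
    then show "((mix e)(2 := x) \<circ> f) i = mix (case_nat x e) i"
    proof cases
      case 2
      then have "f i = 3 * j" "3 * j \<noteq> 2" by (auto simp: f_def) presburger
      then show ?thesis using 2 by (simp add: mix_def)
    qed (auto simp: mix_def f_def mod_Suc)
  qed
  have "P x e = gsat ((mix e)(2 := x)) (rename f \<phi>)" for x e
    using \<phi>[of "case_nat x e"] by (simp add: gsat_rename \<open>inj f\<close> m del: comp_apply fun_upd_apply)
  then have "(\<forall>x. P x e) = gsat (mix e) (Forall 2 (rename f \<phi>))" for e
    by (simp del: fun_upd_apply)
  then show ?thesis unfolding definable_def by blast
qed

lemma definable_ex:
  assumes "definable (\<lambda>e. P (e 0) (\<lambda>i. e (Suc i)))" shows "definable (\<lambda>e. \<exists>x. P x e)"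
  using definable_not[OF definable_all[of "\<lambda>x e. \<not> P x e", OF definable_not[OF assms]]] by simp

lemma definable_shift: "definable P \<Longrightarrow> definable (\<lambda>e. P (\<lambda>i. e (Suc i)))"
  by (rule definable_rename) auto

lemma definable_fun_shift: "definable_fun f \<Longrightarrow> definable_fun (\<lambda>e. f (\<lambda>i. e (Suc i)))"
  using definable_rename[of "\<lambda>e. e 0 = f (\<lambda>i. e (Suc i))" "\<lambda>i. if i = 0 then 0 else Suc i"]
  by (simp add: definable_fun_def inj_on_def)

lemma definable_fun_var: "definable_fun (\<lambda>e. e i)"
  unfolding definable_fun_def definable_def
  by (rule exI[of _ "Eq (Var 0) (Var (3 * Suc i))"]) (simp add: mix_def)

lemma definable_fun_const: "definable_fun (\<lambda>e. c)"
  unfolding definable_fun_def definable_def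
  by (rule exI[of _ "Eq (Var 0) (Var (3 * to_nat c + 1))"])
    (simp add: mix_def mod_Suc div_Suc)

lemma definable_comp1:
  assumes "definable (\<lambda>e. R (e 0))" "definable_fun f" shows "definable (\<lambda>e. R (f e))"
proof -
  have "definable (\<lambda>e. \<exists>x. x = f e \<and> R x)"
    by (intro definable_ex definable_and assms[unfolded definable_fun_def])
  then show ?thesis by simp
qed

lemma definable_comp2:
  assumes "definable (\<lambda>e. R (e 0) (e (Suc 0)))" "definable_fun f" "definable_fun g"
  shows "definable (\<lambda>e. R (f e) (g e))"
proof -
  have "definable (\<lambda>e. \<exists>y x. x = f e \<and> y = g e \<and> R x y)"
    by (intro definable_ex definable_and assms(1) definable_shift
        definable_fun_shift[OF assms(2), unfolded definable_fun_def]
        definable_shift[OF assms(3)[unfolded definable_fun_def]])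
  then show ?thesis by simp
qed

lemma definable_fun_comp1:
  assumes "definable (\<lambda>e. e 0 = F (e (Suc 0)))" "definable_fun f"
  shows "definable_fun (\<lambda>e. F (f e))"
  unfolding definable_fun_def
  by (rule definable_comp2[of "\<lambda>x y. x = F y", OF assms(1) definable_fun_var
        definable_fun_shift[OF assms(2)]])

lemma definable_fun_comp2:
  assumes "definable (\<lambda>e. e 0 = F (e (Suc 0)) (e (Suc (Suc 0))))" "definable_fun f" "definable_fun g"
  shows "definable_fun (\<lambda>e. F (f e) (g e))"
proof -
  \<comment> \<open>A rotation that puts the value of the function behind its two arguments, as the
    two quantifiers below bind places 0 and 1.\<close>
  have "inj (\<lambda>i::nat. if i = 0 then 2 else if i = 1 then 0 else if i = 2 then 1 else i)"
    by (auto simp: inj_on_def split: if_splits)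
  from definable_rename[OF assms(1) this]
  have *: "definable (\<lambda>e. e (Suc (Suc 0)) = F (e 0) (e (Suc 0)))"
    by (simp add: numeral_2_eq_2)
  have "definable (\<lambda>e. \<exists>y x. x = f (\<lambda>i. e (Suc i)) \<and> y = g (\<lambda>i. e (Suc i)) \<and> e 0 = F x y)"
    by (intro definable_ex definable_and * 
        definable_fun_shift[OF definable_fun_shift[OF assms(2)], unfolded definable_fun_def]
        definable_shift[OF definable_fun_shift[OF assms(3), unfolded definable_fun_def]])
  then show ?thesis unfolding definable_fun_def by simp
qed

lemma definable_eq: 
  assumes "definable_fun f" "definable_fun g" shows "definable (\<lambda>e. f e = g e)"
proof (rule definable_comp2[of "\<lambda>x y. x = y", OF _ assms])
  show "definable (\<lambda>e. e 0 = e (Suc 0))"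
    using definable_fun_var[of 0] by (simp add: definable_fun_def)
qed

lemma definable_le: 
  assumes "definable_fun f" "definable_fun g" shows "definable (\<lambda>e. f e \<le> g e)"
proof (rule definable_comp2[of "\<lambda>x y. x \<le> y", OF _ assms])
  show "definable (\<lambda>e. e 0 \<le> e (Suc 0))"
    unfolding definable_def by (rule exI[of _ "Le (Var 0) (Var 3)"]) (simp add: mix_def)
qed

lemma definable_fun_plus:
  assumes "definable_fun f" "definable_fun g" shows "definable_fun (\<lambda>e. f e + g e)"
proof (rule definable_fun_comp2[OF _ assms])
  show "definable (\<lambda>e. e 0 = e (Suc 0) + e (Suc (Suc 0)))"
    unfolding definable_def
    by (rule exI[of _ "Eq (Var 0) (Add (Var 3) (Var 6))"]) (simp add: mix_def numeral_2_eq_2)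
qed

lemma definable_fun_times:
  assumes "definable_fun f" "definable_fun g" shows "definable_fun (\<lambda>e. f e * g e)"
proof (rule definable_fun_comp2[OF _ assms])
  show "definable (\<lambda>e. e 0 = e (Suc 0) * e (Suc (Suc 0)))"
    unfolding definable_def
    by (rule exI[of _ "Eq (Var 0) (Mul (Var 3) (Var 6))"]) (simp add: mix_def numeral_2_eq_2)
qed

lemmas definable_intros = definable_not definable_imp definable_and definable_or definable_iff
  definable_all definable_ex definable_eq definable_le definable_fun_var definable_fun_const
  definable_fun_plus definable_fun_times

text \<open>Induction for formulas is a hypothesis here, because the Henkin model needs this
  principle before it is known to be an ordered semiring of class \<open>peano\<close>.\<close>

lemma definable_induct_general:
  assumes ind: "\<And>(e :: nat \<Rightarrow> 'a::{arith,countable}) \<phi> m. gsat (e(0 := 0)) \<phi> \<Longrightarrow>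
      (\<And>m. gsat (e(0 := m)) \<phi> \<Longrightarrow> gsat (e(0 := m + 1)) \<phi>) \<Longrightarrow> gsat (e(0 := m)) \<phi>"
    and P: "definable (\<lambda>e :: nat \<Rightarrow> 'a. P (e 0))" "P 0" "\<And>m. P m \<Longrightarrow> P (m + 1)"
  shows "P m"
proof -
  obtain \<phi> where \<phi>: "\<And>e :: nat \<Rightarrow> 'a. P (e 0) = gsat (mix e) \<phi>"
    using P(1) unfolding definable_def by auto
  have "mix (\<lambda>i. if i = 0 then x else 0) = (mix (\<lambda>_. 0))(0 := x)" for x :: 'a
    by (auto simp: mix_def fun_eq_iff)
  then have "P x = gsat ((mix (\<lambda>_. 0))(0 := x)) \<phi>" for x
    using \<phi>[of "\<lambda>i. if i = 0 then x else 0"] by simp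
  then show ?thesis using ind[of "mix (\<lambda>_. 0)" \<phi> m] P(2,3) by blast
qed

text \<open>Countability is required since \<open>mix\<close> reserves a variable for every element;
  the other variables of \<open>e\<close> are the parameters of the induction formula.\<close>

class peano = linordered_semidom + arith + countable +
  assumes le_ex_add: "x \<le> y \<Longrightarrow> \<exists>z. y = x + z"
    and gsat_induct: "gsat (e(0 := 0)) \<phi> \<Longrightarrow>
      (\<And>m. gsat (e(0 := m)) \<phi> \<Longrightarrow> gsat (e(0 := m + 1)) \<phi>) \<Longrightarrow> gsat (e(0 := m)) \<phi>"

lemma definable_induct [case_names definable zero succ]:
  fixes m :: "'a::peano"
  assumes "definable (\<lambda>e :: nat \<Rightarrow> 'a. P (e 0))" "P 0" "\<And>m. P m \<Longrightarrow> P (m + 1)"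
  shows "P m"
  using definable_induct_general[OF gsat_induct] assms by blast

instance nat :: peano
proof
  fix e :: "nat \<Rightarrow> nat" and \<phi> m
  assume "gsat (e(0 := 0)) \<phi>" "\<And>m. gsat (e(0 := m)) \<phi> \<Longrightarrow> gsat (e(0 := m + 1)) \<phi>"
  then show "gsat (e(0 := m)) \<phi>"
    using nat_induct[of "\<lambda>m. gsat (e(0 := m)) \<phi>" m] unfolding Suc_eq_plus1 by blast
qed (auto simp: le_iff_add)

lemma peano_zero_le [simp]: "0 \<le> (x :: 'a::peano)"
proof (induction x rule: definable_induct)
  case (succ m)
  then show ?case by (simp add: add_nonneg_nonneg)
qed (auto intro!: definable_intros)

lemma peano_not_less_zero [simp]: "\<not> x < (0 :: 'a::peano)"
  by (simp add: not_less)

lemma peano_cases: obtains "x = (0 :: 'a::peano)" | y where "x = y + 1"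
proof -
  have "x = 0 \<or> (\<exists>y. x = y + 1)"
    by (induction x rule: definable_induct) (auto intro!: definable_intros)
  then show thesis using that by blast
qed

lemma peano_one_le: "x \<noteq> (0 :: 'a::peano) \<Longrightarrow> 1 \<le> x"
  by (cases x rule: peano_cases) auto

lemma peano_less_iff: "x < y \<longleftrightarrow> x + 1 \<le> (y :: 'a::peano)"
proof
  assume "x < y"
  then obtain z where "y = x + z" "z \<noteq> 0" using le_ex_add[of x y] by fastforce
  then show "x + 1 \<le> y" by (simp add: peano_one_le)
qed (meson less_add_one less_le_trans)

lemma peano_le_succ_iff: "x \<le> y + 1 \<longleftrightarrow> x \<le> y \<or> x = y + (1 :: 'a::peano)"
  using peano_less_iff[of y x] by (auto simp: not_le order.order_iff_strict)

lemma peano_less_succ_iff: "x < y + 1 \<longleftrightarrow> x \<le> (y :: 'a::peano)"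
  by (meson not_less peano_less_iff)

lemma definable_less:
  assumes "definable_fun f" "definable_fun g"
  shows "definable (\<lambda>e. f e < (g e :: 'a::peano))"
  using definable_not[OF definable_le[OF assms(2,1)]] by (simp add: not_le)

lemma definable_dvd:
  assumes "definable_fun f" "definable_fun g"
  shows "definable (\<lambda>e. f e dvd (g e :: 'a::peano))"
  unfolding dvd_def
  by (intro definable_intros definable_fun_shift assms)

lemmas peano_definable = definable_intros definable_less definable_dvd

text \<open>The reason why bounded formulas are absolute: a quantifier with a standard bound meets
  no nonstandard number.\<close>

lemma peano_below_of_nat:
  assumes "x \<le> of_nat k" obtains j where "j \<le> k" "x = (of_nat j :: 'a::peano)"
proof -
  have "\<exists>j\<le>k. x = of_nat j" using assms
  proof (induction k)
    case 0
    then show ?case by (simp add: order_antisym)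
  next
    case (Suc k)
    then show ?case using peano_le_succ_iff[of x "of_nat k"]
      by (metis add.commute le_Suc_eq of_nat_Suc order_refl)
  qed
  then show thesis using that by blast
qed

lemma peano_le_square: "x \<le> x * (x :: 'a::peano)"
  using mult_left_mono[of 1 x x] peano_one_le[of x] by (cases "x = 0") auto

text \<open>Lets the leading symbol of a code be read off in every model, also from a nonstandard
  code.\<close>

lemma digit_unique:
  assumes "11 * x + d = 11 * y + d'" "d < 11" "d' < (11 :: 'a::peano)" shows "x = y" "d = d'"
proof -
  have less: False if "x < y" "11 * x + d = 11 * y + d'" "d < 11" for x y d d' :: 'a
  proof -
    have "11 * (x + 1) \<le> 11 * y" using that(1) by (intro mult_left_mono) (auto simp: peano_less_iff)
    also have "\<dots> \<le> 11 * y + d'" by simp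
    also have "\<dots> < 11 * x + 11" using that(2,3) by (metis add_strict_left_mono)
    finally show False by (simp add: algebra_simps)
  qed
  show "x = y" using less[of x y d d'] less[of y x d' d] assms by (metis linorder_neqE)
  with assms(1) show "d = d'" by simp
qed

subsection \<open>Pairing\<close>

text \<open>For s = x + y the value lies between s * s and s * s + s, below the next square, so it
  determines s and then x. Unlike Cantor's pairing it is a term without division, at the price of
  not being onto; on other numbers the projections below are 0.\<close>

definition pr :: "'a::peano \<Rightarrow> 'a \<Rightarrow> 'a" where
  "pr x y = (x + y) * (x + y) + x"

lemma pr_zero: "pr 0 0 = 0"
  by (simp add: pr_def)

lemma le_pr: "x \<le> pr x y" "y \<le> pr x y"
proof -
  show "x \<le> pr x y" by (simp add: pr_def add_increasing)
  have "y \<le> x + y" by simp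
  also have "\<dots> \<le> (x + y) * (x + y)" by (rule peano_le_square)
  also have "\<dots> \<le> pr x y" by (simp add: pr_def)
  finally show "y \<le> pr x y" .
qed

lemma pr_mono: "x \<le> x' \<Longrightarrow> y \<le> y' \<Longrightarrow> pr x y \<le> pr x' y'"
  unfolding pr_def by (intro add_mono mult_mono) auto

lemma pr_eq_iff: "pr x y = pr x' y' \<longleftrightarrow> x = x' \<and> y = y'"
proof
  assume eq: "pr x y = pr x' y'"
  have less: "pr x y < pr x' y'" if "x + y < x' + y'" for x y x' y' :: 'a
  proof -
    have "pr x y \<le> (x + y) * (x + y) + (x + y)" by (simp add: pr_def add_increasing2)
    also have "\<dots> < (x + y) * (x + y) + (x + y) + (x + y + 1)"
      by (metis add.right_neutral add_strict_left_mono le_add_same_cancel1 add_nonneg_pos peano_zero_le zero_less_one)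
    also have "\<dots> = (x + y + 1) * (x + y + 1)" by (simp add: algebra_simps)
    also have "\<dots> \<le> (x' + y') * (x' + y')" using that by (intro mult_mono) (auto simp: peano_less_iff)
    also have "\<dots> \<le> pr x' y'" by (simp add: pr_def)
    finally show ?thesis .
  qed
  have "x + y = x' + y'" using less[of x y x' y'] less[of x' y' x y] eq by (metis less_irrefl linorder_neqE)
  with eq show "x = x' \<and> y = y'" by (simp add: pr_def)
qed auto

definition fs :: "'a::peano \<Rightarrow> 'a" where
  "fs s = (if \<exists>x y. s = pr x y then THE x. \<exists>y. s = pr x y else 0)"

definition sn :: "'a::peano \<Rightarrow> 'a" where
  "sn s = (if \<exists>x y. s = pr x y then THE y. \<exists>x. s = pr x y else 0)"

lemma fs_pr [simp]: "fs (pr x y) = x" and sn_pr [simp]: "sn (pr x y) = y"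
  by (auto simp: fs_def sn_def pr_eq_iff)

lemma fs_le: "fs s \<le> s" and sn_le: "sn s \<le> s"
proof -
  have "fs s \<le> s \<and> sn s \<le> s"
  proof (cases "\<exists>x y. s = pr x y")
    case True
    then show ?thesis using le_pr by auto
  next
    case False
    then show ?thesis by (simp add: fs_def sn_def)
  qed
  then show "fs s \<le> s" "sn s \<le> s" by auto
qed

lemma definable_fun_pr:
  "definable_fun f \<Longrightarrow> definable_fun g \<Longrightarrow> definable_fun (\<lambda>e. pr (f e) (g e))"
  unfolding pr_def by (intro definable_intros)

lemma fs_eq_iff: "x = fs s \<longleftrightarrow> (\<exists>y. s = pr x y) \<or> x = 0 \<and> \<not> (\<exists>x y. s = pr x y)"
  by (metis fs_def fs_pr)

lemma sn_eq_iff: "y = sn s \<longleftrightarrow> (\<exists>x. s = pr x y) \<or> y = 0 \<and> \<not> (\<exists>x y. s = pr x y)"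
  by (metis sn_def sn_pr)

lemma definable_fun_fs: "definable_fun f \<Longrightarrow> definable_fun (\<lambda>e. fs (f e))"
  by (rule definable_fun_comp1[where F = fs]) (unfold fs_eq_iff, intro definable_intros definable_fun_pr)

lemma definable_fun_sn: "definable_fun f \<Longrightarrow> definable_fun (\<lambda>e. sn (f e))"
  by (rule definable_fun_comp1[where F = sn]) (unfold sn_eq_iff, intro definable_intros definable_fun_pr)

text \<open>As \<open>pr 0 0 = 0\<close>, a number in this set is an infinite sequence that is eventually zero.\<close>

inductive_set stream :: "'a::peano set" where
  zero: "0 \<in> stream"
| cons: "r \<in> stream \<Longrightarrow> pr x r \<in> stream"

lemma stream_cases: 
  assumes "r \<in> stream" obtains x r' where "r = pr x r'" "r' \<in> stream"
  using assms by cases (use pr_zero stream.zero in metis)+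

subsection \<open>Coding of bounded definable sets\<close>

text \<open>Takes the place of the factorial of \<open>w\<close> in Goedel's beta function, without
  having to define factorials in the model.\<close>

lemma common_multiple: "\<exists>b>0. \<forall>d. 0 < d \<and> d \<le> w \<longrightarrow> d dvd (b :: 'a::peano)"
proof (induction w rule: definable_induct)
  case zero
  show ?case by (auto intro!: exI[of _ 1])
next
  case (succ m)
  then obtain b where "b > 0" "\<forall>d. 0 < d \<and> d \<le> m \<longrightarrow> d dvd b" by blast
  then show ?case
    by (intro exI[of _ "b * (m + 1)"]) (auto simp: peano_le_succ_iff add_nonneg_pos)
qed (intro peano_definable)

text \<open>Distinct moduli of the beta function are coprime, in a form free of primes and gcds.
  Removing a multiple of ?q leaves \<open>a * d * b\<close> with d the distance of \<open>x\<close>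
  and \<open>m\<close>; ?q is prime to \<open>b\<close> by its shape, and d divides
  \<open>b\<close>, so both factors cancel.\<close>

lemma coprime_step:
  fixes a b :: "'a::peano"
  assumes b: "\<And>d. 0 < d \<Longrightarrow> d \<le> w \<Longrightarrow> d dvd b" and "x \<le> w" "m \<le> w" "x \<noteq> m"
    and dvd: "1 + (x + 1) * b dvd a * (1 + (m + 1) * b)"
  shows "1 + (x + 1) * b dvd a"
proof -
  let ?q = "1 + (x + 1) * b"
  have "\<exists>d. 0 < d \<and> d \<le> w \<and> ?q dvd a * d * b"
  proof (cases "x < m")
    case True
    then obtain d where d: "m = x + d" using le_ex_add[of x m] by fastforce
    have "a * (1 + (m + 1) * b) = a * ?q + a * d * b" by (simp add: d algebra_simps)
    then have "?q dvd a * d * b"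
      using dvd dvd_add_right_iff[of ?q "a * ?q" "a * d * b"] by (simp del: distrib_left_numeral)
    moreover have "d \<noteq> 0" using d True by auto
    moreover have "d \<le> w" using d \<open>m \<le> w\<close> by (meson add_increasing le_add_same_cancel2 order_trans peano_zero_le order_refl)
    ultimately show ?thesis by (intro exI[of _ d]) (auto simp: order.strict_iff_order)
  next
    case False
    then obtain d where d: "x = m + d" using le_ex_add[of m x] by fastforce
    have "a * ?q = a * (1 + (m + 1) * b) + a * d * b" by (simp add: d algebra_simps)
    then have "?q dvd a * d * b"
      using dvd dvd_add_right_iff[of ?q "a * (1 + (m + 1) * b)" "a * d * b"]
      by (metis dvd_triv_right)
    moreover have "d \<noteq> 0" using d \<open>x \<noteq> m\<close> by auto
    moreover have "d \<le> w" using d \<open>x \<le> w\<close> by (meson add_increasing le_add_same_cancel2 order_trans peano_zero_le order_refl)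
    ultimately show ?thesis by (intro exI[of _ d]) (auto simp: order.strict_iff_order)
  qed
  then obtain d where d: "0 < d" "d \<le> w" "?q dvd a * d * b" by blast
  have cancel: "?q dvd y" if "?q dvd y * b" for y
  proof -
    have "y * ?q = y * b * (x + 1) + y" by (simp add: algebra_simps)
    then show ?thesis using that
      by (metis dvd_add_right_iff dvd_mult2 dvd_triv_right)
  qed
  obtain k where "b = d * k" using b[OF d(1,2)] by (auto simp: dvd_def)
  then have "a * d * k = a * b" by (simp add: ac_simps)
  moreover have "?q dvd a * d * k" using cancel[OF d(3)] by simp
  ultimately show ?thesis using cancel[of a] by simp
qed

text \<open>The number \<open>a\<close> is the product of the moduli of those members of
  \<open>X\<close> that are below m and at most \<open>w\<close>, built by induction on m;
  \<open>coprime_step\<close> keeps a new factor from adding other members.\<close>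

lemma comprehension:
  fixes X :: "'a::peano set"
  assumes X: "definable (\<lambda>e. e 0 \<in> X)"
  shows "\<exists>a b. \<forall>x\<le>w. 1 + (x + 1) * b dvd a \<longleftrightarrow> x \<in> X"
proof -
  obtain b where b: "b > 0" "\<And>d. 0 < d \<Longrightarrow> d \<le> w \<Longrightarrow> d dvd b" using common_multiple[of w] by blast
  have "\<exists>a. \<forall>x\<le>w. 1 + (x + 1) * b dvd a \<longleftrightarrow> x \<in> X \<and> x < m" for m
  proof (induction m rule: definable_induct)
    case zero
    have "\<not> 1 + (x + 1) * b dvd 1" for x
    proof
      assume "1 + (x + 1) * b dvd 1"
      then obtain k where k: "1 = (1 + (x + 1) * b) * k" by (auto simp: dvd_def)
      then have "1 \<le> k" using peano_one_le[of k] by force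
      have "1 < 1 + (x + 1) * b" using b(1) by (simp add: add_nonneg_pos)
      also have "\<dots> \<le> (1 + (x + 1) * b) * k" using \<open>1 \<le> k\<close>
        mult_left_mono[of 1 k "1 + (x + 1) * b"] by simp
      finally show False using k by simp
    qed
    then show ?case by (intro exI[of _ 1]) auto
  next
    case (succ m)
    then obtain a where a: "\<forall>x\<le>w. 1 + (x + 1) * b dvd a \<longleftrightarrow> x \<in> X \<and> x < m" by blast
    show ?case
    proof (cases "m \<in> X \<and> m \<le> w")
      case True
      have "1 + (x + 1) * b dvd a * (1 + (m + 1) * b) \<longleftrightarrow> x \<in> X \<and> x < m + 1" if "x \<le> w" for x
      proof (cases "x = m")
        case False
        then have "1 + (x + 1) * b dvd a * (1 + (m + 1) * b) \<longleftrightarrow> 1 + (x + 1) * b dvd a"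
          using coprime_step[OF b(2), of w x m a] True that by (auto intro: dvd_mult2)
        then show ?thesis using a that False peano_less_succ_iff[of x m] le_less[of x m] by auto
      qed (use True in auto)
      then show ?thesis by blast
    next
      case False
      then have "x < m + 1 \<longleftrightarrow> x < m" if "x \<in> X" "x \<le> w" for x
        using that peano_less_succ_iff[of x m] le_less[of x m] by auto
      then show ?thesis using a by (intro exI[of _ a]) auto
    qed
  qed (intro peano_definable definable_comp1[of "\<lambda>x. x \<in> X", OF X])
  from this[of "w + 1"] show ?thesis by (auto simp: peano_less_succ_iff)
qed

text \<open>Collection for definable functions. It keeps evaluation tables bounded, as
  \<open>comprehension\<close> can code only bounded sets.\<close>

lemma bounded_image:
  fixes F :: "'a::peano \<Rightarrow> 'a"
  assumes F: "\<And>f. definable_fun f \<Longrightarrow> definable_fun (\<lambda>e. F (f e))"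
  shows "\<exists>b. \<forall>x\<le>w. F x \<le> b"
proof (induction w rule: definable_induct)
  case zero
  then show ?case by (metis order_antisym order_refl peano_zero_le)
next
  case (succ m)
  then obtain b where "\<forall>x\<le>m. F x \<le> b" by blast
  then have "\<forall>x\<le>m + 1. F x \<le> b + F (m + 1)"
    by (auto simp: peano_le_succ_iff intro: add_increasing2)
  then show ?case by blast
qed (intro peano_definable F)

subsection \<open>A language without variable names\<close>

text \<open>
  Truth values are the numbers 0 and 1. An expression is evaluated on a tape \<open>pr l r\<close>, where the
  streams \<open>l\<close> and \<open>r\<close> are the cells to the left and to the right, the latter starting with the
  scanned cell. The variable with index \<open>i\<close> is reached by \<open>i\<close> moves to the right, so that a variable
  costs as much as it does in the original syntax, and \<open>AllUpto s t\<close> quantifies over the contents of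
  the scanned cell up to the bound \<open>s\<close>.
\<close>

datatype expr =
    Nul
  | One
  | Cell
  | Rgt expr
  | Lft expr
  | Plus expr expr
  | Times expr expr
  | Leq expr expr
  | AllUpto expr expr

definition right :: "'a::peano \<Rightarrow> 'a" where
  "right s = pr (pr (fs (sn s)) (fs s)) (sn (sn s))"

definition left :: "'a::peano \<Rightarrow> 'a" where
  "left s = pr (sn (fs s)) (pr (fs (fs s)) (sn s))"

definition put :: "'a::peano \<Rightarrow> 'a \<Rightarrow> 'a" where
  "put z s = pr (fs s) (pr z (sn (sn s)))"

fun ev :: "expr \<Rightarrow> 'a::peano \<Rightarrow> 'a" where
  "ev Nul s = 0"
| "ev One s = 1"
| "ev Cell s = fs (sn s)"
| "ev (Rgt t) s = ev t (right s)"
| "ev (Lft t) s = ev t (left s)"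
| "ev (Plus t u) s = ev t s + ev u s"
| "ev (Times t u) s = ev t s * ev u s"
| "ev (Leq t u) s = (if ev t s \<le> ev u s then 1 else 0)"
| "ev (AllUpto t u) s = (if \<forall>z\<le>ev t s. ev u (put z s) = 1 then 1 else 0)"

lemma definable_fun_tape:
  assumes "definable_fun f"
  shows "definable_fun (\<lambda>e. right (f e))" "definable_fun (\<lambda>e. left (f e))"
  unfolding right_def left_def
  by (intro definable_fun_pr definable_fun_fs definable_fun_sn assms)+

lemma definable_fun_put:
  "definable_fun f \<Longrightarrow> definable_fun g \<Longrightarrow> definable_fun (\<lambda>e. put (f e) (g e))"
  unfolding put_def by (intro definable_fun_pr definable_fun_fs definable_fun_sn)

lemma definable_fun_if:
  assumes "definable P" "definable_fun f" "definable_fun g"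
  shows "definable_fun (\<lambda>e. if P e then f e else g e)"
proof -
  have "definable (\<lambda>e. (P (\<lambda>i. e (Suc i)) \<longrightarrow> e 0 = f (\<lambda>i. e (Suc i))) \<and>
    (\<not> P (\<lambda>i. e (Suc i)) \<longrightarrow> e 0 = g (\<lambda>i. e (Suc i))))"
    by (intro definable_intros definable_shift[OF assms(1)] assms(2,3)[unfolded definable_fun_def])
  moreover have "(\<lambda>e. e 0 = (if P (\<lambda>i. e (Suc i)) then f (\<lambda>i. e (Suc i)) else g (\<lambda>i. e (Suc i)))) =
    (\<lambda>e. (P (\<lambda>i. e (Suc i)) \<longrightarrow> e 0 = f (\<lambda>i. e (Suc i))) \<and>
    (\<not> P (\<lambda>i. e (Suc i)) \<longrightarrow> e 0 = g (\<lambda>i. e (Suc i))))" by auto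
  ultimately show ?thesis unfolding definable_fun_def by simp
qed

text \<open>The recursion on the standard \<open>t\<close> takes place outside the structure and
  gives each \<open>t\<close> a definition of its own. Treating all codes by one formula is the task
  of the tables.\<close>

lemma definable_fun_ev: "definable_fun f \<Longrightarrow> definable_fun (\<lambda>e. ev t (f e))"
proof (induction t arbitrary: f)
  case (AllUpto t u)
  show ?case unfolding ev.simps
    by (intro peano_definable definable_fun_if definable_fun_shift AllUpto definable_fun_put)
next
  case (Leq t u)
  then show ?case unfolding ev.simps by (intro peano_definable definable_fun_if)
qed (auto intro!: definable_intros definable_fun_fs definable_fun_sn definable_fun_tape)

subsection \<open>Evaluation tables\<close>

text \<open>
  The code of an expression is its prefix notation, read as a number in base 11 with the first
  symbol as the least significant digit (the digits 0 and 1 are not used). A table has an entry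
  \<open>(p, s, q, v)\<close> when the expression whose code starts at \<open>p\<close> and ends where \<open>q\<close> starts has value
  \<open>v\<close> on the tape \<open>s\<close>.
\<close>

fun code :: "expr \<Rightarrow> nat \<Rightarrow> nat" where
  "code Nul k = 11 * k + 2"
| "code One k = 11 * k + 3"
| "code Cell k = 11 * k + 4"
| "code (Rgt t) k = 11 * code t k + 5"
| "code (Lft t) k = 11 * code t k + 6"
| "code (Plus t u) k = 11 * code t (code u k) + 7"
| "code (Times t u) k = 11 * code t (code u k) + 8"
| "code (Leq t u) k = 11 * code t (code u k) + 9"
| "code (AllUpto t u) k = 11 * code t (code u k) + 10"

declare code.simps [simp del]

lemma of_nat_code [simp]:
  "of_nat (code Nul k) = (11 * of_nat k + 2 :: 'a::peano)"
  "of_nat (code One k) = (11 * of_nat k + 3 :: 'a)"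
  "of_nat (code Cell k) = (11 * of_nat k + 4 :: 'a)"
  "of_nat (code (Rgt t) k) = (11 * of_nat (code t k) + 5 :: 'a)"
  "of_nat (code (Lft t) k) = (11 * of_nat (code t k) + 6 :: 'a)"
  "of_nat (code (Plus t u) k) = (11 * of_nat (code t (code u k)) + 7 :: 'a)"
  "of_nat (code (Times t u) k) = (11 * of_nat (code t (code u k)) + 8 :: 'a)"
  "of_nat (code (Leq t u) k) = (11 * of_nat (code t (code u k)) + 9 :: 'a)"
  "of_nat (code (AllUpto t u) k) = (11 * of_nat (code t (code u k)) + 10 :: 'a)"
  by (simp_all only: code.simps of_nat_add of_nat_mult of_nat_numeral)

definition entry :: "'a::peano \<Rightarrow> 'a \<Rightarrow> 'a \<Rightarrow> 'a \<Rightarrow> 'a" where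
  "entry p s q v = pr p (pr s (pr q v))"

lemma entry_eq_iff: "entry p s q v = entry p' s' q' v' \<longleftrightarrow> p = p' \<and> s = s' \<and> q = q' \<and> v = v'"
  by (simp add: entry_def pr_eq_iff)

lemma le_entry: "p \<le> entry p s q v" "s \<le> entry p s q v" "q \<le> entry p s q v" "v \<le> entry p s q v"
  unfolding entry_def by (meson le_pr order_trans)+

text \<open>The tape is \<open>pr (pr a l) (pr b r)\<close> with scanned cell \<open>b\<close>. The
  rest after the leading symbol is \<open>p'\<close>, the second argument starts at
  \<open>m\<close>, and \<open>c\<close>, \<open>d\<close> are the values of the arguments. A
  universal quantifier gets value 0 on the evidence of one \<open>z\<close> whose value
  \<open>d\<close> is not 1. The bounds \<open>w\<close> on \<open>z\<close> make this a bounded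
  formula.\<close>

definition clause :: "'a::peano \<Rightarrow> 'a set \<Rightarrow> 'a \<Rightarrow> 'a \<Rightarrow> 'a \<Rightarrow> 'a \<Rightarrow> 'a \<Rightarrow> 'a \<Rightarrow> 'a \<Rightarrow> 'a \<Rightarrow> 'a \<Rightarrow> 'a \<Rightarrow> 'a \<Rightarrow> bool"
  where "clause w Y p a l b r q v p' m c d \<longleftrightarrow>
      p = 11 * q + 2 \<and> v = 0 \<or>
      p = 11 * q + 3 \<and> v = 1 \<or>
      p = 11 * q + 4 \<and> v = b \<or>
      p = 11 * p' + 5 \<and> entry p' (pr (pr b (pr a l)) r) q v \<in> Y \<or>
      p = 11 * p' + 6 \<and> entry p' (pr l (pr a (pr b r))) q v \<in> Y \<or>
      entry p' (pr (pr a l) (pr b r)) m c \<in> Y \<and>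
       (entry m (pr (pr a l) (pr b r)) q d \<in> Y \<and>
         (p = 11 * p' + 7 \<and> v = c + d \<or>
          p = 11 * p' + 8 \<and> v = c * d \<or>
          p = 11 * p' + 9 \<and> (c \<le> d \<and> v = 1 \<or> \<not> c \<le> d \<and> v = 0)) \<or>
        p = 11 * p' + 10 \<and>
         (v = 1 \<and> (\<forall>z\<le>w. z \<le> c \<longrightarrow> entry m (pr (pr a l) (pr z r)) q 1 \<in> Y) \<or>
          v = 0 \<and> (\<exists>z\<le>w. z \<le> c \<and> d \<noteq> 1 \<and> entry m (pr (pr a l) (pr z r)) q d \<in> Y)))"

definition justified :: "'a::peano \<Rightarrow> 'a set \<Rightarrow> 'a \<Rightarrow> bool" where
  "justified w Y x \<longleftrightarrow>
    (\<exists>p\<le>w. \<exists>a\<le>w. \<exists>l\<le>w. \<exists>b\<le>w. \<exists>r\<le>w. \<exists>q\<le>w. \<exists>v\<le>w. \<exists>p'\<le>w. \<exists>m\<le>w. \<exists>c\<le>w. \<exists>d\<le>w.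
      x = entry p (pr (pr a l) (pr b r)) q v \<and> clause w Y p a l b r q v p' m c d)"

text \<open>All clauses are positive in the table, so justified tables can be joined.\<close>

lemma justified_mono:
  assumes "Y \<subseteq> Y'" "justified w Y x" shows "justified w Y' x"
proof -
  have "justified w Y x \<longrightarrow> justified w Y' x"
    unfolding justified_def clause_def
    by (intro disj_mono conj_mono ex_mono all_mono imp_mono imp_refl in_mono assms(1))
  then show ?thesis using assms(2) by blast
qed

lemma justifiedI:
  assumes "entry p (pr (pr a l) (pr b r)) q v \<le> w" "p' \<le> w" "m \<le> w" "c \<le> w" "d \<le> w"
    "clause w Y p a l b r q v p' m c d"
  shows "justified w Y (entry p (pr (pr a l) (pr b r)) q v)"
proof -
  note e = order_trans[OF _ assms(1)]
  have al: "pr a l \<le> w" and br: "pr b r \<le> w"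
    by (rule order_trans[OF le_pr(1) e[OF le_entry(2)]], rule order_trans[OF le_pr(2) e[OF le_entry(2)]])
  show ?thesis
    unfolding justified_def
    by (rule exI[of _ p], rule conjI[OF e[OF le_entry(1)]],
        rule exI[of _ a], rule conjI[OF order_trans[OF le_pr(1) al]],
        rule exI[of _ l], rule conjI[OF order_trans[OF le_pr(2) al]],
        rule exI[of _ b], rule conjI[OF order_trans[OF le_pr(1) br]],
        rule exI[of _ r], rule conjI[OF order_trans[OF le_pr(2) br]],
        rule exI[of _ q], rule conjI[OF e[OF le_entry(3)]],
        rule exI[of _ v], rule conjI[OF e[OF le_entry(4)]],
        rule exI[of _ p'], rule conjI[OF assms(2)], rule exI[of _ m], rule conjI[OF assms(3)],
        rule exI[of _ c], rule conjI[OF assms(4)], rule exI[of _ d], rule conjI[OF assms(5)],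
        rule conjI[OF refl assms(6)])
qed

lemma digits:
  assumes "numeral d < (11 :: 'a)" "numeral d' < (11 :: 'a)"
  shows "11 * x + numeral d = 11 * y + numeral d' \<longleftrightarrow> x = (y :: 'a::peano) \<and> numeral d = (numeral d' :: 'a)"
  using digit_unique[of x "numeral d" y "numeral d'"] assms by auto

lemma digits_cancel: "11 * x = 11 * y \<longleftrightarrow> x = (y :: 'a::peano)"
  using digit_unique[of x 0 y 0] by auto

definition table :: "'a::peano \<Rightarrow> 'a set \<Rightarrow> bool" where
  "table w Y \<longleftrightarrow> (\<forall>x\<in>Y. x \<le> w \<and> justified w Y x)"

text \<open>Induction on the standard \<open>t\<close>. The claim about \<open>q\<close> is unique
  readability of prefix notation: it shows that the \<open>m\<close> of a clause is where the second
  argument really starts, so that the second induction hypothesis applies.\<close>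

lemma table_sound:
  fixes Y :: "'a::peano set"
  assumes Y: "table w Y" and "entry (of_nat (code t k)) s q v \<in> Y"
  shows "q = of_nat k \<and> v = ev t s"
  using assms(2)
proof (induction t arbitrary: k s q v)
  have cases: "\<exists>a l b r p' m c d. s = pr (pr a l) (pr b r) \<and> clause w Y p a l b r q v p' m c d"
    if "entry p s q v \<in> Y" for p s q v
  proof -
    have "justified w Y (entry p s q v)" using Y that by (auto simp: table_def)
    then show ?thesis unfolding justified_def entry_eq_iff by blast
  qed
  have w: "v \<le> w" if "entry p s q v \<in> Y" for p s q v
    using Y that le_entry(4) order_trans unfolding table_def by blast
  note defs = clause_def digits digits_cancel right_def left_def put_def
  {
    case Nul
    then show ?case using cases[OF Nul] by (auto simp: defs)
  next
    case One
    then show ?case using cases[OF One] by (auto simp: defs)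
  next
    case Cell
    then show ?case using cases[OF Cell] by (auto simp: defs)
  next
    case (Rgt t)
    show ?case using cases[OF Rgt.prems] Rgt.IH by (auto simp: defs)
  next
    case (Lft t)
    show ?case using cases[OF Lft.prems] Lft.IH by (auto simp: defs)
  next
    case (Plus t u)
    obtain a l b r p' m c d where s: "s = pr (pr a l) (pr b r)"
      and "clause w Y (of_nat (code (Plus t u) k)) a l b r q v p' m c d"
      using cases[OF Plus.prems] by blast
    then have "entry (of_nat (code t (code u k))) s m c \<in> Y" "entry m s q d \<in> Y"
      "v = (c + d)"
      by (auto simp: defs)
    then show ?case using Plus.IH(1)[of "code u k" s m c] Plus.IH(2)[of k s q d] by auto
  next
    case (Times t u)
    obtain a l b r p' m c d where s: "s = pr (pr a l) (pr b r)"
      and "clause w Y (of_nat (code (Times t u) k)) a l b r q v p' m c d"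
      using cases[OF Times.prems] by blast
    then have "entry (of_nat (code t (code u k))) s m c \<in> Y" "entry m s q d \<in> Y"
      "v = (c * d)"
      by (auto simp: defs)
    then show ?case using Times.IH(1)[of "code u k" s m c] Times.IH(2)[of k s q d] by auto
  next
    case (Leq t u)
    obtain a l b r p' m c d where s: "s = pr (pr a l) (pr b r)"
      and "clause w Y (of_nat (code (Leq t u) k)) a l b r q v p' m c d"
      using cases[OF Leq.prems] by blast
    then have "entry (of_nat (code t (code u k))) s m c \<in> Y" "entry m s q d \<in> Y"
      "v = (if c \<le> d then 1 else 0)"
      by (auto simp: defs)
    then show ?case using Leq.IH(1)[of "code u k" s m c] Leq.IH(2)[of k s q d] by auto
  next
    case (AllUpto t u)
    obtain a l b r p' m c d where s: "s = pr (pr a l) (pr b r)"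
      and "clause w Y (of_nat (code (AllUpto t u) k)) a l b r q v p' m c d"
      using cases[OF AllUpto.prems] by blast
    then have *: "entry (of_nat (code t (code u k))) s m c \<in> Y"
      "v = 1 \<and> (\<forall>z\<le>w. z \<le> c \<longrightarrow> entry m (put z s) q 1 \<in> Y) \<or>
       v = 0 \<and> (\<exists>z\<le>w. z \<le> c \<and> d \<noteq> 1 \<and> entry m (put z s) q d \<in> Y)"
      by (auto simp: defs)
    have mc: "m = of_nat (code u k)" "c = ev t s" using AllUpto.IH(1)[OF *(1)] by auto
    \<comment> \<open>Hence the bound \<open>w\<close> on \<open>z\<close> in the clause cuts
      nothing off the range up to \<open>c\<close>.\<close>
    have "c \<le> w" using w[OF *(1)] .
    from *(2) show ?case
    proof (elim disjE conjE exE)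
      assume v: "v = 1" and z: "\<forall>z\<le>w. z \<le> c \<longrightarrow> entry m (put z s) q 1 \<in> Y"
      have "q = of_nat k \<and> 1 = ev u (put z s)" if "z \<le> c" for z
        using z that \<open>c \<le> w\<close> AllUpto.IH(2)[of k "put z s" q 1] unfolding mc by auto
      then show ?thesis using v mc by (metis (full_types) ev.simps(9) peano_zero_le)
    next
      fix z
      assume "v = 0" "z \<le> c" "d \<noteq> 1" "entry m (put z s) q d \<in> Y"
      then show ?thesis using AllUpto.IH(2)[of k "put z s" q d] unfolding mc by auto
    qed
  }
qed

section \<open>Existence of complete evaluation tables\<close>

definition tape :: "'a::peano set" where
  "tape = {pr l r | l r. l \<in> stream \<and> r \<in> stream}"

lemma tapeI: "l \<in> stream \<Longrightarrow> r \<in> stream \<Longrightarrow> pr l r \<in> tape"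
  unfolding tape_def by blast

text \<open>A clause applies only to tapes of this shape. One more cell can always be split off on
  either side, since the empty stream 0 is \<open>pr 0 0\<close>.\<close>

lemma tape_cases:
  assumes "s \<in> tape" obtains a l b r where "s = pr (pr a l) (pr b r)" "l \<in> stream" "r \<in> stream"
proof -
  obtain l r where s: "s = pr l r" "l \<in> stream" "r \<in> stream" using assms unfolding tape_def by blast
  obtain a l' where l: "l = pr a l'" "l' \<in> stream" using s(2) by (rule stream_cases)
  obtain b r' where r: "r = pr b r'" "r' \<in> stream" using s(3) by (rule stream_cases)
  show thesis using that[of a l' b r'] s l r by simp
qed

lemma tape_moves:
  assumes "s \<in> tape" shows "right s \<in> tape" "left s \<in> tape" "put z s \<in> tape"
proof -
  obtain a l b r where "s = pr (pr a l) (pr b r)" "l \<in> stream" "r \<in> stream"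
    using assms by (rule tape_cases)
  then show "right s \<in> tape" "left s \<in> tape" "put z s \<in> tape"
    by (simp_all add: right_def left_def put_def tapeI stream.cons)
qed

lemma definable_image:
  assumes "definable (\<lambda>e. e 0 \<in> A)" "\<And>f. definable_fun f \<Longrightarrow> definable_fun (\<lambda>e. F (f e))"
  shows "definable (\<lambda>e. e 0 \<in> F ` A)"
proof -
  have "definable (\<lambda>e. \<exists>x. x \<in> A \<and> e 0 = F x)"
    by (intro definable_intros assms(2) definable_comp1[of "\<lambda>x. x \<in> A", OF assms(1)])
  then show ?thesis by (simp add: image_iff Bex_def)
qed

lemma definable_Un:
  "definable (\<lambda>e. e 0 \<in> A) \<Longrightarrow> definable (\<lambda>e. e 0 \<in> B) \<Longrightarrow> definable (\<lambda>e. e 0 \<in> A \<union> B)"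
  using definable_or[of "\<lambda>e. e 0 \<in> A" "\<lambda>e. e 0 \<in> B"] by simp

definition bounded :: "'a::peano set \<Rightarrow> bool" where
  "bounded A \<longleftrightarrow> (\<exists>w. \<forall>x\<in>A. x \<le> w)"

lemma bounded_Un: "bounded A \<Longrightarrow> bounded B \<Longrightarrow> bounded (A \<union> B)"
  unfolding bounded_def by (metis UnE linorder_linear order_trans)

lemma bounded_Image:
  "bounded A \<Longrightarrow> (\<And>f. definable_fun f \<Longrightarrow> definable_fun (\<lambda>e. F (f e))) \<Longrightarrow> bounded (F ` A)"
  using bounded_image[of F] unfolding bounded_def by blast

text \<open>A whole set of tapes is treated at once, because a bounded quantifier evaluates its body
  on a possibly nonstandard number of tapes. Being a table for every large enough \<open>w\<close>
  allows tables with different bounds to be joined.\<close>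

definition covers :: "'a::peano set \<Rightarrow> expr \<Rightarrow> nat \<Rightarrow> 'a set \<Rightarrow> bool" where
  "covers A t k X \<longleftrightarrow> definable (\<lambda>e. e 0 \<in> X) \<and> bounded X \<and>
    (\<forall>w. (\<forall>x\<in>X. x \<le> w) \<longrightarrow> table w X) \<and>
    (\<forall>s\<in>A. entry (of_nat (code t k)) s (of_nat k) (ev t s) \<in> X)"

text \<open>The entries for an expression are put on top of a table for its parts, which justifies
  them; the old entries stay justified by monotonicity.\<close>

lemma covers_step:
  assumes A: "definable (\<lambda>e. e 0 \<in> A)" "bounded A"
    and X: "definable (\<lambda>e. e 0 \<in> X)" "bounded X" "\<And>w. \<forall>x\<in>X. x \<le> w \<Longrightarrow> table w X"
    and just: "\<And>s w. s \<in> A \<Longrightarrow> \<forall>x\<in>X. x \<le> w \<Longrightarrow>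
      entry (of_nat (code t k)) s (of_nat k) (ev t s) \<le> w \<Longrightarrow>
      justified w X (entry (of_nat (code t k)) s (of_nat k) (ev t s))"
  shows "\<exists>X. covers A t k X"
proof -
  define F where "F s = entry (of_nat (code t k)) s (of_nat k) (ev t s)" for s :: 'a
  have F: "definable_fun (\<lambda>e. F (f e))" if "definable_fun f" for f
    unfolding F_def entry_def
    by (intro definable_fun_pr definable_fun_const definable_fun_ev that)
  have "table w (X \<union> F ` A)" if w: "\<forall>x\<in>X \<union> F ` A. x \<le> w" for w
  proof -
    have "\<forall>x\<in>X. x \<le> w" using w by blast
    moreover have "justified w X x" if "x \<in> F ` A" for x
      using that just w unfolding F_def by blast
    moreover have "justified w X x" if "x \<in> X" for x
      using X(3)[OF calculation(1)] that unfolding table_def by blast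
    ultimately show ?thesis using w justified_mono[of X "X \<union> F ` A" w] unfolding table_def by blast
  qed
  moreover have "definable (\<lambda>e. e 0 \<in> X \<union> F ` A)" "bounded (X \<union> F ` A)"
    by (intro definable_Un definable_image bounded_Un bounded_Image A X F; assumption)+
  ultimately have "covers A t k (X \<union> F ` A)"
    unfolding covers_def F_def[symmetric] by blast
  then show ?thesis by blast
qed

lemma covers_Un:
  assumes "covers A t k X" "covers B u j X'"
  shows "definable (\<lambda>e. e 0 \<in> X \<union> X')" "bounded (X \<union> X')"
    "\<And>w. \<forall>x\<in>X \<union> X'. x \<le> w \<Longrightarrow> table w (X \<union> X')"
proof -
  show "definable (\<lambda>e. e 0 \<in> X \<union> X')" using assms unfolding covers_def by (intro definable_Un) auto
  show "bounded (X \<union> X')" using assms unfolding covers_def by (intro bounded_Un) auto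
  fix w assume w: "\<forall>x\<in>X \<union> X'. x \<le> w"
  then have "table w X" "table w X'" using assms unfolding covers_def by auto
  then show "table w (X \<union> X')"
    unfolding table_def using justified_mono[of X "X \<union> X'" w] justified_mono[of X' "X \<union> X'" w] by blast
qed

lemma covers_entry:
  assumes "covers A t k X" "\<forall>x\<in>X. x \<le> w" "s \<in> A"
  shows "entry (of_nat (code t k)) s (of_nat k) (ev t s) \<in> X" "of_nat (code t k) \<le> w"
    "of_nat k \<le> w" "ev t s \<le> w"
proof -
  show *: "entry (of_nat (code t k)) s (of_nat k) (ev t s) \<in> X"
    using assms unfolding covers_def by blast
  have "entry (of_nat (code t k)) s (of_nat k) (ev t s) \<le> w" using assms(2) * by blast
  note e = order_trans[OF _ this]
  show "of_nat (code t k) \<le> w" "of_nat k \<le> w" "ev t s \<le> w" by (rule e[OF le_entry(1)] e[OF le_entry(3)] e[OF le_entry(4)])+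
qed

lemma covers_leaf:
  fixes A :: "'a::peano set"
  assumes A: "definable (\<lambda>e. e 0 \<in> A)" "bounded A" "A \<subseteq> tape"
    and cl: "\<And>a l b r w :: 'a. clause w {} (of_nat (code t k)) a l b r (of_nat k)
      (ev t (pr (pr a l) (pr b r))) 0 0 0 0"
  shows "\<exists>X. covers A t k X"
proof (rule covers_step[OF A(1,2), of "{}"])
  show "definable (\<lambda>e. e 0 \<in> ({} :: 'a set))"
    using definable_not[OF definable_eq[OF definable_fun_const definable_fun_const], of "0::'a" "0::'a"]
    by simp
  fix s w :: 'a
  assume s: "s \<in> A" and w: "entry (of_nat (code t k)) s (of_nat k) (ev t s) \<le> w"
  obtain a l b r where s: "s = pr (pr a l) (pr b r)" by (rule tape_cases[OF subsetD[OF A(3) s]])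
  show "justified w {} (entry (of_nat (code t k)) s (of_nat k) (ev t s))"
    unfolding s by (rule justifiedI[OF w[unfolded s] _ _ _ _ cl]) simp_all
qed (simp_all add: bounded_def table_def)

lemma covers_move:
  fixes A :: "'a::peano set"
  assumes A: "definable (\<lambda>e. e 0 \<in> A)" "bounded A" "A \<subseteq> tape"
    and X: "covers (F ` A) t k X"
    and cl: "\<And>a l b r w. entry (of_nat (code t k)) (F (pr (pr a l) (pr b r))) (of_nat k)
        (ev t (F (pr (pr a l) (pr b r)))) \<in> X \<Longrightarrow>
      clause w X (of_nat (code u k)) a l b r (of_nat k) (ev u (pr (pr a l) (pr b r)))
        (of_nat (code t k)) 0 0 0"
  shows "\<exists>X. covers A u k X"
proof (rule covers_step[OF A(1,2), of X])
  fix s w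
  assume s: "s \<in> A" and w: "\<forall>x\<in>X. x \<le> w" "entry (of_nat (code u k)) s (of_nat k) (ev u s) \<le> w"
  obtain a l b r where s': "s = pr (pr a l) (pr b r)" by (rule tape_cases[OF subsetD[OF A(3) s]])
  note e = covers_entry[OF X w(1) imageI[OF s], unfolded s']
  show "justified w X (entry (of_nat (code u k)) s (of_nat k) (ev u s))"
    unfolding s' by (rule justifiedI[OF w(2)[unfolded s'] e(2) _ _ _ cl[OF e(1)]]) simp_all
qed (use X in \<open>auto simp: covers_def\<close>)

lemma covers_binary:
  fixes A :: "'a::peano set"
  assumes A: "definable (\<lambda>e. e 0 \<in> A)" "bounded A" "A \<subseteq> tape"
    and X: "covers A t (code u k) X" "covers A u k X'"
    and cl: "\<And>(a :: 'a) l b r w Y. entry (of_nat (code t (code u k))) (pr (pr a l) (pr b r)) (of_nat (code u k))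
        (ev t (pr (pr a l) (pr b r))) \<in> Y \<Longrightarrow>
      entry (of_nat (code u k)) (pr (pr a l) (pr b r)) (of_nat k) (ev u (pr (pr a l) (pr b r))) \<in> Y \<Longrightarrow>
      clause w Y (of_nat (code f k)) a l b r (of_nat k) (ev f (pr (pr a l) (pr b r)))
        (of_nat (code t (code u k))) (of_nat (code u k)) (ev t (pr (pr a l) (pr b r)))
        (ev u (pr (pr a l) (pr b r)))"
  shows "\<exists>X. covers A f k X"
proof (rule covers_step[OF A(1,2) covers_Un[OF X]])
  fix s w
  assume s: "s \<in> A" and w: "\<forall>x\<in>X \<union> X'. x \<le> w" "entry (of_nat (code f k)) s (of_nat k) (ev f s) \<le> w"
  obtain a l b r where s': "s = pr (pr a l) (pr b r)" by (rule tape_cases[OF subsetD[OF A(3) s]])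
  have "\<forall>x\<in>X. x \<le> w" "\<forall>x\<in>X'. x \<le> w" using w by auto
  note e = covers_entry[OF X(1) this(1) s, unfolded s'] covers_entry[OF X(2) this(2) s, unfolded s']
  show "justified w (X \<union> X') (entry (of_nat (code f k)) s (of_nat k) (ev f s))"
    unfolding s'
    by (rule justifiedI[OF w(2)[unfolded s'] e(2) e(3) e(4) e(8) cl[OF UnI1[OF e(1), of X'] UnI2[OF e(5), of X]]])
qed

lemma table_complete:
  fixes A :: "'a::peano set"
  assumes "definable (\<lambda>e. e 0 \<in> A)" "bounded A" "A \<subseteq> tape"
  shows "\<exists>X. covers A t k X"
  using assms
proof (induction t arbitrary: k A)
  note simps = clause_def right_def left_def put_def
  {
    case Nul
    then show ?case by (rule covers_leaf) (simp add: simps)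
  next
    case One
    then show ?case by (rule covers_leaf) (simp add: simps)
  next
    case Cell
    then show ?case by (rule covers_leaf) (simp add: simps)
  next
    case (Rgt t)
    have "definable (\<lambda>e. e 0 \<in> right ` A)" "bounded (right ` A)" "right ` A \<subseteq> tape"
      using Rgt.prems by (auto intro!: definable_image bounded_Image definable_fun_tape tape_moves)
    then obtain X where "covers (right ` A) t k X" using Rgt.IH by blast
    then show ?case by (rule covers_move[OF Rgt.prems]) (simp add: simps)
  next
    case (Lft t)
    have "definable (\<lambda>e. e 0 \<in> left ` A)" "bounded (left ` A)" "left ` A \<subseteq> tape"
      using Lft.prems by (auto intro!: definable_image bounded_Image definable_fun_tape tape_moves)
    then obtain X where "covers (left ` A) t k X" using Lft.IH by blast
    then show ?case by (rule covers_move[OF Lft.prems]) (simp add: simps)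
  next
    case (Plus t u)
    obtain X1 X2 where "covers A t (code u k) X1" "covers A u k X2" using Plus by meson
    then show ?case by (rule covers_binary[OF Plus.prems]) (simp add: simps)
  next
    case (Times t u)
    obtain X1 X2 where "covers A t (code u k) X1" "covers A u k X2" using Times by meson
    then show ?case by (rule covers_binary[OF Times.prems]) (simp add: simps)
  next
    case (Leq t u)
    obtain X1 X2 where "covers A t (code u k) X1" "covers A u k X2" using Leq by meson
    then show ?case by (rule covers_binary[OF Leq.prems]) (simp add: simps)
  next
    case (AllUpto t u)
    \<comment> \<open>The tapes on which the body is evaluated. They are bounded because collection
      bounds the values of \<open>t\<close> on \<open>A\<close>.\<close>
    define B where "B = {put z s | z s. s \<in> A \<and> z \<le> ev t s}"
    have "definable (\<lambda>e. \<exists>z s. s \<in> A \<and> z \<le> ev t s \<and> e 0 = put z s)"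
      by (intro definable_intros definable_fun_ev definable_fun_put
          definable_comp1[of "\<lambda>x. x \<in> A", OF AllUpto.prems(1)])
    then have B: "definable (\<lambda>e. e 0 \<in> B)" unfolding B_def by (simp add: conj_commute conj_left_commute)
    obtain w where w: "\<forall>s\<in>A. s \<le> w" using AllUpto.prems(2) unfolding bounded_def by blast
    obtain b where b: "\<forall>s\<le>w. ev t s \<le> b" using bounded_image[of "ev t" w, OF definable_fun_ev] by blast
    have "put z s \<le> pr w (pr b w)" if "s \<in> A" "z \<le> ev t s" for z s
    proof -
      have "s \<le> w" using w that by blast
      moreover have "z \<le> b" using b w that order_trans by blast
      ultimately show ?thesis unfolding put_def
        by (intro pr_mono) (meson fs_le sn_le order_trans)+
    qed
    then have B': "bounded B" unfolding bounded_def B_def by blast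
    have "B \<subseteq> tape" using AllUpto.prems(3) tape_moves unfolding B_def by blast
    with B B' obtain X1 X2 where X: "covers A t (code u k) X1" "covers B u k X2"
      using AllUpto.IH AllUpto.prems by meson
    show ?case
    proof (rule covers_step[OF AllUpto.prems(1,2) covers_Un[OF X]])
      fix s w assume s: "s \<in> A" and w: "\<forall>x\<in>X1 \<union> X2. x \<le> w"
        "entry (of_nat (code (AllUpto t u) k)) s (of_nat k) (ev (AllUpto t u) s) \<le> w"
      obtain a l b r where s': "s = pr (pr a l) (pr b r)" by (rule tape_cases[OF subsetD[OF AllUpto.prems(3) s]])
      have w': "\<forall>x\<in>X1. x \<le> w" "\<forall>x\<in>X2. x \<le> w" using w by auto
      note X1 = covers_entry[OF X(1) w'(1) s]
      have X2: "entry (of_nat (code u k)) (put z s) (of_nat k) (ev u (put z s)) \<in> X2" "ev u (put z s) \<le> w"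
        if "z \<le> ev t s" for z
        using covers_entry[OF X(2) w'(2), of "put z s"] that s unfolding B_def by blast+
      show "justified w (X1 \<union> X2) (entry (of_nat (code (AllUpto t u) k)) s (of_nat k) (ev (AllUpto t u) s))"
      proof (cases "\<forall>z\<le>ev t s. ev u (put z s) = 1")
        case True
        have "entry (of_nat (code u k)) (put z s) (of_nat k) 1 \<in> X2" if "z \<le> ev t s" for z
          using X2(1)[OF that] True that by simp
        then show ?thesis using True w X1 unfolding s'
          by (intro justifiedI[of _ _ _ _ _ _ _ _ "of_nat (code t (code u k))" "of_nat (code u k)"
              "ev t s" 0]) (auto simp: simps s')
      next
        case False
        then obtain z where z: "z \<le> ev t s" "ev u (put z s) \<noteq> 1" by blast
        then have "z \<le> w" using X1(4) by (meson order_trans)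
        with z X2[OF z(1)] False show ?thesis using w X1 unfolding s'
          by (intro justifiedI[of _ _ _ _ _ _ _ _ "of_nat (code t (code u k))" "of_nat (code u k)"
              "ev t s" "ev u (put z s)"]) (auto simp: simps s')
      qed
    qed
  }
qed

subsection \<open>Translating formulas into expressions\<close>

fun compile_trm :: "trm \<Rightarrow> expr" where
  "compile_trm (Var i) = (Rgt ^^ i) Cell"
| "compile_trm Zero = Nul"
| "compile_trm (Succ t) = Plus (compile_trm t) One"
| "compile_trm (Add s t) = Plus (compile_trm s) (compile_trm t)"
| "compile_trm (Mul s t) = Times (compile_trm s) (compile_trm t)"

text \<open>
  On truth values, implication is \<open>\<le>\<close> and negation is \<open>\<le> 0\<close>. Formulas that are not \<open>\<Delta>\<^sub>0\<close> get a
  junk value.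
\<close>

fun compile :: "form \<Rightarrow> expr" where
  "compile (Eq s t) = Leq (Leq (Leq (compile_trm s) (compile_trm t))
     (Leq (Leq (compile_trm t) (compile_trm s)) Nul)) Nul"
| "compile (Le s t) = Leq (compile_trm s) (compile_trm t)"
| "compile (Neg \<phi>) = Leq (compile \<phi>) Nul"
| "compile (Imp \<phi> \<psi>) = Leq (compile \<phi>) (compile \<psi>)"
| "compile (Forall x (Imp (Le u t) \<phi>)) =
     (Rgt ^^ x) (AllUpto ((Lft ^^ x) (compile_trm t)) ((Lft ^^ x) (compile \<phi>)))"
| "compile (Forall x _) = Nul"

definition look :: "'a::peano \<Rightarrow> nat \<Rightarrow> 'a" where
  "look s i = fs ((sn ^^ i) (sn s))"

lemma ev_Rgt_pow: "ev ((Rgt ^^ i) t) s = ev t ((right ^^ i) s)"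
  by (induction i arbitrary: s) (simp_all add: funpow_swap1[of right])

lemma ev_Lft_pow: "ev ((Lft ^^ i) t) s = ev t ((left ^^ i) s)"
  by (induction i arbitrary: s) (simp_all add: funpow_swap1[of left])

lemma fs_right: "fs (right s) = pr (fs (sn s)) (fs s)"
  by (simp add: right_def)

lemma look_right: "look (right s) i = look s (Suc i)"
  by (simp add: look_def right_def funpow_swap1)

lemma look_right_pow: "look ((right ^^ i) s) j = look s (i + j)"
  by (induction i arbitrary: j) (simp_all add: look_right)

lemma fs_sn_look: "fs (sn s) = look s 0"
  by (simp add: look_def)

lemma ev_compile_trm: "ev (compile_trm t) s = tval (look s) t"
  by (induction t) (simp_all add: ev_Rgt_pow fs_sn_look look_right_pow)

lemma look_left_0: "look (left s) 0 = fs (fs s)" and look_left_Suc: "look (left s) (Suc i) = look s i"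
  by (simp_all add: look_def left_def funpow_swap1)

text \<open>A compiled quantifier runs to its cell and back. For an \<open>s\<close> that is not a
  proper tape the moves need not cancel; what returns is \<open>fs\<close> and every cell that
  \<open>look\<close> can read, and the latter determine the value of a compiled formula.\<close>

lemma left_right_pow:
  "fs ((left ^^ i) ((right ^^ i) s)) = fs s \<and> look ((left ^^ i) ((right ^^ i) s)) = look s"
proof (induction i arbitrary: s)
  case (Suc i)
  define u where "u = (left ^^ i) ((right ^^ i) (right s))"
  have u: "fs u = pr (fs (sn s)) (fs s)" "look u = look (right s)"
    using Suc[of "right s"] by (simp_all add: u_def fs_right)
  have "look (left u) j = look s j" for j
    by (cases j) (simp_all add: look_left_0 look_left_Suc u fs_sn_look look_right)
  moreover have "fs (left u) = fs s" by (simp add: left_def u)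
  ultimately show ?case by (auto simp: u_def funpow_swap1 fun_eq_iff)
qed auto

lemma left_put_right_pow:
  "fs ((left ^^ i) (put z ((right ^^ i) s))) = fs s \<and>
   look ((left ^^ i) (put z ((right ^^ i) s))) = (look s)(i := z)"
proof (induction i arbitrary: s)
  case 0
  have "look (put z s) j = ((look s)(0 := z)) j" for j
    by (cases j) (simp_all add: look_def put_def funpow_swap1)
  then show ?case by (auto simp: put_def)
next
  case (Suc i)
  define u where "u = (left ^^ i) (put z ((right ^^ i) (right s)))"
  have u: "fs u = pr (fs (sn s)) (fs s)" "look u = (look (right s))(i := z)"
    using Suc[of "right s"] unfolding u_def fs_right by blast+
  have "look (left u) j = ((look s)(Suc i := z)) j" for j
    by (cases j) (simp_all add: look_left_0 look_left_Suc u fs_sn_look look_right)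
  moreover have "fs (left u) = fs s" by (simp add: left_def u)
  ultimately show ?case by (auto simp: u_def funpow_swap1 fun_eq_iff)
qed

lemma ev_compile: "delta0 \<phi> \<Longrightarrow> ev (compile \<phi>) s = (if gsat (look s) \<phi> then 1 else 0)"
proof (induction arbitrary: s rule: delta0.induct)
  case (5 x t \<phi>)
  have "tval ((look s)(x := m)) t = tval (look s) t" for m
    by (rule tval_cong) (use 5 in auto)
  then show ?case
    by (simp add: ev_Rgt_pow ev_Lft_pow ev_compile_trm left_right_pow left_put_right_pow 5
        fun_upd_same del: fun_upd_apply) blast
qed (auto simp: ev_compile_trm)

section \<open>Lengths of expressions and sizes of codes\<close>

fun symbols :: "expr \<Rightarrow> nat" where
  "symbols Nul = 1"
| "symbols One = 1"
| "symbols Cell = 1"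
| "symbols (Rgt t) = symbols t + 1"
| "symbols (Lft t) = symbols t + 1"
| "symbols (Plus t u) = symbols t + symbols u + 1"
| "symbols (Times t u) = symbols t + symbols u + 1"
| "symbols (Leq t u) = symbols t + symbols u + 1"
| "symbols (AllUpto t u) = symbols t + symbols u + 1"

text \<open>Adding 1 on both sides makes the bound compose: a digit d is at most 10, so 11 * c + d +
  1 is at most 11 * (c + 1).\<close>

lemma code_bound: "code t k + 1 \<le> 11 ^ symbols t * (k + 1)"
proof (induction t arbitrary: k)
  have step: "11 * c + d + 1 \<le> 11 ^ (i + j + 1) * (k + 1)"
    if "d \<le> 10" "c + 1 \<le> 11 ^ i * (k' + 1)" "k' + 1 \<le> 11 ^ j * (k + 1)" for c d i j k k' :: nat
  proof -
    have "11 * c + d + 1 \<le> 11 * (c + 1)" using that(1) by simp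
    also have "\<dots> \<le> 11 * (11 ^ i * (11 ^ j * (k + 1)))"
      using that(2,3) by (meson le_trans mult_le_mono2)
    also have "\<dots> = 11 ^ (i + j + 1) * (k + 1)" by (simp add: power_add algebra_simps)
    finally show ?thesis .
  qed
  {
    case (Rgt t)
    then show ?case using step[of 5 "code t k" "symbols t" k 0 k] by (simp add: code.simps)
  next
    case (Lft t)
    then show ?case using step[of 6 "code t k" "symbols t" k 0 k] by (simp add: code.simps)
  next
    case (Plus t u)
    then show ?case using step[of 7 _ "symbols t" "code u k" "symbols u" k] by (simp add: code.simps)
  next
    case (Times t u)
    then show ?case using step[of 8 _ "symbols t" "code u k" "symbols u" k] by (simp add: code.simps)
  next
    case (Leq t u)
    then show ?case using step[of 9 _ "symbols t" "code u k" "symbols u" k] by (simp add: code.simps)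
  next
    case (AllUpto t u)
    then show ?case using step[of 10 _ "symbols t" "code u k" "symbols u" k] by (simp add: code.simps)
  }
qed (simp_all add: code.simps)

lemma symbols_pow: "symbols ((Rgt ^^ i) t) = i + symbols t" "symbols ((Lft ^^ i) t) = i + symbols t"
  by (induction i) auto

lemma symbols_compile_trm: "symbols (compile_trm t) \<le> 2 * length (trm_string t)"
  by (induction t) (auto simp: symbols_pow var_string_def)

text \<open>Linear because only the terms of an equation are duplicated, never a formula: they occur
  twice each, among seven further symbols.\<close>

lemma symbols_compile: "delta0 \<phi> \<Longrightarrow> symbols (compile \<phi>) \<le> 7 * form_length \<phi>"
proof (induction rule: delta0.induct)
  case (1 s t)
  then show ?case using symbols_compile_trm[of s] symbols_compile_trm[of t] by (simp add: form_length_def)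
next
  case (2 s t)
  then show ?case using symbols_compile_trm[of s] symbols_compile_trm[of t] by (simp add: form_length_def)
next
  case (5 x t \<phi>)
  then show ?case using symbols_compile_trm[of t]
    by (simp add: form_length_def symbols_pow var_string_def)
qed (simp_all add: form_length_def)

text \<open>Also strips a bounded quantifier at the front of the matrix proper; what remains then is
  an implication of bounded formulas, and so is still bounded.\<close>

fun matrix :: "form \<Rightarrow> form" where
  "matrix (Forall x \<phi>) = matrix \<phi>"
| "matrix \<phi> = \<phi>"

lemma delta0_matrix: "pi1 \<phi> \<Longrightarrow> delta0 (matrix \<phi>)"
proof (induction rule: pi1.induct)
  case (1 \<phi>)
  then show ?case by cases (auto intro: delta0.intros)
qed auto

lemma length_matrix: "form_length (matrix \<phi>) \<le> form_length \<phi>"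
  by (induction \<phi> rule: matrix.induct) (auto simp: form_length_def)

text \<open>A refutation picks an arbitrary tape, that is an assignment to all variables, so the
  leading universal quantifiers need no code.\<close>

lemma gsat_matrix: "(\<forall>e :: nat \<Rightarrow> 'a::arith. gsat e (matrix \<phi>)) \<longleftrightarrow> (\<forall>e :: nat \<Rightarrow> 'a. gsat e \<phi>)"
proof (induction \<phi> rule: matrix.induct)
  case (1 x \<phi>)
  have inst: "gsat e \<phi>" if "\<forall>e :: nat \<Rightarrow> 'a. gsat e (Forall x \<phi>)" for e :: "nat \<Rightarrow> 'a"
  proof -
    show ?thesis using that[unfolded gsat.simps, rule_format, of e "e x"] by simp
  qed
  have "(\<forall>e :: nat \<Rightarrow> 'a. gsat e (Forall x \<phi>)) \<longleftrightarrow> (\<forall>e :: nat \<Rightarrow> 'a. gsat e \<phi>)"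
    by (intro iffI allI, erule inst) simp
  then show ?case using 1 by simp
qed auto

lemma code_matrix:
  assumes "pi1 \<psi>" "form_length \<psi> \<le> n" shows "code (compile (matrix \<psi>)) 0 \<le> 11 ^ (7 * n)"
proof -
  have "code (compile (matrix \<psi>)) 0 + 1 \<le> 11 ^ symbols (compile (matrix \<psi>))"
    using code_bound[of "compile (matrix \<psi>)" 0] by simp
  also have "\<dots> \<le> 11 ^ (7 * n)"
    using symbols_compile[OF delta0_matrix[OF assms(1)]] length_matrix[of \<psi>] assms(2)
    by (intro power_increasing) auto
  finally show ?thesis by simp
qed

subsection \<open>Refutations\<close>

text \<open>In \<open>entry c s 0 0\<close> the first 0 says that nothing follows the expression,
  the second that its value is false. One bound \<open>y\<close> on all data makes the notion
  bounded and monotone, so that refutations can be compared by their least \<open>y\<close>.\<close>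

definition refuted :: "'a::peano \<Rightarrow> 'a \<Rightarrow> bool" where
  "refuted c y \<longleftrightarrow> (\<exists>w\<le>y. \<exists>a\<le>y. \<exists>b\<le>y. \<exists>s\<le>y.
    table w {x. x \<le> w \<and> 1 + (x + 1) * b dvd a} \<and>
    entry c s 0 0 \<in> {x. x \<le> w \<and> 1 + (x + 1) * b dvd a})"

lemma refuted_mono: "refuted c y \<Longrightarrow> y \<le> y' \<Longrightarrow> refuted c y'"
  unfolding refuted_def by (meson order_trans)

lemma refuted_sound:
  assumes "refuted (of_nat (code t 0)) (y :: 'a::peano)" shows "\<exists>s::'a. ev t s = 0"
proof -
  obtain w Y s where "table w Y" "entry (of_nat (code t 0)) s 0 (0::'a) \<in> Y"
    using assms unfolding refuted_def by blast
  then show ?thesis using table_sound by fastforce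
qed

lemma refuted_complete:
  assumes "s \<in> tape" "ev t s = (0 :: 'a::peano)" shows "\<exists>y. refuted (of_nat (code t 0)) (y :: 'a)"
proof -
  have "definable (\<lambda>e. e 0 \<in> {s})" 
    using definable_eq[OF definable_fun_var[of 0] definable_fun_const[of s]] by simp
  moreover have "bounded {s}" unfolding bounded_def by blast
  ultimately obtain X where X: "covers {s} t 0 X" using table_complete[of "{s}" t 0] assms(1) by blast
  then obtain w where w: "\<forall>x\<in>X. x \<le> w" unfolding covers_def bounded_def by blast
  obtain a b where ab: "\<forall>x\<le>w. 1 + (x + 1) * b dvd a \<longleftrightarrow> x \<in> X"
    using comprehension X unfolding covers_def by blast
  have "{x. x \<le> w \<and> 1 + (x + 1) * b dvd a} = X" using w ab by auto
  then have main: "table w {x. x \<le> w \<and> 1 + (x + 1) * b dvd a} \<and>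
      entry (of_nat (code t 0)) s 0 0 \<in> {x. x \<le> w \<and> 1 + (x + 1) * b dvd a}"
    using X w assms(2) unfolding covers_def by auto
  have le: "w \<le> w + a + b + s" "a \<le> w + a + b + s" "b \<le> w + a + b + s" "s \<le> w + a + b + s"
    by (simp_all add: add_increasing add_increasing2)
  have "refuted (of_nat (code t 0)) (w + a + b + s)"
    unfolding refuted_def
    by (rule exI[of _ w], rule conjI[OF le(1)], rule exI[of _ a], rule conjI[OF le(2)],
        rule exI[of _ b], rule conjI[OF le(3)], rule exI[of _ s], rule conjI[OF le(4)], rule main)
  then show ?thesis by blast
qed

text \<open>A standard number of cells is enough for the free variables of a formula, even if their
  contents are nonstandard.\<close>

lemma tape_of_env: "\<exists>s\<in>tape. \<forall>i<n. look s i = e i"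
proof -
  have "\<exists>r\<in>stream. \<forall>i<n. fs ((sn ^^ i) r) = e i" for e :: "nat \<Rightarrow> 'a"
  proof (induction n arbitrary: e)
    case 0
    then show ?case using stream.zero by blast
  next
    case (Suc n)
    obtain r where r: "r \<in> stream" "\<forall>i<n. fs ((sn ^^ i) r) = e (Suc i)"
      using Suc[of "\<lambda>i. e (Suc i)"] by blast
    have "fs ((sn ^^ i) (pr (e 0) r)) = e i" if "i < Suc n" for i
      using that r(2) by (cases i) (simp_all add: funpow_swap1)
    then show ?case using r(1) stream.cons by blast
  qed
  then obtain r where "r \<in> stream" "\<forall>i<n. fs ((sn ^^ i) r) = e i" by blast
  then show ?thesis using tapeI[OF stream.zero] by (intro bexI[of _ "pr 0 r"]) (auto simp: look_def)
qed

text \<open>Both sides refer to the same structure: in a nonstandard model the assignment and the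
  refutation may be nonstandard.\<close>

lemma refuted_iff:
  assumes "delta0 \<phi>"
  shows "(\<exists>y::'a::peano. refuted (of_nat (code (compile \<phi>) 0)) y) \<longleftrightarrow> (\<exists>e::nat \<Rightarrow> 'a. \<not> gsat e \<phi>)"
proof
  assume "\<exists>y::'a. refuted (of_nat (code (compile \<phi>) 0)) y"
  then obtain s :: 'a where "ev (compile \<phi>) s = 0" using refuted_sound by blast
  then show "\<exists>e::nat \<Rightarrow> 'a. \<not> gsat e \<phi>" using ev_compile[OF assms, of s] by (auto split: if_splits)
next
  assume "\<exists>e::nat \<Rightarrow> 'a. \<not> gsat e \<phi>"
  then obtain e :: "nat \<Rightarrow> 'a" where e: "\<not> gsat e \<phi>" by blast
  obtain n where n: "\<forall>i\<in>free_vars \<phi>. i < n"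
    using finite_free_vars[of \<phi>] by (metis finite_nat_set_iff_bounded)
  obtain s where s: "s \<in> tape" "\<forall>i<n. look s i = e i" using tape_of_env by blast
  have "gsat (look s) \<phi> = gsat e \<phi>" by (rule gsat_cong) (use n s in auto)
  then have "ev (compile \<phi>) s = 0" using ev_compile[OF assms, of s] e by simp
  then show "\<exists>y::'a. refuted (of_nat (code (compile \<phi>) 0)) y" using refuted_complete s(1) by blast
qed

lemma refuted_matrix:
  assumes "pi1 \<psi>"
  shows "(\<exists>y::'a::peano. refuted (of_nat (code (compile (matrix \<psi>)) 0)) y) \<longleftrightarrow> (\<exists>e::nat \<Rightarrow> 'a. \<not> gsat e \<psi>)"
  using refuted_iff[OF delta0_matrix[OF assms]] gsat_matrix[of \<psi>] by blast

subsection \<open>Refutability as a bounded formula\<close>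

abbreviation Or :: "form \<Rightarrow> form \<Rightarrow> form" where
  "Or \<phi> \<psi> \<equiv> Imp (Neg \<phi>) \<psi>"

definition All_le :: "nat \<Rightarrow> nat \<Rightarrow> form \<Rightarrow> form" where
  "All_le x j \<phi> = Forall x (Imp (Le (Var x) (Var j)) \<phi>)"

definition Ex_le :: "nat \<Rightarrow> nat \<Rightarrow> form \<Rightarrow> form" where
  "Ex_le x j \<phi> = Neg (All_le x j (Neg \<phi>))"

definition num :: "nat \<Rightarrow> trm" where
  "num n = (Succ ^^ n) Zero"

definition Pr :: "trm \<Rightarrow> trm \<Rightarrow> trm" where
  "Pr s t = Add (Mul (Add s t) (Add s t)) s"

definition Entry :: "trm \<Rightarrow> trm \<Rightarrow> trm \<Rightarrow> trm \<Rightarrow> trm" where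
  "Entry p s q v = Pr p (Pr s (Pr q v))"

definition Digit :: "trm \<Rightarrow> nat \<Rightarrow> trm" where
  "Digit t d = Add (Mul (num 11) t) (num d)"

text \<open>
  Variables 10, 11, 12 hold the bound \<open>w\<close> and the code \<open>a\<close>, \<open>b\<close> of a table, and 27 is local to
  \<open>Mem\<close>.
\<close>

definition Mem :: "trm \<Rightarrow> form" where
  "Mem t = Conj (Le t (Var 10))
     (Ex_le 27 11 (Eq (Mul (Succ (Mul (Succ t) (Var 12))) (Var 27)) (Var 11)))"

definition Clause :: form where
  "Clause = (let p = Var 15; a = Var 16; l = Var 17; b = Var 18; r = Var 19; q = Var 20; v = Var 21;
       p' = Var 22; m = Var 23; c = Var 24; d = Var 25; z = Var 26; s = Pr (Pr a l) (Pr b r) in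
     Or (Conj (Eq p (Digit q 2)) (Eq v Zero))
    (Or (Conj (Eq p (Digit q 3)) (Eq v (Succ Zero)))
    (Or (Conj (Eq p (Digit q 4)) (Eq v b))
    (Or (Conj (Eq p (Digit p' 5)) (Mem (Entry p' (Pr (Pr b (Pr a l)) r) q v)))
    (Or (Conj (Eq p (Digit p' 6)) (Mem (Entry p' (Pr l (Pr a (Pr b r))) q v)))
    (Conj (Mem (Entry p' s m c))
      (Or (Conj (Mem (Entry m s q d))
            (Or (Conj (Eq p (Digit p' 7)) (Eq v (Add c d)))
            (Or (Conj (Eq p (Digit p' 8)) (Eq v (Mul c d)))
            (Conj (Eq p (Digit p' 9))
              (Or (Conj (Le c d) (Eq v (Succ Zero))) (Conj (Neg (Le c d)) (Eq v Zero)))))))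
          (Conj (Eq p (Digit p' 10))
            (Or (Conj (Eq v (Succ Zero))
                  (All_le 26 10 (Imp (Le z c) (Mem (Entry m (Pr (Pr a l) (Pr z r)) q (Succ Zero))))))
                (Conj (Eq v Zero)
                  (Ex_le 26 10 (Conj (Le z c) (Conj (Neg (Eq d (Succ Zero)))
                     (Mem (Entry m (Pr (Pr a l) (Pr z r)) q d)))))))))))))))"

definition Table :: form where
  "Table = All_le 14 10 (Imp (Mem (Var 14))
     (Ex_le 15 10 (Ex_le 16 10 (Ex_le 17 10 (Ex_le 18 10 (Ex_le 19 10 (Ex_le 20 10 (Ex_le 21 10
       (Ex_le 22 10 (Ex_le 23 10 (Ex_le 24 10 (Ex_le 25 10
         (Conj (Eq (Var 14) (Entry (Var 15) (Pr (Pr (Var 16) (Var 17)) (Pr (Var 18) (Var 19)))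
            (Var 20) (Var 21))) Clause)))))))))))))"

definition Refuted :: "nat \<Rightarrow> nat \<Rightarrow> form" where
  "Refuted i j = Ex_le 10 j (Ex_le 11 j (Ex_le 12 j (Ex_le 13 j
     (Conj Table (Mem (Entry (Var i) (Var 13) Zero Zero))))))"

section \<open>Meaning, boundedness and free variables of the refutation formula\<close>

lemma gsat_All_le: "x \<noteq> j \<Longrightarrow> gsat e (All_le x j \<phi>) \<longleftrightarrow> (\<forall>m\<le>e j. gsat (e(x := m)) \<phi>)"
  by (simp add: All_le_def)

lemma gsat_Ex_le: "x \<noteq> j \<Longrightarrow> gsat e (Ex_le x j \<phi>) \<longleftrightarrow> (\<exists>m\<le>e j. gsat (e(x := m)) \<phi>)"
  by (simp add: Ex_le_def gsat_All_le)

lemma tval_num: "tval e (num n) = (of_nat n :: 'a::peano)"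
  unfolding num_def by (induction n) (auto simp: add.commute)

lemma tval_Pr: "tval e (Pr s t) = pr (tval e s) (tval e t)"
  by (simp add: Pr_def pr_def)

lemma tval_Entry: "tval e (Entry p s q v) = entry (tval e p) (tval e s) (tval e q) (tval e v)"
  by (simp add: Entry_def entry_def tval_Pr)

lemma tval_Digit: "tval e (Digit t d) = 11 * tval e t + (of_nat d :: 'a::peano)"
  by (simp add: Digit_def tval_num)

text \<open>Makes membership in a coded set a bounded formula. For m = 0 the cofactor 0 will
  do.\<close>

lemma dvd_iff_bounded: "m dvd n \<longleftrightarrow> (\<exists>k\<le>n. m * k = (n :: 'a::peano))"
proof
  assume "m dvd n"
  then obtain k where k: "n = m * k" by (auto simp: dvd_def)
  show "\<exists>k\<le>n. m * k = n"
  proof (cases "m = 0")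
    case True
    then show ?thesis using k by auto
  next
    case False
    then have "1 * k \<le> m * k" by (intro mult_right_mono) (auto simp: peano_one_le)
    then show ?thesis using k by auto
  qed
qed auto

definition members :: "(nat \<Rightarrow> 'a::peano) \<Rightarrow> 'a set" where
  "members e = {x. x \<le> e 10 \<and> 1 + (x + 1) * e 12 dvd e 11}"

lemma members_upd [simp]: "i \<notin> {10, 11, 12} \<Longrightarrow> members (e(i := m)) = members e"
  by (auto simp: members_def)

lemma gsat_Mem: "27 \<notin> trm_vars t \<Longrightarrow> gsat e (Mem t) \<longleftrightarrow> tval e t \<in> members e"
proof -
  assume "27 \<notin> trm_vars t"
  then have "tval (e(27 := m)) t = tval e t" for m by (intro tval_cong) auto
  then show ?thesis
    by (simp add: Mem_def gsat_Ex_le members_def dvd_iff_bounded[of "1 + _"] add.commute[of _ 1])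
qed

lemma vars_num [simp]: "trm_vars (num n) = {}"
  unfolding num_def by (induction n) auto

lemma vars_Pr [simp]: "trm_vars (Pr s t) = trm_vars s \<union> trm_vars t"
  by (auto simp: Pr_def)

lemma vars_Entry [simp]: "trm_vars (Entry p s q v) = trm_vars p \<union> trm_vars s \<union> trm_vars q \<union> trm_vars v"
  by (auto simp: Entry_def)

lemma vars_Digit [simp]: "trm_vars (Digit t d) = trm_vars t"
  by (auto simp: Digit_def)

lemma gsat_Or: "gsat e (Or \<phi> \<psi>) \<longleftrightarrow> gsat e \<phi> \<or> gsat e \<psi>"
  by auto

lemma gsat_Conj: "gsat e (Conj \<phi> \<psi>) \<longleftrightarrow> gsat e \<phi> \<and> gsat e \<psi>"
  by auto

lemma gsat_Clause:
  "gsat e Clause \<longleftrightarrow> clause (e 10) (members e) (e 15) (e 16) (e 17) (e 18) (e 19) (e 20) (e 21)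
     (e 22) (e 23) (e 24) (e 25)"
  unfolding Clause_def clause_def Let_def gsat_Or gsat_Conj
  by (simp add: gsat_Mem gsat_All_le gsat_Ex_le tval_Entry tval_Pr tval_Digit del: not_le not_less)

lemma gsat_Table: "gsat e Table \<longleftrightarrow> table (e 10) (members e)"
proof -
  have "gsat e Table \<longleftrightarrow> (\<forall>x\<le>e 10. x \<in> members e \<longrightarrow> justified (e 10) (members e) x)"
    unfolding Table_def justified_def
    by (simp add: gsat_Mem gsat_All_le gsat_Ex_le gsat_Clause tval_Entry tval_Pr)
  then show ?thesis unfolding table_def by (auto simp: members_def)
qed

lemma gsat_Refuted:
  assumes "i < 10" "j < 10" shows "gsat e (Refuted i j) \<longleftrightarrow> refuted (e i) (e j)"
proof -
  have "i \<notin> {10, 11, 12, 13, 27}" "j \<notin> {10, 11, 12, 13}" using assms by auto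
  then show ?thesis
    unfolding Refuted_def refuted_def
    by (simp add: gsat_Ex_le gsat_Table gsat_Mem tval_Entry) (simp add: members_def)
qed

lemma delta0_All_le: "x \<noteq> j \<Longrightarrow> delta0 \<phi> \<Longrightarrow> delta0 (All_le x j \<phi>)"
  unfolding All_le_def by (intro delta0.intros) auto

lemma delta0_Ex_le: "x \<noteq> j \<Longrightarrow> delta0 \<phi> \<Longrightarrow> delta0 (Ex_le x j \<phi>)"
  unfolding Ex_le_def by (intro delta0.intros delta0_All_le)

lemma delta0_Mem: "delta0 (Mem t)"
  unfolding Mem_def by (intro delta0.intros delta0_Ex_le) simp

lemma delta0_Refuted: "j < 10 \<Longrightarrow> delta0 (Refuted i j)"
  unfolding Refuted_def Table_def Clause_def Let_def
  by (intro delta0.intros delta0_Ex_le delta0_All_le delta0_Mem) auto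

lemma free_All_le: "free_vars (All_le x j \<phi>) = insert j (free_vars \<phi>) - {x}"
  by (auto simp: All_le_def)

lemma free_Ex_le: "free_vars (Ex_le x j \<phi>) = insert j (free_vars \<phi>) - {x}"
  by (auto simp: Ex_le_def free_All_le)

lemma free_Mem: "free_vars (Mem t) \<subseteq> trm_vars t \<union> {10, 11, 12}"
  by (auto simp: Mem_def free_Ex_le)

lemma free_Clause: "free_vars Clause \<subseteq> {10, 11, 12, 15, 16, 17, 18, 19, 20, 21, 22, 23, 24, 25}"
proof -
  note m = subsetD[OF free_Mem]
  show ?thesis unfolding Clause_def Let_def by (auto simp: free_All_le free_Ex_le dest!: m)
qed

lemma free_Table: "free_vars Table \<subseteq> {10, 11, 12}"
proof -
  note m = subsetD[OF free_Mem] subsetD[OF free_Clause]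
  show ?thesis unfolding Table_def by (auto simp: free_All_le free_Ex_le dest!: m)
qed

lemma free_Refuted: "free_vars (Refuted i j) \<subseteq> {i, j}"
proof -
  note m = subsetD[OF free_Mem] subsetD[OF free_Table]
  show ?thesis unfolding Refuted_def by (auto simp: free_Ex_le dest!: m)
qed

section \<open>Absoluteness of bounded formulas and short numerals\<close>

lemma tval_of_nat: "tval (\<lambda>i. of_nat (e i)) t = (of_nat (tval e t) :: 'a::peano)"
  by (induction t) (auto simp: add.commute)

lemma gsat_absolute:
  "delta0 \<phi> \<Longrightarrow> gsat (\<lambda>i. of_nat (e i) :: 'a::peano) \<phi> \<longleftrightarrow> gsat e \<phi>"
proof (induction arbitrary: e rule: delta0.induct)
  case (5 x t \<phi>)
  have upd: "(\<lambda>i. of_nat (e i))(x := of_nat j) = (\<lambda>i. of_nat ((e(x := j)) i) :: 'a)" for j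
    by auto
  have b: "tval ((\<lambda>i. of_nat (e i))(x := m)) t = (of_nat (tval e t) :: 'a)"
    "tval (e(x := k)) t = tval e t" for m k
    unfolding tval_of_nat[symmetric] by (rule tval_cong, use 5 in auto)+
  have "gsat (\<lambda>i. of_nat (e i) :: 'a) (Forall x (Imp (Le (Var x) t) \<phi>)) \<longleftrightarrow>
      (\<forall>m. m \<le> (of_nat (tval e t) :: 'a) \<longrightarrow> gsat ((\<lambda>i. of_nat (e i))(x := m)) \<phi>)"
    by (simp only: gsat.simps tval.simps b fun_upd_same)
  also have "\<dots> \<longleftrightarrow> (\<forall>j. j \<le> tval e t \<longrightarrow> gsat ((\<lambda>i. of_nat (e i))(x := (of_nat j :: 'a))) \<phi>)"
    by (metis of_nat_le_iff peano_below_of_nat)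
  also have "\<dots> \<longleftrightarrow> gsat e (Forall x (Imp (Le (Var x) t) \<phi>))"
    unfolding upd by (simp only: gsat.simps tval.simps b 5 fun_upd_same)
  finally show ?case .
qed (auto simp: tval_of_nat)

lemma tval_closed:
  assumes "trm_vars t = {}" shows "tval e t = (of_nat (tval (\<lambda>_. 0) t) :: 'a::peano)"
  using tval_cong[of t e "\<lambda>i. of_nat ((\<lambda>_. 0) i)"] tval_of_nat[of "\<lambda>_. 0" t] assms by auto

lemma length_num: "length (trm_string (num n)) = n + 1"
  unfolding num_def by (induction n) auto

text \<open>Unary numerals would be exponentially long. Horner's scheme in base 11 spends at most 29
  further symbols per digit: 12 for 11, at most 11 for the digit, and 6 for the operations.\<close>

lemma short_numeral:
  "(k :: nat) < 11 ^ m \<Longrightarrow> \<exists>t. trm_vars t = {} \<and> tval (\<lambda>_. 0) t = k \<and> length (trm_string t) \<le> 30 * m + 1"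
proof (induction m arbitrary: k)
  case 0
  then have "k = 0" by simp
  then show ?case by (intro exI[of _ Zero]) auto
next
  case (Suc m)
  then have "k div 11 < 11 ^ m" by (simp add: less_mult_imp_div_less mult.commute)
  then obtain t where t: "trm_vars t = {}" "tval (\<lambda>_. 0) t = k div 11" "length (trm_string t) \<le> 30 * m + 1"
    using Suc.IH by blast
  have "k mod 11 < 11" by simp
  then have "length (trm_string (Digit t (k mod 11))) \<le> 30 * Suc m + 1"
    using t(3) by (simp add: Digit_def length_num)
  then show ?case using t by (intro exI[of _ "Digit t (k mod 11)"]) (simp add: tval_Digit)
qed

subsection \<open>The reflecting sentence\<close>

text \<open>Here \<open>C\<close> denotes a code that is refuted no earlier than any refuted code up to \<open>B\<close>.\<close>

definition reflect :: "trm \<Rightarrow> trm \<Rightarrow> form" where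
  "reflect B C = Forall 3 (Forall 2 (Forall 1 (Forall 0
     (Imp (Le (Var 0) B) (Imp (Eq (Var 3) C)
       (Imp (Refuted 3 1) (Imp (Refuted 0 2) (Refuted 0 1))))))))"

lemma gsat_reflect:
  assumes "trm_vars B = {}" "trm_vars C = {}"
  shows "gsat (e :: nat \<Rightarrow> 'a::peano) (reflect B C) \<longleftrightarrow>
    (\<forall>y z. \<forall>c\<le>of_nat (tval (\<lambda>_. 0) B) :: 'a.
       refuted (of_nat (tval (\<lambda>_. 0) C)) y \<longrightarrow> refuted c z \<longrightarrow> refuted c y)"
proof -
  have "tval e B = (of_nat (tval (\<lambda>_. 0) B) :: 'a)" "tval e C = (of_nat (tval (\<lambda>_. 0) C) :: 'a)" for e
    using assms by (auto intro: tval_closed)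
  then show ?thesis unfolding reflect_def by (simp add: gsat_Refuted) blast
qed

text \<open>That a code is refuted at all is an existential statement, but it stands in an
  antecedent, so its quantifier becomes the outer universal one over variable 2.\<close>

lemma pi1_reflect: "pi1 (reflect B C)"
  unfolding reflect_def by (intro pi1.intros delta0.intros delta0_Refuted) auto

lemma free_reflect: "trm_vars B = {} \<Longrightarrow> trm_vars C = {} \<Longrightarrow> free_vars (reflect B C) = {}"
  unfolding reflect_def using free_Refuted[of 3 1] free_Refuted[of 0 2] free_Refuted[of 0 1] by auto

text \<open>\<open>C\<close> enters through an equation with variable 3 instead of a substitution
  into \<open>Refuted\<close>, so each of the two numerals occurs once and all else has constant
  length.\<close>

lemma length_reflect:
  "form_length (reflect B C) = form_length (Refuted 3 1) + form_length (Refuted 0 2) +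
     form_length (Refuted 0 1) + length (trm_string B) + length (trm_string C) + 33"
  by (simp add: reflect_def form_length_def var_string_def eval_nat_numeral)

subsection \<open>A model for an unprovable sentence\<close>

text \<open>
  A type cannot be introduced inside a proof, so the sentence to be refuted is fixed beforehand: it
  is an unprovable one among those that have to be shown provable, if there is one at all.
\<close>

definition obligations :: "form set" where
  "obligations = {Imp (reflect B C) \<psi> | B C \<psi>.
     trm_vars B = {} \<and> trm_vars C = {} \<and> (\<exists>y::nat. refuted (tval (\<lambda>_. 0) C) y) \<and>
     true_pi1_sentence \<psi> \<and> code (compile (matrix \<psi>)) 0 \<le> tval (\<lambda>_. 0) B}"

definition goal :: form where
  "goal = (if \<exists>\<chi>\<in>obligations. \<not> PA \<turnstile> \<chi> then SOME \<chi>. \<chi> \<in> obligations \<and> \<not> PA \<turnstile> \<chi>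
     else Eq (Succ Zero) Zero)"

lemma goal_in_obligations:
  "\<chi> \<in> obligations \<Longrightarrow> \<not> PA \<turnstile> \<chi> \<Longrightarrow> goal \<in> obligations \<and> \<not> PA \<turnstile> goal"
  using someI[of "\<lambda>\<chi>. \<chi> \<in> obligations \<and> \<not> PA \<turnstile> \<chi>" \<chi>] by (auto simp: goal_def)

lemma obligations_closed: "\<chi> \<in> obligations \<Longrightarrow> free_vars \<chi> = {}"
  by (auto simp: obligations_def free_reflect true_pi1_sentence_def sentence_def)

text \<open>A Henkin model can be built only against an unprovable sentence. If all obligations are
  provable, the default 1 = 0 keeps the construction unconditional.\<close>

lemma goal: "free_vars goal = {}" "\<not> PA \<turnstile> goal"
proof -
  have *: "goal \<in> obligations \<and> \<not> PA \<turnstile> goal \<or> goal = Eq (Succ Zero) Zero"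
    by (cases "\<exists>\<chi>\<in>obligations. \<not> PA \<turnstile> \<chi>") (use goal_in_obligations in blast, simp add: goal_def)
  then show "free_vars goal = {}"
  proof
    assume eq: "goal = Eq (Succ Zero) Zero"
    show ?thesis unfolding eq by simp
  qed (use obligations_closed in blast)
  show "\<not> PA \<turnstile> goal" using * soundness[of "Eq (Succ Zero) Zero"] by auto
qed

text \<open>Henkin variables are odd, which leaves the even ones to induction formulas; they exceed
  2, so the other axioms can be used as they stand; and they exceed the bound variables of
  \<open>goal\<close>.\<close>

definition hvar :: "nat \<Rightarrow> nat" where
  "hvar y = 2 * (Max (insert 2 (bound_vars goal)) + y) + 1"

lemma hvar_range: "x \<in> range hvar \<Longrightarrow> odd x \<and> Max (insert 2 (bound_vars goal)) < x"
  by (auto simp: hvar_def)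

lemma not_hvar: "even x \<Longrightarrow> x \<notin> range hvar" "x \<le> 2 \<Longrightarrow> x \<notin> range hvar"
proof -
  have "2 \<le> Max (insert 2 (bound_vars goal))" by (simp add: finite_bound_vars)
  then show "even x \<Longrightarrow> x \<notin> range hvar" "x \<le> 2 \<Longrightarrow> x \<notin> range hvar"
    using hvar_range by fastforce+
qed

interpretation hk: henkin PA goal hvar
proof
  show "inj hvar" by (auto simp: inj_def hvar_def)
  show "range hvar \<noteq> UNIV" using not_hvar(1)[of 0] by auto
  show "bound_vars goal \<inter> range hvar = {}"
  proof -
    have "x \<le> Max (insert 2 (bound_vars goal))" if "x \<in> bound_vars goal" for x
      using that by (intro Max_ge) (auto simp: finite_bound_vars)
    then show ?thesis using hvar_range by fastforce
  qed
qed (fact goal)+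

quotient_type model = nat / "\<lambda>y z. Eq (Var (hvar y)) (Var (hvar z)) \<in> hk.Delta"
proof (rule equivpI)
  show "reflp (\<lambda>y z. Eq (Var (hvar y)) (Var (hvar z)) \<in> hk.Delta)"
    by (rule reflpI) (simp add: hk.eq_refl)
  show "symp (\<lambda>y z. Eq (Var (hvar y)) (Var (hvar z)) \<in> hk.Delta)"
    by (rule sympI) (rule hk.eq_sym)
  show "transp (\<lambda>y z. Eq (Var (hvar y)) (Var (hvar z)) \<in> hk.Delta)"
    by (rule transpI) (rule hk.eq_trans)
qed

lemma abs_model_eq: "abs_model y = abs_model z \<longleftrightarrow> Eq (Var (hvar y)) (Var (hvar z)) \<in> hk.Delta"
  by (rule model.abs_eq_iff)

lemma abs_rep_model: "abs_model (rep_model x) = x"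
  by (rule Quotient3_abs_rep[OF Quotient3_model])

lemma rep_abs_model: "Eq (Var (hvar (rep_model (abs_model y)))) (Var (hvar y)) \<in> hk.Delta"
  using abs_rep_model[of "abs_model y"] by (simp add: abs_model_eq)

instance model :: countable
  by (intro countable_classI[of rep_model]) (metis abs_rep_model)

instantiation model :: "{zero,one,plus,minus,times,ord}"
begin

definition "0 = abs_model (hk.name Zero)"
definition "1 = abs_model (hk.name (Succ Zero))"
definition "x + y = abs_model (hk.name (Add (Var (hvar (rep_model x))) (Var (hvar (rep_model y)))))"
definition "x * y = abs_model (hk.name (Mul (Var (hvar (rep_model x))) (Var (hvar (rep_model y)))))"
definition "x \<le> y \<longleftrightarrow> Le (Var (hvar (rep_model x))) (Var (hvar (rep_model y))) \<in> hk.Delta"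
definition "x < y \<longleftrightarrow> x \<le> y \<and> \<not> y \<le> (x :: model)"
text \<open>Truncated subtraction is part of \<open>linordered_semidom\<close>; it is 0 unless
  \<open>y \<le> x\<close>.\<close>

definition "x - y = (if y \<le> x then THE z :: model. z + y = x else 0)"

instance ..
end

instance model :: arith ..

lemma abs_name_eq:
  "hk.closed s \<Longrightarrow> hk.closed t \<Longrightarrow> abs_model (hk.name s) = abs_model (hk.name t) \<longleftrightarrow> Eq s t \<in> hk.Delta"
  unfolding abs_model_eq using hk.name hk.eq_sym hk.eq_trans by meson

text \<open>Reconciles successor with the addition of 1 by which the class interprets it.\<close>

lemma Delta_add_one: "Eq (Add (Var (hvar y)) (Succ Zero)) (Succ (Var (hvar y))) \<in> hk.Delta"
proof -
  let ?S = "Eq (Add (Var 0) (Succ (Var 1))) (Succ (Add (Var 0) (Var 1)))"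
  have "PA \<turnstile> Imp (Forall 1 ?S) (subst 1 Zero ?S)"
    by (rule proves.inst) simp
  then have "PA \<turnstile> subst 1 Zero ?S"
    using proves.mp proves.gen proves.axiom PA.add_succ by blast
  then have "PA \<turnstile> Forall 0 (subst 1 Zero ?S)" by (rule proves.gen)
  then have 1: "Forall 0 (subst 1 Zero ?S) \<in> hk.Delta"
    by (intro hk.Delta_theorem) (auto simp: hk.good_def not_hvar)
  have "PA \<turnstile> Forall 0 (Eq (Add (Var 0) Zero) (Var 0))"
    by (intro proves.gen proves.axiom PA.add_zero)
  then have 2: "Forall 0 (Eq (Add (Var 0) Zero) (Var 0)) \<in> hk.Delta"
    by (intro hk.Delta_theorem) (auto simp: hk.good_def not_hvar)
  have "Eq (Add (Var (hvar y)) (Succ Zero)) (Succ (Add (Var (hvar y)) Zero)) \<in> hk.Delta"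
    using 1 hk.Delta_Forall[OF hk.good_Delta[OF 1]] by simp
  moreover have "Eq (Add (Var (hvar y)) Zero) (Var (hvar y)) \<in> hk.Delta"
    using 2 hk.Delta_Forall[OF hk.good_Delta[OF 2]] by simp
  ultimately show ?thesis using hk.eq_trans hk.eq_cong_Succ by blast
qed

interpretation hm: henkin_model PA goal hvar abs_model
proof
  fix y z
  show "(abs_model y = abs_model z) = (Eq (Var (hvar y)) (Var (hvar z)) \<in> hk.Delta)"
    by (rule abs_model_eq)
  show "surj abs_model" by (metis abs_rep_model surj_def)
  show "0 = abs_model (hk.name Zero)" by (rule zero_model_def)
  show add: "abs_model y + abs_model z = abs_model (hk.name (Add (Var (hvar y)) (Var (hvar z))))" for y z
    unfolding plus_model_def by (subst abs_name_eq) (auto intro: hk.eq_cong_Add rep_abs_model)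
  show "abs_model y * abs_model z = abs_model (hk.name (Mul (Var (hvar y)) (Var (hvar z))))"
    unfolding times_model_def by (subst abs_name_eq) (auto intro: hk.eq_cong_Mul rep_abs_model)
  show "abs_model y \<le> abs_model z \<longleftrightarrow> Le (Var (hvar y)) (Var (hvar z)) \<in> hk.Delta"
    unfolding less_eq_model_def using rep_abs_model hk.eq_sym hk.eq_cong_Le by blast
  have "abs_model y + 1 = abs_model (hk.name (Add (Var (hvar y)) (Var (hvar (hk.name (Succ Zero))))))"
    unfolding one_model_def add by simp
  also have "\<dots> = abs_model (hk.name (Succ (Var (hvar y))))"
  proof (subst abs_name_eq)
    have "Eq (Add (Var (hvar y)) (Var (hvar (hk.name (Succ Zero))))) (Add (Var (hvar y)) (Succ Zero)) \<in> hk.Delta"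
      by (intro hk.eq_cong_Add hk.eq_refl hk.name) auto
    then show "Eq (Add (Var (hvar y)) (Var (hvar (hk.name (Succ Zero))))) (Succ (Var (hvar y))) \<in> hk.Delta"
      using Delta_add_one hk.eq_trans by blast
  qed auto
  finally show "abs_model y + 1 = abs_model (hk.name (Succ (Var (hvar y))))" .
qed

section \<open>The axioms of PA and the ordered semiring laws in the model\<close>

lemma model_axiom:
  assumes "\<phi> \<in> PA" "bound_vars \<phi> \<subseteq> {..2}" "free_vars \<phi> \<subseteq> {..2}" shows "gsat (e :: nat \<Rightarrow> model) \<phi>"
  by (rule hm.gsat_theorem[OF proves.axiom[OF assms(1)]]) (use assms not_hvar(2) in auto)

lemma model_succ_nonzero: "x + 1 \<noteq> (0 :: model)"
  using model_axiom[OF PA.succ_nonzero, of "\<lambda>_. x"] by simp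

lemma model_succ_inj: "x + 1 = y + 1 \<Longrightarrow> x = (y :: model)"
  using model_axiom[OF PA.succ_inj, of "\<lambda>i. if i = 0 then x else y"] by simp

lemma model_add_zero: "x + 0 = (x :: model)"
  using model_axiom[OF PA.add_zero, of "\<lambda>_. x"] by simp

lemma model_add_succ: "x + (y + 1) = (x + y) + (1 :: model)"
  using model_axiom[OF PA.add_succ, of "\<lambda>i. if i = 0 then x else y"] by simp

lemma model_mul_zero: "x * 0 = (0 :: model)"
  using model_axiom[OF PA.mul_zero, of "\<lambda>_. x"] by simp

lemma model_mul_succ: "x * (y + 1) = x * y + (x :: model)"
  using model_axiom[OF PA.mul_succ, of "\<lambda>i. if i = 0 then x else y"] by simp

lemma model_le_iff: "x \<le> y \<longleftrightarrow> (\<exists>z. z + x = (y :: model))"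
proof -
  let ?e = "\<lambda>i. if i = 0 then x else y"
  have "gsat ?e (Iff (Le (Var 0) (Var 1)) (Exists 2 (Eq (Add (Var 2) (Var 0)) (Var 1))))"
    by (rule model_axiom[OF PA.le_def]) auto
  then show ?thesis by auto
qed

text \<open>The formula may use Henkin variables, so all its variables are doubled before the
  induction axiom is applied. Doubling fixes the induction variable 0, and \<open>e'\<close> undoes
  it on the side of the environment.\<close>

lemma model_gsat_induct:
  fixes e :: "nat \<Rightarrow> model"
  assumes "gsat (e(0 := 0)) \<phi>" "\<And>m. gsat (e(0 := m)) \<phi> \<Longrightarrow> gsat (e(0 := m + 1)) \<phi>"
  shows "gsat (e(0 := m)) \<phi>"
proof -
  define \<phi>' where "\<phi>' = rename (\<lambda>i. 2 * i) \<phi>"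
  define e' where "e' i = e (i div 2)" for i
  have inj: "inj (\<lambda>i::nat. 2 * i)" by (auto simp: inj_def)
  have *: "gsat (e'(0 := m)) \<phi>' = gsat (e(0 := m)) \<phi>" for m
  proof -
    have "e'(0 := m) \<circ> (\<lambda>i. 2 * i) = e(0 := m)" by (auto simp: e'_def fun_eq_iff)
    then show ?thesis unfolding \<phi>'_def gsat_rename[OF inj] by simp
  qed
  have f: "free_vars \<phi>' \<subseteq> range (\<lambda>i. 2 * i)" "bound_vars \<phi>' \<subseteq> range (\<lambda>i. 2 * i)"
    unfolding \<phi>'_def using free_vars_rename by (auto simp: bound_vars_rename)
  have s: "free_vars (subst 0 t \<phi>') \<subseteq> (free_vars \<phi>' - {0}) \<union> trm_vars t" for t
    by (rule free_vars_subst)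
  have "gsat e' (Imp (subst 0 Zero \<phi>')
    (Imp (Forall 0 (Imp \<phi>' (subst 0 (Succ (Var 0)) \<phi>'))) (Forall 0 \<phi>')))"
  proof (rule hm.gsat_theorem[OF proves.axiom[OF PA.induction]])
    let ?I = "Imp (subst 0 Zero \<phi>') (Imp (Forall 0 (Imp \<phi>' (subst 0 (Succ (Var 0)) \<phi>'))) (Forall 0 \<phi>'))"
    have "x \<notin> range hvar" if "x \<in> range (\<lambda>i. 2 * i)" for x
      by (rule not_hvar(1)) (use that in auto)
    moreover have "bound_vars ?I \<subseteq> range (\<lambda>i. 2 * i)" using f(2) by auto
    moreover have "free_vars ?I \<subseteq> range (\<lambda>i. 2 * i)" using f(1) s[of Zero] s[of "Succ (Var 0)"] by auto
    ultimately show "bound_vars ?I \<inter> range hvar = {}" "free_vars ?I \<inter> range hvar = {}" by blast+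
  qed
  then show ?thesis
    using assms unfolding gsat.simps gsat_subst_Zero gsat_subst_Succ fun_upd_same fun_upd_upd * by blast
qed

lemma model_induct [case_names definable zero succ]:
  "definable (\<lambda>e :: nat \<Rightarrow> model. P (e 0)) \<Longrightarrow> P 0 \<Longrightarrow> (\<And>m. P m \<Longrightarrow> P (m + 1)) \<Longrightarrow> P m"
  using definable_induct_general[OF model_gsat_induct] by blast

lemma model_zero_add: "0 + x = (x :: model)"
  by (induction x rule: model_induct)
    (auto intro!: definable_intros simp: model_add_zero model_add_succ)

lemma model_succ_add: "(x + 1) + y = (x + y) + (1 :: model)"
  by (induction y rule: model_induct)
    (auto intro!: definable_intros simp: model_add_zero model_add_succ)

lemma model_add_commute: "x + y = y + (x :: model)"
  by (induction y rule: model_induct)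
    (auto intro!: definable_intros simp: model_add_zero model_zero_add model_add_succ model_succ_add)

lemma model_add_assoc: "(x + y) + z = x + (y + (z :: model))"
  by (induction z rule: model_induct)
    (auto intro!: definable_intros simp: model_add_zero model_add_succ)

lemma model_add_left_commute: "x + (y + z) = y + (x + (z :: model))"
  by (metis model_add_assoc model_add_commute)

lemmas model_add_ac = model_add_assoc model_add_commute model_add_left_commute

lemma model_zero_mul: "0 * x = (0 :: model)"
  by (induction x rule: model_induct)
    (auto intro!: definable_intros simp: model_mul_zero model_mul_succ model_add_zero)

lemma model_succ_mul: "(x + 1) * y = x * y + (y :: model)"
proof (induction y rule: model_induct)
  case (succ y)
  then show ?case by (simp add: model_mul_succ) (metis model_add_assoc model_add_commute)
qed (auto intro!: definable_intros simp: model_mul_zero model_add_zero)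

lemma model_mul_commute: "x * y = y * (x :: model)"
  by (induction y rule: model_induct)
    (auto intro!: definable_intros simp: model_mul_zero model_zero_mul model_mul_succ model_succ_mul)

lemma model_distrib: "(x + y) * z = x * z + y * (z :: model)"
proof (induction z rule: model_induct)
  case (succ z)
  show ?case unfolding model_mul_succ succ by (simp only: model_add_ac)
qed (auto intro!: definable_intros simp: model_mul_zero model_add_zero)

lemma model_mul_assoc: "(x * y) * z = x * (y * (z :: model))"
proof (induction z rule: model_induct)
  case (succ z)
  then show ?case by (simp add: model_mul_succ) (metis model_distrib model_mul_commute)
qed (auto intro!: definable_intros simp: model_mul_zero)

lemma model_add_cancel: "x + z = y + z \<longleftrightarrow> x = (y :: model)"
proof
  show "x + z = y + z \<Longrightarrow> x = y"
    by (induction z rule: model_induct)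
      (auto intro!: definable_intros dest!: model_succ_inj simp: model_add_zero model_add_succ)
qed simp

lemma model_cases: obtains "x = (0 :: model)" | y where "x = y + 1"
proof -
  have "x = 0 \<or> (\<exists>y. x = y + 1)"
    by (induction x rule: model_induct) (auto intro!: definable_intros)
  then show thesis using that by blast
qed

lemma model_add_eq_0: "x + y = 0 \<longleftrightarrow> x = 0 \<and> y = (0 :: model)"
  by (cases y rule: model_cases) (auto simp: model_add_zero model_zero_add model_add_succ model_succ_nonzero)

lemma model_linear: "x \<le> y \<or> y \<le> (x :: model)"
proof (induction y rule: model_induct)
  case definable
  show ?case by (intro definable_intros)
next
  case zero
  then show ?case using model_le_iff model_add_zero by blast
next
  case (succ y)
  then show ?case
  proof
    assume "x \<le> y"
    then show ?thesis unfolding model_le_iff by (metis model_succ_add)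
  next
    assume "y \<le> x"
    then obtain z where z: "z + y = x" unfolding model_le_iff by blast
    show ?thesis
    proof (cases z rule: model_cases)
      case 1
      then have "1 + x = y + 1" using z by (simp add: model_zero_add model_add_commute)
      then show ?thesis unfolding model_le_iff by blast
    next
      case (2 w)
      then have "w + (y + 1) = x" using z by (simp add: model_add_succ model_succ_add)
      then show ?thesis unfolding model_le_iff by blast
    qed
  qed
qed

lemma model_diff: "y \<le> x \<Longrightarrow> x - y + y = (x :: model)"
proof -
  assume "y \<le> x"
  then obtain z where z: "z + y = x" unfolding model_le_iff by blast
  then have "(THE z. z + y = x) = z" using model_add_cancel by (intro the_equality) auto
  then show ?thesis using z \<open>y \<le> x\<close> by (simp add: minus_model_def)
qed

lemma model_le_antisym: "x \<le> y \<Longrightarrow> y \<le> x \<Longrightarrow> x = (y :: model)"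
proof -
  assume "x \<le> y" "y \<le> x"
  then obtain z w where z: "z + x = y" "w + y = x" unfolding model_le_iff by blast
  then have "(w + z) + x = 0 + x" by (simp add: model_add_assoc model_zero_add)
  then have "z = 0" by (simp add: model_add_cancel model_add_eq_0)
  then show ?thesis using z by (simp add: model_zero_add)
qed

lemma model_le_trans: "x \<le> y \<Longrightarrow> y \<le> z \<Longrightarrow> x \<le> (z :: model)"
  unfolding model_le_iff by (metis model_add_assoc)

lemma model_le_refl: "x \<le> (x :: model)"
  unfolding model_le_iff using model_zero_add by blast

lemma model_le_add: "y \<le> x + (y :: model)"
  unfolding model_le_iff by blast

lemma model_diff_eqI: "z + y = x \<Longrightarrow> x - y = (z :: model)"
  using model_diff[of y x] model_le_add[of y z] model_add_cancel by metis

lemma model_diff_zero: "\<not> y \<le> x \<Longrightarrow> x - y = (0 :: model)"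
  by (simp add: minus_model_def)

lemma model_mul_mono: "x \<le> y \<Longrightarrow> z * x \<le> z * (y :: model)"
  unfolding model_le_iff by (metis model_distrib model_mul_commute)

lemma model_mul_eq_0: "x * y = 0 \<Longrightarrow> x = 0 \<or> y = (0 :: model)"
  by (cases x rule: model_cases; cases y rule: model_cases)
    (auto simp: model_mul_succ model_succ_mul model_add_succ model_succ_nonzero)

instance model :: linordered_semidom
proof
  fix a b c :: model
  show "a + b + c = a + (b + c)" by (rule model_add_assoc)
  show "a + b = b + a" by (rule model_add_commute)
  show "0 + a = a" by (rule model_zero_add)
  show "a * b * c = a * (b * c)" by (rule model_mul_assoc)
  show "a * b = b * a" by (rule model_mul_commute)
  have one: "1 = 0 + (1 :: model)" by (simp add: model_zero_add)
  show "1 * a = a" by (subst one, subst model_succ_mul) (simp add: model_zero_mul model_zero_add)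
  show "(a + b) * c = a * c + b * c" by (rule model_distrib)
  show "a * (b + c) = a * b + a * c" by (metis model_distrib model_mul_commute)
  show "0 * a = 0" by (rule model_zero_mul)
  show "a * 0 = 0" by (rule model_mul_zero)
  show "(0::model) \<noteq> 1" using model_succ_nonzero[of 0] one by auto
  show "a + b - a = b" by (rule model_diff_eqI) (rule model_add_commute)
  show "a - b - c = a - (b + c)"
  proof (cases "b + c \<le> a")
    case True
    then obtain z where z: "z + (b + c) = a" unfolding model_le_iff by blast
    have "a - b = z + c" by (rule model_diff_eqI) (use z in \<open>simp add: model_add_ac\<close>)
    moreover have "z + c - c = z" "a - (b + c) = z" using z by (auto intro: model_diff_eqI)
    ultimately show ?thesis by simp
  next
    case False
    have "a - b - c = 0"
    proof (cases "c \<le> a - b")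
      case c: True
      then obtain z where z: "z + c = a - b" unfolding model_le_iff by blast
      show ?thesis
      proof (cases "b \<le> a")
        case True
        then have "z + c + b = a" using z model_diff by simp
        then have "z + (b + c) = a" by (simp add: model_add_ac)
        then show ?thesis using False model_le_add by blast
      next
        case False
        then show ?thesis using z by (auto simp: model_diff_zero model_add_eq_0 intro: model_diff_eqI model_add_zero)
      qed
    qed (simp add: model_diff_zero)
    then show ?thesis using False by (simp add: model_diff_zero)
  qed
  show "a * (b - c) = a * b - a * c"
  proof (cases "c \<le> b")
    case True
    then show ?thesis
      using model_diff[OF True] model_distrib[of "b - c" c a] model_diff_eqI[of "a * (b - c)" "a * c" "a * b"]
      by (simp add: model_mul_commute)
  next
    case False
    then obtain z where z: "z + b = c" using model_linear[of b c] unfolding model_le_iff by blast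
    have "a * c = a * z + a * b" unfolding z[symmetric] by (metis model_distrib model_mul_commute)
    then have "a * b - a * c = 0"
    proof (cases "a * c \<le> a * b")
      case True
      then have "a * c = a * b" using model_le_antisym model_le_add \<open>a * c = a * z + a * b\<close> by metis
      then show ?thesis using model_diff_eqI model_zero_add by metis
    qed (simp add: model_diff_zero)
    then show ?thesis using False by (simp add: model_diff_zero model_mul_zero)
  qed
  show "a * b \<noteq> 0" if "a \<noteq> 0" "b \<noteq> 0" using that model_mul_eq_0 by blast
  show "(a < b) = (a \<le> b \<and> \<not> b \<le> a)" by (rule less_model_def)
  show "a \<le> a" by (rule model_le_refl)
  show "a \<le> b \<Longrightarrow> b \<le> c \<Longrightarrow> a \<le> c" by (rule model_le_trans)
  show "a \<le> b \<Longrightarrow> b \<le> a \<Longrightarrow> a = b" by (rule model_le_antisym)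
  show "a \<le> b \<or> b \<le> a" by (rule model_linear)
  show "a \<le> b \<Longrightarrow> c + a \<le> c + b" unfolding model_le_iff by (metis model_add_left_commute)
  show "c * a < c * b" if ab: "a < b" and c: "0 < c"
  proof -
    have "\<not> c * b \<le> c * a"
    proof
      assume *: "c * b \<le> c * a"
      obtain z where z: "z + a = b" using ab less_model_def[of a b] model_le_iff[of a b] by blast
      have "c * b = c * z + c * a" unfolding z[symmetric] by (metis model_distrib model_mul_commute)
      moreover have "c * b = c * a" using * ab model_mul_mono model_le_antisym less_model_def by blast
      ultimately have "c * z + c * a = 0 + c * a" by (simp add: model_zero_add)
      then have "c * z = 0" unfolding model_add_cancel .
      moreover have "c \<noteq> 0" using c by (auto simp: less_model_def)
      ultimately have "z = 0" using model_mul_eq_0[of c z] by blast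
      with z have "b = a" by (simp add: model_zero_add)
      with ab show False by (simp add: less_model_def)
    qed
    then show ?thesis using ab model_mul_mono less_model_def by blast
  qed
  show "(0::model) < 1"
    unfolding less_model_def model_le_iff
    using model_add_zero model_add_eq_0 \<open>(0::model) \<noteq> 1\<close> by metis
  show "b \<le> a \<Longrightarrow> a - b + b = a" by (rule model_diff)
qed

instance model :: peano
proof
  show "x \<le> y \<Longrightarrow> \<exists>z. y = x + z" for x y :: model
    unfolding model_le_iff by (metis add.commute)
qed (fact model_gsat_induct)

lemma obligations_provable:
  assumes "\<chi> \<in> obligations" shows "PA \<turnstile> \<chi>"
proof (rule ccontr)
  assume "\<not> PA \<turnstile> \<chi>"
  then have "goal \<in> obligations" using goal_in_obligations assms by blast
  then obtain B C \<psi> and y :: nat where g: "goal = Imp (reflect B C) \<psi>" "trm_vars B = {}" "trm_vars C = {}"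
    and y: "refuted (tval (\<lambda>_. 0) C) y"
    and \<psi>: "true_pi1_sentence \<psi>" "code (compile (matrix \<psi>)) 0 \<le> tval (\<lambda>_. 0) B"
    unfolding obligations_def by blast
  define c where "c = code (compile (matrix \<psi>)) 0"
  have pi1: "pi1 \<psi>" using \<psi>(1) by (simp add: true_pi1_sentence_def)
  have "\<not> gsat e goal" for e :: "nat \<Rightarrow> model" by (rule hm.gsat_goal)
  then have r: "gsat (\<lambda>_. 0 :: model) (reflect B C)" and f: "\<not> gsat (\<lambda>_. 0 :: model) \<psi>"
    unfolding g by auto
  \<comment> \<open>Used in both directions: the refutation of the value of \<open>C\<close> passes
    into the model, and the refutation of \<open>c\<close> comes back out of it.\<close>
  have abs: "refuted (of_nat i :: model) (of_nat j) \<longleftrightarrow> refuted i j" for i j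
    using gsat_absolute[OF delta0_Refuted[of 1 0], of "\<lambda>k. if k = 0 then i else j", where 'a = model]
    by (simp add: gsat_Refuted)
  obtain z where z: "refuted (of_nat c :: model) z"
    using refuted_matrix[OF pi1, where 'a = model] f unfolding c_def by blast
  have "(of_nat c :: model) \<le> of_nat (tval (\<lambda>_. 0) B)" using \<psi>(2) by (simp add: c_def)
  \<comment> \<open>The refutation below \<open>z\<close> may be nonstandard; the reflecting
    sentence gives one below the standard \<open>y\<close>.\<close>
  then have "refuted (of_nat c :: model) (of_nat y)"
    using r[unfolded gsat_reflect[OF g(2,3)]] abs y z by blast
  then have "refuted c y" by (simp add: abs)
  then have "\<exists>e :: nat \<Rightarrow> nat. \<not> gsat e \<psi>" using refuted_matrix[OF pi1, where 'a = nat] unfolding c_def by auto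
  then show False using \<psi>(1) by (simp add: true_pi1_sentence_def true_form_def gsat_nat)
qed

lemma latest_refuted:
  assumes "2 \<le> N"
  obtains c :: nat where "c \<le> N" "\<exists>y. refuted c y"
    "\<And>d y z. d \<le> N \<Longrightarrow> refuted c y \<Longrightarrow> refuted d z \<Longrightarrow> refuted d y"
proof -
  define F :: "nat set" where "F = {c. c \<le> N \<and> (\<exists>y. refuted c y)}"
  define first :: "nat \<Rightarrow> nat" where "first c = (LEAST y. refuted c y)" for c
  \<comment> \<open>The expression \<open>Nul\<close> with code 2 is false on every tape, so some
    code up to \<open>N\<close> is refuted and the maximum below exists.\<close>
  have "\<exists>y::nat. refuted (of_nat (code Nul 0)) y"
    by (rule refuted_complete[of "pr 0 0"]) (auto intro: tapeI stream.zero)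
  then have "2 \<in> F" using assms by (simp add: F_def code.simps numeral_2_eq_2)
  moreover have "finite F" by (simp add: F_def)
  ultimately have "Max (first ` F) \<in> first ` F" by (intro Max_in) auto
  then obtain c where c: "c \<in> F" "first c = Max (first ` F)" by auto
  have latest: "refuted d y" if "d \<le> N" "refuted c y" "refuted d z" for d y z
  proof -
    have "refuted d (first d)" unfolding first_def using that(3) by (rule LeastI)
    moreover have "first c \<le> y" unfolding first_def using that(2) by (rule Least_le)
    moreover have "first d \<le> first c"
      unfolding c(2) by (rule Max_ge) (use that \<open>finite F\<close> in \<open>auto simp: F_def\<close>)
    ultimately show ?thesis using refuted_mono order_trans by blast
  qed
  have "c \<le> N" "\<exists>y. refuted c y" using c(1) unfolding F_def by auto
  from that[OF this latest] show thesis .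
qed

theorem theorem8:
  "\<exists>K::nat. \<forall>n::nat. n \<ge> 1 \<longrightarrow>
     (\<exists>\<phi>. true_pi1_sentence \<phi> \<and> form_length \<phi> \<le> K * n \<and>
       (\<forall>\<psi>. true_pi1_sentence \<psi> \<and> form_length \<psi> \<le> n \<longrightarrow> PA \<turnstile> Imp \<phi> \<psi>))"
proof -
  define k where "k = form_length (Refuted 3 1) + form_length (Refuted 0 2) + form_length (Refuted 0 1)"
  have "\<exists>\<phi>. true_pi1_sentence \<phi> \<and> form_length \<phi> \<le> (k + 600) * n \<and>
       (\<forall>\<psi>. true_pi1_sentence \<psi> \<and> form_length \<psi> \<le> n \<longrightarrow> PA \<turnstile> Imp \<phi> \<psi>)"
    if n: "n \<ge> 1" for n
  proof -
    define N :: nat where "N = 11 ^ (7 * n)"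
    have "(11::nat) ^ 1 \<le> N" unfolding N_def by (rule power_increasing) (use n in auto)
    then have "2 \<le> N" by simp
    then obtain c where c: "c \<le> N" "\<exists>y. refuted c y"
      "\<And>d y z. d \<le> N \<Longrightarrow> refuted c y \<Longrightarrow> refuted d z \<Longrightarrow> refuted d y"
      using latest_refuted by blast
    \<comment> \<open>\<open>N\<close> itself has 7 * n + 1 digits in base 11, and \<open>c\<close>
      has no more.\<close>
    have less: "N < 11 ^ (7 * n + 1)" by (simp add: N_def)
    obtain B where B: "trm_vars B = {}" "tval (\<lambda>_. 0) B = N" "length (trm_string B) \<le> 30 * (7 * n + 1) + 1"
      using short_numeral[OF less] by blast
    obtain C where C: "trm_vars C = {}" "tval (\<lambda>_. 0) C = c" "length (trm_string C) \<le> 30 * (7 * n + 1) + 1"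
      using short_numeral[OF le_less_trans[OF c(1) less]] by blast
    have "gsat e (reflect B C)" for e :: "nat \<Rightarrow> nat"
      unfolding gsat_reflect[OF B(1) C(1)] B(2) C(2) using c(3) by auto
    then have true: "true_pi1_sentence (reflect B C)"
      by (simp add: true_pi1_sentence_def pi1_reflect sentence_def free_reflect B C true_form_def gsat_nat)
    \<comment> \<open>Each numeral has at most 210 * n + 31 symbols, and 33 come from
      \<open>length_reflect\<close>. As n is at least 1, the constants are absorbed into the factor
      of n; 600 is 420 + 95 rounded up.\<close>
    have "form_length (reflect B C) \<le> k + 420 * n + 95"
      using B(3) C(3) by (simp add: length_reflect k_def)
    also have "\<dots> \<le> k * n + 420 * n + 95 * n" using n by (intro add_mono) auto
    also have "\<dots> \<le> (k + 600) * n" by (simp add: algebra_simps)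
    finally have "form_length (reflect B C) \<le> (k + 600) * n" .
    moreover have "PA \<turnstile> Imp (reflect B C) \<psi>" if \<psi>: "true_pi1_sentence \<psi>" "form_length \<psi> \<le> n" for \<psi>
    proof -
      have "code (compile (matrix \<psi>)) 0 \<le> N"
        unfolding N_def by (rule code_matrix) (use \<psi> in \<open>auto simp: true_pi1_sentence_def\<close>)
      then have "Imp (reflect B C) \<psi> \<in> obligations"
        using B C c(2) \<psi>(1) unfolding obligations_def by blast
      then show ?thesis by (rule obligations_provable)
    qed
    ultimately show ?thesis using true by blast
  qed
  then show ?thesis by blast
qed

end
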